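(* Let $c>0$. Let $a_0$ be a positive integer that has a prime factor at most $(\log N)^{1-c}$, and let $a_1,\dots,a_d\in[N]$ be distinct positive integers such that $H(a_0;a_1,\dots,a_d)$ is contained in the set of perfect powers. Then $d\ll_c(\log N)^{1-c'}$, where $c'>0$ depends only on $c$.
   Context: $H(a_0;a_1,\dots,a_d)=a_0+\{0,a_1\}+\cdots+\{0,a_d\}$. A perfect power is an integer $x^m$ with $x,m$ positive integers, $m\ge2$. $[N]=\{1,\dots,N\}$. $X\ll_cY$ means $|X|\le C_cY$ with $C_c$ depending only on $c$. *)

theory Defs
  imports Complex_Main "HOL-Library.Set_Algebras" "HOL-Computational_Algebra.Primes"
begin

text \<open>Sums of sets are Minkowski sums, as in the theory \<open>Set_Algebras\<close>; the generators are
  the values \<open>a 1, ..., a d\<close>, other values of \<open>a\<close> being irrelevant.\<close>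

definition hilbert_cube :: "nat \<Rightarrow> (nat \<Rightarrow> nat) \<Rightarrow> nat \<Rightarrow> nat set" where
  "hilbert_cube a0 a d = a0 +o (\<Sum>i = 1..d. {0, a i})"

definition perfect_powers :: "nat set" where
  "perfect_powers = {x ^ m | x m :: nat. 0 < x \<and> 2 \<le> m}"

end

(*
A perfect power divisible by a prime q is divisible by q^2.  Hence all but 2 q of the a_i are
divisible by q.  Take the prime p dividing a_0 and let k be the least p-adic valuation of a_0 and
of the a_i that are divisible by p; then 0 < k <= log N / log 2, and the elements of the cube of
valuation k are m-th powers for prime divisors m of k.

The subset sums of the a_i number at least d^2.49: otherwise they are almost invariant under a
progression longer than d^1.005, and then there are more primes q, each excluding some elements
with q || x from the cube, than the few exceptions to invariance permit.

On the other hand, fix s = O(log d) sums b_i divisible by p^(k+1), and consider the sums c such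
that all X + b_i + c have valuation k.  A class of such c on which the exponents m_i for i in I
are prescribed is small as soon as the product of the m_i exceeds d^1.003: by the pigeonhole
principle some combination of products of the integers (X + b_i + c)^(1/m_i) with integer
coefficients is smaller than 1 in absolute value, hence 0, on the class, and such a combination
has few zeros.  The number of classes is controlled by the convergence of the sum of
p^(-29/20) over the primes p to a value at most 1, so that there are at most about d^2.47 sums c.
*)

theory Submission
  imports Defs "HOL-Complex_Analysis.Complex_Analysis" "HOL-Number_Theory.Cong" "HOL-Real_Asymp.Real_Asymp"
begin

subsection \<open>Subset sums of perfect-power cubes modulo primes\<close>

text \<open>Two exponents compete. If the subset sums number d^(2+a), the almost-invariance
  argument, run with relative defect about (log d)/d, leaves up to logarithms and small powers d^a
  exceptions in a progression slightly longer than d. The square of this must stay below the number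
  of primes up to that length, so any a < 1/2 is admissible. On the other side a class has about as
  many points as the product of its exponents, which is about d, and there are about d^rho words of
  primes with such a product as soon as the sum of p^(-rho) over the primes is at most 1. The proof
  thus needs some rho < 3/2 with this property; 29/20 is a choice that admits a numerical check. The
  excesses 0.001 to 0.008 in the exponents absorb logarithms and a log N that is slightly larger
  than d.

  The prime p fixes the valuation and so restricts all exponents to the prime factors of one number
  k = O(log N), of which only boundedly many exceed a given small power of d. The size of p matters
  because each multiple of p^(k+1) is built from p generators.\<close>

definition subset_sums :: "'a::comm_monoid_add set \<Rightarrow> 'a set" where
  "subset_sums A = \<Sum> ` Pow A"

lemma subset_sumsI: "S \<subseteq> A \<Longrightarrow> \<Sum>S \<in> subset_sums A"
  by (auto simp: subset_sums_def)

lemma zero_in_subset_sums [simp]: "0 \<in> subset_sums A"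
  using subset_sumsI[of "{}" A] by simp

lemma finite_subset_sums [simp]: "finite A \<Longrightarrow> finite (subset_sums A)"
  by (simp add: subset_sums_def)

lemma subset_sums_mono: "A \<subseteq> B \<Longrightarrow> subset_sums A \<subseteq> subset_sums B"
  by (auto simp: subset_sums_def)

lemma subset_sums_empty [simp]: "subset_sums {} = {0}"
  by (simp add: subset_sums_def)

lemma subset_sums_insert:
  assumes "finite A" "a \<notin> A"
  shows "subset_sums (insert a A) = subset_sums A \<union> (+) a ` subset_sums A"
proof -
  have "\<Sum> ` insert a ` Pow A = (+) a ` \<Sum> ` Pow A"
    unfolding image_image
  proof (rule image_cong[OF refl])
    fix S assume "S \<in> Pow A"
    then have "finite S" "a \<notin> S" using assms finite_subset by auto
    then show "\<Sum> (insert a S) = a + \<Sum> S" by simp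
  qed
  then show ?thesis
    by (simp add: subset_sums_def Pow_insert image_Un)
qed

lemma subset_sums_Un:
  assumes "finite A" "finite B" "A \<inter> B = {}" "x \<in> subset_sums A" "y \<in> subset_sums B"
  shows "x + y \<in> subset_sums (A \<union> B)"
proof -
  obtain S T where S: "S \<subseteq> A" "x = \<Sum>S" and T: "T \<subseteq> B" "y = \<Sum>T"
    using assms(4,5) by (auto simp: subset_sums_def)
  have "\<Sum>(S \<union> T) = \<Sum>S + \<Sum>T"
    using S T assms by (intro sum.union_disjoint) (auto intro: finite_subset)
  then show ?thesis using S T subset_sumsI[of "S \<union> T" "A \<union> B"] by auto
qed

lemma hilbert_cube_eq:
  assumes "inj_on a {1..d}"
  shows "hilbert_cube a0 a d = (+) a0 ` subset_sums (a ` {1..d})"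
proof -
  have "(\<Sum>i = 1..d. {0, a i}) = subset_sums (a ` {1..d})" using assms
  proof (induction d)
    case 0 then show ?case by (simp add: set_zero)
  next
    case (Suc d)
    have inj: "inj_on a {1..d}" using Suc.prems by (rule inj_on_subset) auto
    have new: "a (Suc d) \<notin> a ` {1..d}"
    proof
      assume "a (Suc d) \<in> a ` {1..d}"
      then obtain i where "i \<in> {1..d}" "a (Suc d) = a i" by auto
      then show False using inj_onD[OF Suc.prems, of "Suc d" i] by auto
    qed
    have "(\<Sum>i = 1..Suc d. {0, a i}) = subset_sums (a ` {1..d}) + {0, a (Suc d)}"
      using Suc.IH[OF inj] by simp
    also have "\<dots> = subset_sums (a ` {1..d}) \<union> (+) (a (Suc d)) ` subset_sums (a ` {1..d})"
      by (auto simp: set_plus_def image_iff)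
    also have "\<dots> = subset_sums (insert (a (Suc d)) (a ` {1..d}))"
      using new by (simp add: subset_sums_insert)
    also have "insert (a (Suc d)) (a ` {1..d}) = a ` {1..Suc d}"
      by (simp add: atLeastAtMostSuc_conv)
    finally show ?case .
  qed
  then show ?thesis by (auto simp: hilbert_cube_def elt_set_plus_def)
qed

lemma perfect_power_dvd:
  assumes "x \<in> perfect_powers" "prime q" "q dvd x"
  shows "q\<^sup>2 dvd x"
proof -
  obtain y m where x: "x = y ^ m" and m: "2 \<le> m"
    using assms(1) by (auto simp: perfect_powers_def)
  have "q dvd y" using assms(2,3) x prime_dvd_power by blast
  then have "q ^ m dvd x" using x by (simp add: dvd_power_same)
  then show ?thesis using m power_le_dvd by blast
qed

text \<open>If a set of residues is stable under adding a unit, it is everything; so adding one more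
  unit produces at least one new residue.\<close>

lemma residues_subset_sums:
  fixes A :: "nat set"
  assumes "finite A" "n > 0" "\<And>a. a \<in> A \<Longrightarrow> coprime a n"
  shows "min n (card A + 1) \<le> card ((\<lambda>x. x mod n) ` subset_sums A)"
  using assms(1,3)
proof (induction A)
  case empty
  then show ?case using \<open>n > 0\<close> by simp
next
  case (insert a A)
  define S where "S = (\<lambda>x. x mod n) ` subset_sums A"
  define T where "T = (\<lambda>x. x mod n) ` subset_sums (insert a A)"
  have finS: "finite S" "finite T" using insert by (auto simp: S_def T_def)
  have T: "T = S \<union> (\<lambda>x. (a + x) mod n) ` S"
    unfolding T_def S_def using insert.hyps
    by (subst subset_sums_insert) (auto simp: image_Un image_image mod_add_right_eq)
  have IH: "min n (card A + 1) \<le> card S" using insert by (simp add: S_def)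
  have Sn: "S \<subseteq> {..<n}" using \<open>n > 0\<close> by (auto simp: S_def)
  show ?case
  proof (cases "T = S")
    case False
    then have "S \<subset> T" using T by blast
    then have "card S < card T" using finS by (simp add: psubset_card_mono)
    then show ?thesis using IH insert.hyps by (simp flip: T_def)
  next
    case True
    have step: "(a + x) mod n \<in> S" if "x \<in> S" for x using T True that by auto
    have all: "(k * a) mod n \<in> S" for k
    proof (induction k)
      case 0
      have "0 mod n \<in> S" unfolding S_def by (intro imageI) simp
      then show ?case by simp
    next
      case (Suc k)
      have "(a + (k * a) mod n) mod n \<in> S" by (rule step[OF Suc])
      then show ?case by (simp add: mod_add_right_eq)
    qed
    have "{..<n} \<subseteq> S"
    proof
      fix y assume "y \<in> {..<n}"
      obtain k where "[a * k = y] (mod n)"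
        using insert.prems[of a] cong_solve_dvd_nat[of a n y] by auto
      then have "(k * a) mod n = y" using \<open>y \<in> {..<n}\<close> by (simp add: unique_euclidean_semiring_class.cong_def mult.commute)
      then show "y \<in> S" using all[of k] by simp
    qed
    then have "card S = n" using Sn by (metis card_lessThan subset_antisym)
    then show ?thesis using True by (simp flip: T_def)
  qed
qed

text \<open>More than \<open>q\<close> residues modulo \<open>q\<^sup>2\<close> force two sums that agree modulo \<open>q\<close> but not
  modulo \<open>q\<^sup>2\<close>; completing both to multiples of \<open>q\<close> makes one of them a multiple of \<open>q\<close>
  but not of \<open>q\<^sup>2\<close>.\<close>

lemma card_not_dvd_less:
  fixes A :: "nat set"
  assumes "finite A" "prime q" "(+) a0 ` subset_sums A \<subseteq> perfect_powers"
  shows "card {a \<in> A. \<not> q dvd a} < 2 * q"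
proof (rule ccontr)
  assume "\<not> ?thesis"
  then obtain U where U: "U \<subseteq> {a \<in> A. \<not> q dvd a}" "card U = 2 * q"
    using obtain_subset_with_card_n by (metis not_less)
  have finU: "finite U" using U(1) assms(1) by (auto intro: finite_subset)
  obtain V where V: "V \<subseteq> U" "card V = q"
    using obtain_subset_with_card_n[of q U] U(2) by auto
  have finV: "finite V" using V finU finite_subset by blast
  define W where "W = U - V"
  have W: "card W = q" "finite W" using U V finU finV by (auto simp: W_def card_Diff_subset)
  have q: "q > 1" using assms(2) prime_gt_1_nat by blast
  have cop: "coprime a q" if "a \<in> U" for a
    using that U assms(2) prime_imp_coprime[of q a] by (auto simp: coprime_commute)
  have "min q (card V + 1) \<le> card ((\<lambda>x. x mod q) ` subset_sums V)"
    using cop V q finV by (intro residues_subset_sums) auto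
  then have cV: "q \<le> card ((\<lambda>x. x mod q) ` subset_sums V)" using V by simp
  have subV: "(\<lambda>x. x mod q) ` subset_sums V \<subseteq> {..<q}" using q by auto
  have fullV: "(\<lambda>x. x mod q) ` subset_sums V = {..<q}"
    using card_seteq[OF _ subV] cV by simp
  have "min (q\<^sup>2) (card W + 1) \<le> card ((\<lambda>x. x mod q\<^sup>2) ` subset_sums W)"
    using cop W q by (intro residues_subset_sums) (auto simp: W_def)
  moreover have "q + 1 \<le> q\<^sup>2"
    using mult_le_mono1[of 2 q q] q unfolding power2_eq_square by linarith
  ultimately have cW: "q + 1 \<le> card ((\<lambda>x. x mod q\<^sup>2) ` subset_sums W)" using W by simp
  let ?R = "(\<lambda>x. x mod q\<^sup>2) ` subset_sums W"
  have "\<not> inj_on (\<lambda>r. r mod q) ?R"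
  proof
    assume "inj_on (\<lambda>r. r mod q) ?R"
    then have "card ?R = card ((\<lambda>r. r mod q) ` ?R)" by (simp add: card_image)
    also have "\<dots> \<le> card {..<q}" using q by (intro card_mono) auto
    finally show False using cW by simp
  qed
  then obtain s t where st: "s \<in> subset_sums W" "t \<in> subset_sums W" "s mod q\<^sup>2 \<noteq> t mod q\<^sup>2"
    "(s mod q\<^sup>2) mod q = (t mod q\<^sup>2) mod q" by (auto simp: inj_on_def)
  then have stq: "s mod q = t mod q" by (simp add: mod_mod_cancel)
  obtain v where v: "v \<in> subset_sums V" "v mod q = (q - (a0 + s) mod q) mod q"
  proof -
    have "(q - (a0 + s) mod q) mod q \<in> (\<lambda>x. x mod q) ` subset_sums V"
      using fullV q by simp
    then show ?thesis using that by force
  qed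
  have "(a0 + s + v) mod q = ((a0 + s) mod q + v mod q) mod q" by (simp add: mod_add_eq)
  also have "\<dots> = ((a0 + s) mod q + (q - (a0 + s) mod q)) mod q"
    unfolding v(2) by (simp add: mod_add_right_eq)
  also have "\<dots> = 0" using q by (simp add: less_imp_le)
  finally have d1: "q dvd a0 + s + v" by (simp add: dvd_eq_mod_eq_0)
  have "(a0 + s + v) mod q = (a0 + t + v) mod q"
    using stq by (metis mod_add_cong)
  then have d2: "q dvd a0 + t + v" using d1 by (simp add: dvd_eq_mod_eq_0)
  have mem: "a0 + x + v \<in> perfect_powers" if "x \<in> subset_sums W" for x
  proof -
    have "x + v \<in> subset_sums (W \<union> V)"
      using that v W finV by (intro subset_sums_Un) (auto simp: W_def)
    then have "x + v \<in> subset_sums A"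
      using subset_sums_mono[of "W \<union> V" A] U V by (auto simp: W_def)
    then show ?thesis using assms(3) by (auto simp: image_subset_iff add.assoc)
  qed
  have "q\<^sup>2 dvd a0 + s + v" "q\<^sup>2 dvd a0 + t + v"
    using perfect_power_dvd[OF mem assms(2)] st d1 d2 by auto
  then have "[a0 + s + v = a0 + t + v] (mod q\<^sup>2)" by (simp add: unique_euclidean_semiring_class.cong_def dvd_eq_mod_eq_0)
  then have "[s = t] (mod q\<^sup>2)"
    by (simp add: cong_add_lcancel_nat cong_add_rcancel_nat)
  then show False using st by (simp add: unique_euclidean_semiring_class.cong_def)
qed

text \<open>Two of the \<open>n + 1\<close> prefix sums of an enumeration of \<open>G\<close> agree
  modulo \<open>n\<close>, and the block between them is the subset.\<close>

lemma zero_sum_subset: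
  fixes f :: "'a \<Rightarrow> nat"
  assumes "finite G" "card G = n" "n > 0"
  obtains S where "S \<subseteq> G" "S \<noteq> {}" "n dvd sum f S"
proof -
  obtain g where g: "bij_betw g {..<n} G"
    using assms by (metis atLeast0LessThan ex_bij_betw_nat_finite)
  define P where "P = (\<lambda>i. (\<Sum>k<i. f (g k)) mod n)"
  have "\<not> inj_on P {..n}"
  proof
    assume "inj_on P {..n}"
    then have "card {..n} \<le> card {..<n}"
      by (intro card_inj_on_le[of P]) (auto simp: P_def \<open>n > 0\<close>)
    then show False by simp
  qed
  then obtain i0 j0 where ij0: "i0 \<le> n" "j0 \<le> n" "i0 \<noteq> j0" "P i0 = P j0" by (auto simp: inj_on_def)
  then obtain i j where ij: "i < j" "j \<le> n" "P i = P j" by (metis linorder_neqE_nat)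
  define S where "S = g ` {i..<j}"
  have inj: "inj_on g {i..<j}" using g ij
    by (auto simp: bij_betw_def intro: inj_on_subset)
  have "(\<Sum>k<j. f (g k)) = (\<Sum>k<i. f (g k)) + (\<Sum>k=i..<j. f (g k))"
    using ij by (metis lessThan_atLeast0 less_imp_le sum.atLeastLessThan_concat zero_le)
  then have "n dvd (\<Sum>k=i..<j. f (g k))"
    using ij(3) by (simp add: P_def) (metis add_diff_cancel_left' le_add1 mod_eq_dvd_iff_nat)
  then have "n dvd sum f S" using inj by (simp add: S_def sum.reindex)
  moreover have "S \<subseteq> G" using g ij by (auto simp: S_def bij_betw_def)
  moreover have "S \<noteq> {}" using ij by (simp add: S_def)
  ultimately show ?thesis using that by blast
qed

subsection \<open>Shift defects and growth of subset sums\<close>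

text \<open>This measures how far \<open>h\<close> is from being a period of \<open>B\<close>. It is
  even and subadditive in \<open>h\<close>, like a length; integers are used because negative shifts
  occur.\<close>

definition shift_defect :: "int set \<Rightarrow> int \<Rightarrow> nat" where
  "shift_defect B h = card {b \<in> B. b + h \<notin> B}"

lemma shift_defect_0 [simp]: "shift_defect B 0 = 0"
  by (simp add: shift_defect_def)

lemma shift_defect_add:
  assumes "finite B"
  shows "shift_defect B (x + y) \<le> shift_defect B x + shift_defect B y"
proof -
  have "{b \<in> B. b + (x + y) \<notin> B} \<subseteq>
      {b \<in> B. b + x \<notin> B} \<union> (\<lambda>b. b - x) ` {b \<in> B. b + y \<notin> B}"
  proof
    fix b assume b: "b \<in> {b \<in> B. b + (x + y) \<notin> B}"
    show "b \<in> {b \<in> B. b + x \<notin> B} \<union> (\<lambda>b. b - x) ` {b \<in> B. b + y \<notin> B}"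
    proof (cases "b + x \<in> B")
      case True
      then have "b + x \<in> {b \<in> B. b + y \<notin> B}" using b by (simp add: add.assoc)
      then have "(b + x) - x \<in> (\<lambda>b. b - x) ` {b \<in> B. b + y \<notin> B}" by (rule imageI)
      then show ?thesis by simp
    qed (use b in auto)
  qed
  then have "shift_defect B (x + y) \<le>
      card ({b \<in> B. b + x \<notin> B} \<union> (\<lambda>b. b - x) ` {b \<in> B. b + y \<notin> B})"
    unfolding shift_defect_def using assms by (intro card_mono) auto
  also have "\<dots> \<le> card {b \<in> B. b + x \<notin> B} + card ((\<lambda>b. b - x) ` {b \<in> B. b + y \<notin> B})"
    by (rule card_Un_le)
  also have "card ((\<lambda>b. b - x) ` {b \<in> B. b + y \<notin> B}) \<le> card {b \<in> B. b + y \<notin> B}"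
    using assms by (intro card_image_le) auto
  finally show ?thesis by (simp add: shift_defect_def)
qed

lemma shift_defect_eq:
  assumes "finite B"
  shows "shift_defect B x + card {b \<in> B. b + x \<in> B} = card B"
proof -
  have "{b \<in> B. b + x \<notin> B} \<union> {b \<in> B. b + x \<in> B} = B" by auto
  then show ?thesis unfolding shift_defect_def
    using card_Un_disjoint[of "{b \<in> B. b + x \<notin> B}" "{b \<in> B. b + x \<in> B}"] assms
    by fastforce
qed

lemma shift_defect_minus:
  assumes "finite B"
  shows "shift_defect B (- x) = shift_defect B x"
proof -
  have "bij_betw (\<lambda>b. b + x) {b \<in> B. b + x \<in> B} {b \<in> B. b + - x \<in> B}"
    by (rule bij_betwI[where g = "\<lambda>b. b - x"]) auto
  then have "card {b \<in> B. b + x \<in> B} = card {b \<in> B. b + - x \<in> B}"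
    by (rule bij_betw_same_card)
  then show ?thesis using shift_defect_eq[OF assms, of x] shift_defect_eq[OF assms, of "- x"] by linarith
qed

text \<open>Each such \<open>x\<close> accounts for at least \<open>card B / 2\<close> pairs
  \<open>(b, b + h * x)\<close> in \<open>B \<times> B\<close>, and different \<open>x\<close> give
  different pairs.\<close>

lemma card_small_shift_defect:
  assumes "finite B" "B \<noteq> {}" "h \<noteq> 0"
  defines "X \<equiv> {x. 2 * shift_defect B (h * x) \<le> card B}"
  shows "finite X \<and> card X \<le> 2 * card B"
proof -
  have sub: "card Y \<le> 2 * card B" if "finite Y" "Y \<subseteq> X" for Y
  proof -
    have "card Y * card B = (\<Sum>x\<in>Y. card B)" by simp
    also have "\<dots> \<le> (\<Sum>x\<in>Y. 2 * card {b \<in> B. b + h * x \<in> B})"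
    proof (rule sum_mono)
      fix x assume "x \<in> Y"
      then have "2 * shift_defect B (h * x) \<le> card B" using that by (auto simp: X_def)
      then show "card B \<le> 2 * card {b \<in> B. b + h * x \<in> B}"
        using shift_defect_eq[OF assms(1), of "h * x"] by linarith
    qed
    also have "\<dots> = 2 * (\<Sum>x\<in>Y. card {b \<in> B. b + h * x \<in> B})" by (simp add: sum_distrib_left)
    also have "(\<Sum>x\<in>Y. card {b \<in> B. b + h * x \<in> B}) = card (SIGMA x:Y. {b \<in> B. b + h * x \<in> B})"
      using assms(1) that(1) by simp
    also have "\<dots> \<le> card (B \<times> B)"
      by (rule card_inj_on_le[of "\<lambda>(x, b). (b, b + h * x)"])
        (use assms(1,3) in \<open>auto simp: inj_on_def\<close>)
    finally have "card Y * card B \<le> (2 * card B) * card B" by (simp add: card_cartesian_product)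
    then show ?thesis using assms(1,2) by (simp add: card_gt_0_iff)
  qed
  have "finite X"
  proof (rule ccontr)
    assume "infinite X"
    then obtain Y where "Y \<subseteq> X" "finite Y" "card Y = Suc (2 * card B)"
      using infinite_arbitrarily_large by blast
    then show False using sub[of Y] by simp
  qed
  then show ?thesis using sub[of X] by simp
qed

text \<open>The sums gained are the translates by \<open>a\<close> of those sums that leave the set.
  Slow growth therefore means small defects.\<close>

lemma card_subset_sums_insert:
  fixes a :: nat
  assumes "finite S" "a \<notin> S"
  shows "card (subset_sums (insert a S)) =
    card (subset_sums S) + shift_defect (int ` subset_sums S) (int a)"
proof -
  let ?X = "subset_sums S"
  have "card (subset_sums (insert a S)) = card (?X \<union> ((+) a ` ?X - ?X))"
    using assms by (simp add: subset_sums_insert)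
  also have "\<dots> = card ?X + card ((+) a ` ?X - ?X)"
    using assms by (intro card_Un_disjoint) auto
  also have "card ((+) a ` ?X - ?X) = card ((\<lambda>x. int x) ` {x \<in> ?X. a + x \<notin> ?X})"
  proof -
    have "(+) a ` ?X - ?X = (+) a ` {x \<in> ?X. a + x \<notin> ?X}" by auto
    then show ?thesis by (simp add: card_image)
  qed
  also have "int ` {x \<in> ?X. a + x \<notin> ?X} = {b \<in> int ` ?X. b + int a \<notin> int ` ?X}"
  proof -
    have "int x + int a \<in> int ` ?X \<longleftrightarrow> a + x \<in> ?X" for x
      by (metis (mono_tags, lifting) add.commute image_iff of_nat_add of_nat_eq_iff)
    then show ?thesis by auto
  qed
  finally show ?thesis by (simp add: shift_defect_def)
qed

text \<open>Greedy choice: inserting a generator of defect above the fraction \<open>r\<close>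
  multiplies the number of sums by more than \<open>1 + r\<close>. If this gets stuck early, all
  remaining generators are almost periods.\<close>

lemma subset_sums_growth_dichotomy:
  fixes A :: "nat set" and r :: real
  assumes "finite A" "n \<le> card A" "r \<ge> 0"
  shows "(\<exists>S\<subseteq>A. card S = n \<and> (1 + r) ^ n \<le> real (card (subset_sums S))) \<or>
    (\<exists>S\<subseteq>A. card S < n \<and>
      (\<forall>a\<in>A - S. shift_defect (int ` subset_sums S) (int a) \<le> r * card (subset_sums S)))"
  using assms(2)
proof (induction n)
  case 0
  show ?case by (intro disjI1 exI[of _ "{}"]) simp
next
  case (Suc n)
  show ?case
  proof (cases "\<exists>S\<subseteq>A. card S < n \<and>
      (\<forall>a\<in>A - S. shift_defect (int ` subset_sums S) (int a) \<le> r * card (subset_sums S))")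
    case True
    then show ?thesis using less_SucI by blast
  next
    case False
    then obtain S where S: "S \<subseteq> A" "card S = n" "(1 + r) ^ n \<le> real (card (subset_sums S))"
      using Suc by auto
    have finS: "finite S" using S(1) assms(1) finite_subset by blast
    show ?thesis
    proof (cases "\<forall>a\<in>A - S. shift_defect (int ` subset_sums S) (int a) \<le> r * card (subset_sums S)")
      case True
      then show ?thesis using S by blast
    next
      case False
      then obtain a where a: "a \<in> A" "a \<notin> S"
        "shift_defect (int ` subset_sums S) (int a) > r * card (subset_sums S)" by auto
      have "(1 + r) ^ Suc n \<le> (1 + r) * card (subset_sums S)"
        using S(3) assms(3) by (simp add: mult_left_mono)
      also have "\<dots> \<le> real (card (subset_sums (insert a S)))"
        using a card_subset_sums_insert[OF finS a(2)] by (simp add: algebra_simps)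
      finally show ?thesis using a S finS by (intro disjI1 exI[of _ "insert a S"]) simp
    qed
  qed
qed

text \<open>The ball of radius \<open>i\<close> about 0 in the word metric of the generators
  \<open>G\<close>, with both signs allowed.\<close>

fun int_ball :: "int set \<Rightarrow> nat \<Rightarrow> int set" where
  "int_ball G 0 = {0}"
| "int_ball G (Suc i) = int_ball G i \<union> (\<Union>g\<in>G. (\<lambda>x. x + g) ` int_ball G i \<union> (\<lambda>x. x - g) ` int_ball G i)"

text \<open>The generators are considered modulo the largest of them: a ball that fills all residues
  controls \<open>f\<close> on a long interval, and the growth of balls by at least \<open>card G - 1\<close> every three
  steps shows that this happens early.\<close>

locale subadditive_ball =
  fixes f :: "int \<Rightarrow> real" and G :: "int set" and n :: int and \<epsilon> :: real and V w :: nat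
  assumes f_0: "f 0 = 0"
    and f_add: "f (x + y) \<le> f x + f y"
    and f_minus: "f (- x) = f x"
    and f_G: "g \<in> G \<Longrightarrow> f g \<le> \<epsilon>"
    and G: "0 \<in> G" "n \<in> G" "G \<subseteq> {0..n}" "Gcd G = 1" "card G = Suc w"
    and n_pos: "n > 0"
    and fin: "finite {x. f x \<le> 1 / 2}"
    and V: "card {x. f x \<le> 1 / 2} \<le> V"
begin

section \<open>Growth of balls in the residues modulo the largest generator\<close>

definition residue_ball :: "nat \<Rightarrow> int set" where
  "residue_ball i = (\<lambda>x. x mod n) ` int_ball G i"

lemma eps_nonneg: "\<epsilon> \<ge> 0"
  using f_0 f_G[OF G(1)] by simp

lemma ball_bounds: "x \<in> int_ball G i \<Longrightarrow> f x \<le> i * \<epsilon> \<and> \<bar>x\<bar> \<le> i * n"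
proof (induction i arbitrary: x)
  case 0
  then show ?case using f_0 by simp
next
  case (Suc i)
  consider "x \<in> int_ball G i" | y g where "g \<in> G" "y \<in> int_ball G i" "x = y + g"
    | y g where "g \<in> G" "y \<in> int_ball G i" "x = y - g"
    using Suc.prems by auto
  then show ?case
  proof cases
    case 1
    then show ?thesis using Suc.IH[OF 1] eps_nonneg n_pos by (auto simp: algebra_simps)
  next
    case 2
    have "g \<in> {0..n}" using 2 G by auto
    then show ?thesis using Suc.IH[OF 2(2)] f_add[of y g] f_G[OF 2(1)] 2(3)
      by (auto simp: algebra_simps)
  next
    case 3
    have "g \<in> {0..n}" using 3 G by auto
    then show ?thesis using Suc.IH[OF 3(2)] f_add[of y "- g"] f_G[OF 3(1)] f_minus[of g] 3(3)
      by (auto simp: algebra_simps)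
  qed
qed

lemma f_multiple: "f (int u * n) \<le> u * \<epsilon>"
proof (induction u)
  case (Suc u)
  have "f (int (Suc u) * n) \<le> f (int u * n) + f n"
    using f_add[of "int u * n" n] by (simp add: algebra_simps)
  then show ?case using Suc f_G[OF G(2)] by (simp add: algebra_simps)
qed (simp add: f_0)

lemma f_multiple_int: "f (u * n) \<le> \<bar>u\<bar> * \<epsilon>"
proof (cases "u \<ge> 0")
  case True
  then show ?thesis using f_multiple[of "nat u"] by simp
next
  case False
  then show ?thesis using f_multiple[of "nat (- u)"] f_minus[of "u * n"] by simp
qed

lemma residue_ball_sub: "residue_ball i \<subseteq> {0..<n}"
  using n_pos by (auto simp: residue_ball_def)

lemma finite_residue_ball [simp]: "finite (residue_ball i)"
  using residue_ball_sub finite_subset by blast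

lemma residue_ball_mono: "i \<le> j \<Longrightarrow> residue_ball i \<subseteq> residue_ball j"
proof (induction j rule: dec_induct)
  case (step j)
  then show ?case by (auto simp: residue_ball_def)
qed simp

lemma residue_ball_step:
  assumes "c \<in> residue_ball i" "g \<in> G"
  shows "(c + g) mod n \<in> residue_ball (Suc i)" "(c - g) mod n \<in> residue_ball (Suc i)"
proof -
  obtain x where x: "x \<in> int_ball G i" "c = x mod n" using assms(1) by (auto simp: residue_ball_def)
  have "(c + g) mod n = (x + g) mod n" "(c - g) mod n = (x - g) mod n"
    using x(2) by (simp_all add: mod_add_left_eq mod_diff_left_eq)
  moreover have "x + g \<in> int_ball G (Suc i)" "x - g \<in> int_ball G (Suc i)" using x assms(2) by auto
  ultimately show "(c + g) mod n \<in> residue_ball (Suc i)" "(c - g) mod n \<in> residue_ball (Suc i)"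
    unfolding residue_ball_def by (simp_all del: int_ball.simps)
qed

text \<open>The translations that preserve a stable ball in both directions form a group containing
  \<open>G\<close>, and \<open>G\<close> has greatest common divisor 1.\<close>

lemma residue_ball_stable:
  assumes "residue_ball (Suc i) = residue_ball i"
  shows "residue_ball i = {0..<n}"
proof -
  define P where "P = (\<lambda>t. \<forall>c\<in>residue_ball i. (c + t) mod n \<in> residue_ball i)"
  have P_add: "P (s + t)" if "P s" "P t" for s t
    using that unfolding P_def by (metis add.assoc mod_add_left_eq)
  have P_g: "P g" "P (- g)" if "g \<in> G" for g
    using residue_ball_step[OF _ that, of _ i] assms by (auto simp: P_def)
  have P_0: "P 0" unfolding P_def
    using residue_ball_sub by (metis add.right_neutral atLeastLessThan_iff mod_pos_pos_trivial subsetD)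
  have P_mult: "P (int k * t)" if "P t" for k t
    by (induction k) (use that P_0 P_add in \<open>auto simp: algebra_simps\<close>)
  define T where "T = {u::nat. u > 0 \<and> P (int u) \<and> P (- int u)}"
  have nT: "nat n \<in> T" using G(2) n_pos P_g by (simp add: T_def)
  \<comment> \<open>The least positive two-sided period divides every generator: the remainder would
    be a smaller one.\<close>
  define u where "u = (LEAST u. u \<in> T)"
  have uT: "u \<in> T" unfolding u_def using nT by (rule LeastI)
  have u_least: "u \<le> v" if "v \<in> T" for v unfolding u_def using that by (rule Least_le)
  have "int u dvd g" if g: "g \<in> G" for g
  proof -
    have "g \<ge> 0" using g G by auto
    define k where "k = g div int u"
    have "k \<ge> 0" using \<open>g \<ge> 0\<close> using uT by (simp add: k_def T_def pos_imp_zdiv_nonneg_iff)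
    have eq: "g mod int u = g + int (nat k) * (- int u)"
      using \<open>k \<ge> 0\<close> by (simp add: k_def minus_mult_div_eq_mod[symmetric] mult.commute)
    have eq': "- (g mod int u) = - g + int (nat k) * int u"
      using eq by simp
    have Pu: "P (int u)" "P (- int u)" using uT by (simp_all add: T_def)
    have "P (g mod int u)" unfolding eq by (rule P_add[OF P_g(1)[OF g] P_mult[OF Pu(2)]])
    moreover have "P (- (g mod int u))" unfolding eq' by (rule P_add[OF P_g(2)[OF g] P_mult[OF Pu(1)]])
    moreover have "g mod int u \<ge> 0" "g mod int u < int u" using uT by (auto simp: T_def)
    ultimately have "\<not> 0 < g mod int u"
      using u_least[of "nat (g mod int u)"] unfolding T_def by fastforce
    then have "g mod int u = 0" using \<open>g mod int u \<ge> 0\<close> by simp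
    then show ?thesis by (simp add: dvd_eq_mod_eq_0)
  qed
  then have "int u dvd Gcd G" by (simp add: Gcd_greatest)
  then have "u = 1" using G(4) by simp
  then have P1: "P 1" using uT by (simp add: T_def)
  have "{0..<n} \<subseteq> residue_ball i"
  proof
    fix y assume y: "y \<in> {0..<n}"
    have "0 \<in> int_ball G i" by (induction i) auto
    then have "0 mod n \<in> residue_ball i" unfolding residue_ball_def by (rule imageI)
    moreover have "P (int (nat y) * 1)" using P1 by (rule P_mult)
    ultimately show "y \<in> residue_ball i" using y by (auto simp: P_def)
  qed
  then show ?thesis using residue_ball_sub by blast
qed

text \<open>A residue \<open>c\<close> first reached at step \<open>i + 2\<close> has its neighbours
  \<open>c + g\<close> within radius \<open>i + 3\<close>, but none within radius \<open>i\<close>,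
  since \<open>c\<close> would then lie within radius \<open>i + 1\<close>. Modulo \<open>n\<close>
  the generators \<open>0\<close> and \<open>n\<close> coincide, so \<open>card G - 1 = w\<close>
  residues are gained.\<close>

lemma residue_ball_jump:
  assumes "residue_ball (i + 2) \<noteq> {0..<n}"
  shows "card (residue_ball i) + w \<le> card (residue_ball (i + 3))"
proof -
  have sub: "residue_ball (i + 1) \<subseteq> residue_ball (i + 2)" by (rule residue_ball_mono) simp
  have "residue_ball (i + 2) \<noteq> residue_ball (i + 1)"
    using residue_ball_stable[of "i + 1"] assms by auto
  then obtain c where c: "c \<in> residue_ball (i + 2)" "c \<notin> residue_ball (i + 1)" using sub by blast
  have cn: "0 \<le> c" "c < n" using c(1) residue_ball_sub by (meson atLeastLessThan_iff subsetD)+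
  define N where "N = (\<lambda>g. (c + g) mod n) ` (G - {n})"
  have finG: "finite G" using G(3) finite_subset by blast
  have inj: "inj_on (\<lambda>g. (c + g) mod n) (G - {n})"
  proof (rule inj_onI)
    fix x y assume xy: "x \<in> G - {n}" "y \<in> G - {n}" "(c + x) mod n = (c + y) mod n"
    then have "[c + x = c + y] (mod n)" by (simp add: unique_euclidean_semiring_class.cong_def)
    then have "[x = y] (mod n)" by (simp add: cong_add_lcancel)
    moreover have "0 \<le> x" "x < n" "0 \<le> y" "y < n" using xy G(3) by force+
    ultimately show "x = y" by (rule cong_less_imp_eq_int[rotated -1])
  qed
  have cN: "card N = w" unfolding N_def card_image[OF inj] using G finG by simp
  have "N \<subseteq> residue_ball (i + 3)"
    using residue_ball_step(1)[OF c(1)] by (auto simp: N_def numeral_eq_Suc)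
  moreover have "N \<inter> residue_ball i = {}"
  proof (rule ccontr)
    assume "N \<inter> residue_ball i \<noteq> {}"
    then obtain g where g: "g \<in> G" "(c + g) mod n \<in> residue_ball i" by (auto simp: N_def)
    have "((c + g) mod n - g) mod n \<in> residue_ball (Suc i)" by (rule residue_ball_step(2)[OF g(2,1)])
    then show False using c(2) cn by (simp add: mod_diff_left_eq)
  qed
  moreover have "residue_ball i \<subseteq> residue_ball (i + 3)" by (rule residue_ball_mono) simp
  ultimately have "card (residue_ball i \<union> N) \<le> card (residue_ball (i + 3))"
    by (intro card_mono) auto
  moreover have "card (residue_ball i \<union> N) = card (residue_ball i) + card N"
    using \<open>N \<inter> residue_ball i = {}\<close> finG by (intro card_Un_disjoint) (auto simp: N_def)
  ultimately show ?thesis using cN by simp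
qed

lemma residue_ball_growth: "residue_ball (3 * m) \<noteq> {0..<n} \<Longrightarrow> m * w \<le> card (residue_ball (3 * m))"
proof (induction m)
  case (Suc m)
  have "residue_ball (3 * m + 2) \<noteq> {0..<n}" "residue_ball (3 * m) \<noteq> {0..<n}"
    using Suc.prems residue_ball_mono[of "3 * m + 2" "3 * Suc m"] residue_ball_mono[of "3 * m" "3 * Suc m"]
      residue_ball_sub[of "3 * Suc m"] by auto
  then show ?case using residue_ball_jump[of "3 * m"] Suc.IH by (simp add: add.commute)
qed simp

text \<open>Lifts of the residues to the ball, shifted by \<open>0, ..., q\<close> times
  \<open>n\<close>, are distinct integers at which \<open>f\<close> is at most
  \<open>(i + q) * \<epsilon>\<close>.\<close>

lemma residue_ball_volume:
  assumes "(i + q) * \<epsilon> \<le> 1 / 2"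
  shows "(q + 1) * card (residue_ball i) \<le> V"
proof -
  define \<rho> where "\<rho> = inv_into (int_ball G i) (\<lambda>x. x mod n)"
  have \<rho>: "\<rho> c \<in> int_ball G i" "\<rho> c mod n = c" if "c \<in> residue_ball i" for c
    using that inv_into_into[of c "\<lambda>x. x mod n" "int_ball G i"]
      f_inv_into_f[of c "\<lambda>x. x mod n" "int_ball G i"] by (auto simp: \<rho>_def residue_ball_def)
  have "card ({0..q} \<times> residue_ball i) \<le> card {x. f x \<le> 1 / 2}"
  proof (rule card_inj_on_le[of "\<lambda>(u, c). \<rho> c + int u * n"])
    show "inj_on (\<lambda>(u, c). \<rho> c + int u * n) ({0..q} \<times> residue_ball i)"
    proof (rule inj_onI, clarify)
      fix u c u' c'
      assume *: "c \<in> residue_ball i" "c' \<in> residue_ball i" "\<rho> c + int u * n = \<rho> c' + int u' * n"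
      then have "(\<rho> c + int u * n) mod n = (\<rho> c' + int u' * n) mod n" by simp
      then have "c = c'" using \<rho>(2)[OF *(1)] \<rho>(2)[OF *(2)] by simp
      then show "u = u' \<and> c = c'" using * n_pos by simp
    qed
    show "(\<lambda>(u, c). \<rho> c + int u * n) ` ({0..q} \<times> residue_ball i) \<subseteq> {x. f x \<le> 1 / 2}"
    proof clarsimp
      fix u c assume uc: "u \<le> q" "c \<in> residue_ball i"
      have "f (\<rho> c + int u * n) \<le> i * \<epsilon> + u * \<epsilon>"
        using f_add[of "\<rho> c" "int u * n"] ball_bounds[OF \<rho>(1)[OF uc(2)]] f_multiple[of u] by linarith
      also have "\<dots> \<le> (i + q) * \<epsilon>" using uc(1) eps_nonneg by (simp add: algebra_simps mult_left_mono)
      finally show "f (\<rho> c + int u * n) * 2 \<le> 1" using assms by simp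
    qed
  qed (rule fin)
  then show ?thesis using V by (simp add: card_cartesian_product)
qed

text \<open>If radius \<open>3 * m\<close> missed a residue, the ball would have
  \<open>m * w\<close> residues, against the volume bound at radius \<open>t\<close>. Hence
  \<open>x\<close> is a ball element plus a multiple of \<open>n\<close> by at most
  \<open>q + 3 * m\<close>.\<close>

lemma small_on_interval:
  assumes "3 * m \<le> t" "2 * t * \<epsilon> \<le> 1 / 2" "V < (t + 1) * (m * w)" "0 \<le> x" "x \<le> int q * n"
  shows "f x \<le> (6 * m + q) * \<epsilon>"
proof -
  have full: "residue_ball (3 * m) = {0..<n}"
  proof (rule ccontr)
    assume "residue_ball (3 * m) \<noteq> {0..<n}"
    then have "m * w \<le> card (residue_ball (3 * m))" by (rule residue_ball_growth)
    also have "\<dots> \<le> card (residue_ball t)" using residue_ball_mono[OF assms(1)] by (intro card_mono) auto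
    finally have "(t + 1) * (m * w) \<le> (t + 1) * card (residue_ball t)" by (rule mult_le_mono2)
    also have "\<dots> \<le> V" using residue_ball_volume[of t t] assms(2) by (simp add: algebra_simps)
    finally show False using assms(3) by simp
  qed
  have "x mod n \<in> residue_ball (3 * m)" using full n_pos by simp
  then obtain y where y: "y \<in> int_ball G (3 * m)" "x mod n = y mod n" by (auto simp: residue_ball_def)
  obtain u where u: "x - y = n * u" using y(2) by (metis dvd_def mod_eq_dvd_iff)
  have yb: "f y \<le> (3 * m) * \<epsilon>" "\<bar>y\<bar> \<le> (3 * m) * n" using ball_bounds[OF y(1)] by auto
  have "\<bar>u\<bar> * n = \<bar>x - y\<bar>" using u n_pos by (simp add: abs_mult mult.commute)
  also have "\<dots> \<le> (int q + int (3 * m)) * n" using yb(2) assms(4,5) by (simp add: algebra_simps)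
  finally have "\<bar>u\<bar> \<le> int q + int (3 * m)" using n_pos by simp
  then have ub: "real_of_int \<bar>u\<bar> \<le> q + 3 * m" by linarith
  have "f x \<le> f y + f (u * n)" using f_add[of y "u * n"] u by (simp add: algebra_simps)
  also have "\<dots> \<le> (3 * m) * \<epsilon> + \<bar>u\<bar> * \<epsilon>" using yb f_multiple_int[of u] by simp
  also have "\<dots> \<le> (3 * m) * \<epsilon> + (q + 3 * m) * \<epsilon>"
    using ub eps_nonneg by (intro add_left_mono mult_right_mono) auto
  finally show ?thesis by (simp add: algebra_simps)
qed

end

text \<open>The pairs \<open>(b, x)\<close> with \<open>b + h * x\<close> outside \<open>B\<close>
  are counted by \<open>x\<close> through the defects; some \<open>b\<close> does no worse than the
  average.\<close>

lemma exists_long_near_progression: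
  fixes B :: "int set" and \<rho> :: real
  assumes "finite B" "B \<noteq> {}" "\<And>x. x < k \<Longrightarrow> real (shift_defect B (h * int x)) \<le> \<rho> * card B"
  obtains b where "b \<in> B" "real (card {x. x < k \<and> b + h * int x \<notin> B}) \<le> \<rho> * k"
proof -
  have "(\<Sum>b\<in>B. card {x. x < k \<and> b + h * int x \<notin> B}) =
      card (SIGMA b:B. {x. x < k \<and> b + h * int x \<notin> B})"
    using assms(1) by simp
  also have "\<dots> = card (SIGMA x:{..<k}. {b \<in> B. b + h * int x \<notin> B})"
    by (rule bij_betw_same_card[of prod.swap]) (auto intro!: bij_betwI[where g = prod.swap])
  also have "\<dots> = (\<Sum>x<k. shift_defect B (h * int x))"
    using assms(1) by (simp add: shift_defect_def)
  finally have "real (\<Sum>b\<in>B. card {x. x < k \<and> b + h * int x \<notin> B}) =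
      (\<Sum>x<k. real (shift_defect B (h * int x)))" by simp
  also have "\<dots> \<le> (\<Sum>x<k. \<rho> * card B)" using assms(3) by (intro sum_mono) auto
  finally have le: "(\<Sum>b\<in>B. real (card {x. x < k \<and> b + h * int x \<notin> B})) \<le> (\<Sum>b\<in>B. \<rho> * k)"
    by (simp add: algebra_simps)
  have "\<exists>b\<in>B. real (card {x. x < k \<and> b + h * int x \<notin> B}) \<le> \<rho> * k"
  proof (rule ccontr)
    assume "\<not> ?thesis"
    then have "(\<Sum>b\<in>B. \<rho> * k) < (\<Sum>b\<in>B. real (card {x. x < k \<and> b + h * int x \<notin> B}))"
      using assms(1,2) by (intro sum_strict_mono) auto
    then show False using le by simp
  qed
  then show ?thesis using that by blast
qed

text \<open>Every prime \<open>q\<close> contributes a pair of exceptional indices whose difference is divisible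
  by \<open>q\<close>; as the difference is below the product of any two of the primes, the pair
  determines \<open>q\<close>.\<close>

lemma card_primes_le_exceptions:
  fixes h b k :: nat
  assumes fin: "finite P"
    and P: "\<And>q. q \<in> P \<Longrightarrow> prime q \<and> 2 < q \<and> \<not> q dvd h \<and> 3 * q \<le> k \<and> k \<le> q\<^sup>2"
    and B: "(+) a0 ` B \<subseteq> perfect_powers"
  shows "card P \<le> (card {x. x < k \<and> b + h * x \<notin> B})\<^sup>2"
proof -
  define U where "U = {x. x < k \<and> b + h * x \<notin> B}"
  have finU: "finite U" by (simp add: U_def)
  have "\<exists>x y. x \<in> U \<and> y \<in> U \<and> x < y \<and> q dvd y - x" if q: "q \<in> P" for q
  proof -
    have qp: "prime q" "2 < q" "\<not> q dvd h" "3 * q \<le> k" "k \<le> q\<^sup>2" using P[OF q] by auto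
    have "coprime h q" using qp prime_imp_coprime[of q h] by (simp add: coprime_commute)
    then obtain x' where x': "[h * x' = (q - (a0 + b) mod q)] (mod q)"
      using cong_solve_dvd_nat[of h q] by auto
    define x where "x = x' mod q"
    have xq: "x < q" using qp by (simp add: x_def)
    have "[h * x = h * x'] (mod q)" unfolding x_def by (simp add: unique_euclidean_semiring_class.cong_def mod_mult_right_eq)
    then have "[h * x = (q - (a0 + b) mod q)] (mod q)" using x' cong_trans by blast
    then have "[(a0 + b) + h * x = (a0 + b) mod q + (q - (a0 + b) mod q)] (mod q)"
      by (intro cong_add) (auto simp: unique_euclidean_semiring_class.cong_def)
    then have "[(a0 + b) + h * x = 0] (mod q)"
      using qp by (simp add: unique_euclidean_semiring_class.cong_def less_imp_le)
    then have d: "q dvd a0 + b + h * x" by (simp add: cong_0_iff)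
    have di: "q dvd a0 + b + h * (x + i * q)" for i
    proof -
      have "a0 + b + h * (x + i * q) = (a0 + b + h * x) + q * (h * i)" by (simp add: algebra_simps)
      then show ?thesis using d by (metis dvd_add dvd_triv_left)
    qed
    \<comment> \<open>The indices \<open>x\<close>, \<open>x + q\<close>, \<open>x + 2 * q\<close>
      lie below \<open>3 * q \<le> k\<close>. Two of the values differ by \<open>q * h\<close> or
      \<open>2 * q * h\<close>, not divisible by \<open>q ^ 2\<close> as \<open>q > 2\<close>, so at
      least two of the three indices are exceptions.\<close>
    have notsq: "\<not> (q\<^sup>2 dvd a0 + b + h * (x + i * q) \<and> q\<^sup>2 dvd a0 + b + h * (x + j * q))"
      if "i < j" "j \<le> 2" for i j
    proof
      assume *: "q\<^sup>2 dvd a0 + b + h * (x + i * q) \<and> q\<^sup>2 dvd a0 + b + h * (x + j * q)"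
      have "(a0 + b + h * (x + j * q)) - (a0 + b + h * (x + i * q)) = q * (h * (j - i))"
        using that by (simp add: algebra_simps diff_mult_distrib2)
      then have "q * q dvd q * (h * (j - i))"
        using * dvd_diff_nat power2_eq_square by metis
      then have "q dvd h * (j - i)" using qp by simp
      then have "q dvd j - i" using qp prime_dvd_mult_iff by blast
      then show False using that qp by (auto dest: dvd_imp_le)
    qed
    have inU: "x + i * q \<in> U" if "i \<le> 2" "\<not> q\<^sup>2 dvd a0 + b + h * (x + i * q)" for i
    proof -
      have "i * q \<le> 2 * q" using that by simp
      then have "x + i * q < k" using xq qp by linarith
      moreover have "b + h * (x + i * q) \<notin> B"
      proof
        assume "b + h * (x + i * q) \<in> B"
        then have "a0 + (b + h * (x + i * q)) \<in> perfect_powers" using B by blast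
        then have "q\<^sup>2 dvd a0 + (b + h * (x + i * q))"
          using di[of i] qp perfect_power_dvd by (metis add.assoc)
        then show False using that by (simp add: add.assoc)
      qed
      ultimately show ?thesis by (simp add: U_def)
    qed
    have "\<exists>i j. i < j \<and> j \<le> 2 \<and> \<not> q\<^sup>2 dvd a0 + b + h * (x + i * q) \<and> \<not> q\<^sup>2 dvd a0 + b + h * (x + j * q)"
      using notsq[of 0 1] notsq[of 1 2] notsq[of 0 2] by (metis less_numeral_extra(1) one_le_numeral one_less_numeral_iff order_refl pos2 semiring_norm(76))
    then obtain i j where ij: "i < j" "j \<le> 2" "\<not> q\<^sup>2 dvd a0 + b + h * (x + i * q)"
      "\<not> q\<^sup>2 dvd a0 + b + h * (x + j * q)" by blast
    have "(x + j * q) - (x + i * q) = q * (j - i)" using ij by (simp add: algebra_simps diff_mult_distrib2)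
    then have "q dvd (x + j * q) - (x + i * q)" by simp
    moreover have "x + i * q < x + j * q" using ij qp by simp
    ultimately show ?thesis using inU[of i] inU[of j] ij by (meson less_imp_le le_trans)
  qed
  then obtain F G where FG: "\<And>q. q \<in> P \<Longrightarrow> F q \<in> U \<and> G q \<in> U \<and> F q < G q \<and> q dvd G q - F q"
    by metis
  have "card P \<le> card (U \<times> U)"
  proof (rule card_inj_on_le[of "\<lambda>q. (F q, G q)"])
    show "inj_on (\<lambda>q. (F q, G q)) P"
    proof (rule inj_onI, rule ccontr)
      fix q r assume qr: "q \<in> P" "r \<in> P" "(F q, G q) = (F r, G r)" "q \<noteq> r"
      have "coprime q r" using P[OF qr(1)] P[OF qr(2)] qr(4) primes_coprime by blast
      then have "q * r dvd G q - F q" using FG[OF qr(1)] FG[OF qr(2)] qr(3)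
        by (intro divides_mult) auto
      then have "q * r \<le> G q - F q" using FG[OF qr(1)] by (intro dvd_imp_le) auto
      also have "\<dots> < k" using FG[OF qr(1)] by (auto simp: U_def)
      finally have "q * r < k" .
      moreover have "k \<le> q * q" "k \<le> r * r" using P[OF qr(1)] P[OF qr(2)] by (auto simp: power2_eq_square)
      ultimately show False
        using mult_le_mono2[of q r q] mult_le_mono1[of r q r] by linarith
    qed
  qed (use FG finU in auto)
  then show ?thesis by (simp add: card_cartesian_product U_def power2_eq_square)
qed

subsection \<open>A lower bound for the number of primes\<close>

text \<open>The induction step is the recurrence
  \<open>1 / ((m + 1) * (n choose (m + 1))) = 1 / (m * ((n - 1) choose m)) - 1 / (m * (n choose m))\<close>
  of Leibniz' harmonic triangle.\<close>

lemma mult_binomial_dvd_Lcm: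
  assumes "1 \<le> m" "m \<le> n"
  shows "m * (n choose m) dvd Lcm {1..n::nat}"
  using assms
proof (induction m arbitrary: n rule: dec_induct)
  case base
  then show ?case by (auto intro: dvd_Lcm)
next
  case (step m)
  then obtain n' where n: "n = Suc n'" "m \<le> n'" by (cases n) auto
  define D where "D = Lcm {1..n}"
  have "Lcm {1..n'} dvd D" unfolding D_def n by (intro Lcm_subset) auto
  then have "m * (n' choose m) dvd D" using step n dvd_trans by blast
  then obtain u where u: "D = m * (n' choose m) * u" by blast
  have "m * (n choose m) dvd D" unfolding D_def using step n by simp
  then obtain v where v: "D = m * (n choose m) * v" by blast
  have a: "(n' choose m) > 0" using n by simp
  have e1: "Suc m * (n choose Suc m) = n * (n' choose m)" unfolding n(1) by (rule Suc_times_binomial)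
  have e2: "(n - m) * (n choose m) = n * (n' choose m)"
    using n binomial_absorb_comp[of n m] by simp
  have "int (Suc m * (n choose Suc m)) * (int u - int v) = int D"
  proof -
    have "int m * (int (n * (n' choose m)) * (int u - int v)) =
        int n * int (m * (n' choose m) * u) - int m * int v * int (n * (n' choose m))"
      by (simp add: algebra_simps)
    also have "\<dots> = int n * int (m * (n' choose m) * u) - int (n - m) * int (m * (n choose m) * v)"
      unfolding e2[symmetric] by simp
    also have "\<dots> = int n * int D - int (n - m) * int D" by (simp only: u[symmetric] v[symmetric])
    also have "\<dots> = int m * int D" using n by (simp add: algebra_simps of_nat_diff)
    finally show ?thesis using step(1) e1 by simp
  qed
  then have "int (Suc m * (n choose Suc m)) dvd int D" by (metis dvd_triv_left)
  then show ?case unfolding D_def by (simp only: of_nat_dvd_iff)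
qed

text \<open>Each prime up to \<open>n\<close> enters with its highest power not exceeding
  \<open>n\<close>, hence contributes a factor at most \<open>n\<close>.\<close>

lemma Lcm_upto_le: "Lcm {1..n::nat} \<le> n ^ card {p. prime p \<and> p \<le> n}"
proof (cases "n = 0")
  case False
  define P where "P = {p. prime p \<and> p \<le> n}"
  have finP: "finite P" by (simp add: P_def)
  define e where "e = (\<lambda>p. GREATEST e. p ^ e \<le> n)"
  have le_e: "p ^ i \<le> n \<Longrightarrow> i \<le> e p" and e_le: "p ^ e p \<le> n" if p: "p \<in> P" for p i
  proof -
    have p1: "1 < p" using p prime_gt_1_nat by (auto simp: P_def)
    have bound: "\<forall>y. p ^ y \<le> n \<longrightarrow> y \<le> n"
      using power_gt_expt[OF p1[unfolded One_nat_def]] by (meson less_imp_le order.trans)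
    show "i \<le> e p" if "p ^ i \<le> n" unfolding e_def
      using Greatest_le_nat[of "\<lambda>e. p ^ e \<le> n" i n] that bound by blast
    have "p ^ 0 \<le> n" using False by simp
    then show "p ^ e p \<le> n" unfolding e_def
      using GreatestI_nat[of "\<lambda>e. p ^ e \<le> n" 0 n] bound by blast
  qed
  define Q where "Q = (\<Prod>p\<in>P. p ^ e p)"
  have "Lcm {1..n} dvd Q"
  proof (rule Lcm_least)
    fix i assume i: "i \<in> {1..n}"
    have sub: "prime_factors i \<subseteq> P" using i by (auto simp: P_def prime_factors_dvd dest: dvd_imp_le)
    have "i = (\<Prod>p\<in>prime_factors i. p ^ multiplicity p i)"
      using i by (simp add: prod_prime_factors)
    also have "\<dots> dvd (\<Prod>p\<in>prime_factors i. p ^ e p)"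
    proof (rule prod_dvd_prod, rule le_imp_power_dvd)
      fix p assume p: "p \<in> prime_factors i"
      have "p ^ multiplicity p i \<le> i" using i multiplicity_dvd[of p i] by (intro dvd_imp_le) auto
      then show "multiplicity p i \<le> e p" using le_e[of p] p sub i by (meson atLeastAtMost_iff le_trans subsetD)
    qed
    also have "\<dots> dvd Q" unfolding Q_def using sub finP by (rule prod_dvd_prod_subset[rotated])
    finally show "i dvd Q" .
  qed
  moreover have "Q > 0" by (auto simp: Q_def P_def prime_gt_0_nat)
  ultimately have "Lcm {1..n} \<le> Q" by (rule dvd_imp_le)
  also have "Q \<le> (\<Prod>p\<in>P. n)" unfolding Q_def using e_le by (intro prod_mono) auto
  finally show ?thesis by (simp add: P_def)
next
  case True
  have "{p. prime p \<and> p \<le> n} = {}" using True by (auto dest: prime_gt_0_nat)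
  then show ?thesis using True by (simp only: card.empty) simp
qed

text \<open>Chebyshev's bound: the central binomial coefficient is at least
  \<open>4 ^ n / (2 * n)\<close> and at most the least common multiple of
  \<open>1, ..., 2 * n\<close>.\<close>

lemma prime_count_lower_bound:
  assumes "n > 0"
  shows "n * ln 4 \<le> (card {p. prime p \<and> p \<le> 2 * n} + 1) * ln (2 * real n)"
proof -
  let ?c = "card {p::nat. prime p \<and> p \<le> 2 * n}"
  have "n * (2 * n choose n) dvd Lcm {1..2 * n}" using assms by (intro mult_binomial_dvd_Lcm) auto
  moreover have "Lcm {1..2 * n} > 0" by (auto intro!: Nat.gr0I simp: Lcm_0_iff)
  ultimately have "n * (2 * n choose n) \<le> Lcm {1..2 * n}" by (rule dvd_imp_le)
  also have "\<dots> \<le> (2 * n) ^ ?c" by (rule Lcm_upto_le)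
  finally have "n * (2 * n choose n) \<le> (2 * n) ^ ?c" .
  moreover have "1 * (2 * n choose n) \<le> n * (2 * n choose n)" using assms by (intro mult_le_mono1) simp
  ultimately have "(2 * n choose n) \<le> (2 * n) ^ ?c" unfolding mult_1 by (rule order.trans[rotated])
  then have "real (2 * n choose n) \<le> (2 * real n) ^ ?c"
    by (metis of_nat_le_iff of_nat_mult of_nat_numeral of_nat_power)
  then have "4 ^ n / (2 * real n) \<le> (2 * real n) ^ ?c"
    using central_binomial_lower_bound[OF assms] by linarith
  then have "4 ^ n \<le> (2 * real n) ^ (?c + 1)" using assms by (simp add: field_simps)
  then have "ln (4 ^ n) \<le> ln ((2 * real n) ^ (?c + 1))" using assms by (intro ln_mono) auto
  also have "\<dots> = real (?c + 1) * ln (2 * real n)" by (rule ln_realpow)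
  finally show ?thesis by (simp add: ln_realpow)
qed

lemma card_prime_divisors_le:
  assumes "h > 0"
  shows "2 ^ card {p. prime p \<and> p dvd h} \<le> (h::nat)"
proof -
  have eq: "{p. prime p \<and> p dvd h} = prime_factors h" using assms by (auto simp: prime_factors_dvd)
  have "(2::nat) ^ card (prime_factors h) = (\<Prod>p\<in>prime_factors h. 2)" by simp
  also have "\<dots> \<le> (\<Prod>p\<in>prime_factors h. p ^ multiplicity p h)"
  proof (rule prod_mono, safe)
    fix p assume p: "p \<in> prime_factors h"
    then have "2 \<le> p" "multiplicity p h > 0"
      by (auto simp: prime_factors_multiplicity prime_ge_2_nat)
    then show "2 \<le> p ^ multiplicity p h" using self_le_power[of p "multiplicity p h"] by linarith
  qed
  also have "\<dots> = h" using assms by (simp add: prod_prime_factors)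
  finally show ?thesis by (simp add: eq)
qed

subsection \<open>Polynomial growth of subset sums\<close>

text \<open>The ball argument needs generators without a common factor, so \<open>\<Gamma>\<close>
  is divided by its gcd \<open>h\<close>, which becomes the step of the progression. The bound
  \<open>h \<le> M\<close> later limits the number of primes dividing the step.\<close>

lemma near_progression_of_small_defect:
  fixes B :: "int set" and \<Gamma> :: "int set" and \<epsilon> :: real and k m q t w :: nat
  assumes B: "finite B" "B \<noteq> {}"
    and \<Gamma>: "\<Gamma> \<subseteq> {0..M}" "0 \<in> \<Gamma>" "card \<Gamma> = Suc w" "w > 0"
    and defect: "\<And>g. g \<in> \<Gamma> \<Longrightarrow> shift_defect B g \<le> \<epsilon> * card B"
    and par: "3 * m \<le> t" "2 * real t * \<epsilon> \<le> 1 / 2" "2 * card B < (t + 1) * (m * w)" "k \<le> q * w"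
  obtains h b where "0 < h" "h \<le> M" "b \<in> B"
    "real (card {x. x < k \<and> b + h * int x \<notin> B}) \<le> (6 * m + q) * \<epsilon> * k"
proof -
  have fin\<Gamma>: "finite \<Gamma>" using \<Gamma>(1) finite_subset by blast
  define h where "h = Gcd \<Gamma>"
  have "\<not> \<Gamma> \<subseteq> {0}"
  proof
    assume "\<Gamma> \<subseteq> {0}"
    then have "card \<Gamma> \<le> card {0::int}" by (intro card_mono) auto
    then show False using \<Gamma>(3,4) by simp
  qed
  then obtain g0 where g0: "g0 \<in> \<Gamma>" "g0 \<noteq> 0" by blast
  have "h \<noteq> 0" using g0 by (auto simp: h_def Gcd_0_iff)
  moreover have "h \<ge> 0" by (simp add: h_def)
  ultimately have h: "h > 0" by simp
  have hdvd: "h dvd g" if "g \<in> \<Gamma>" for g using that by (simp add: h_def)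
  have "h \<le> g0" using hdvd[OF g0(1)] g0 \<Gamma>(1) by (intro zdvd_imp_le) force+
  then have hM: "h \<le> M" using g0(1) \<Gamma>(1) by force
  define G where "G = (\<lambda>g. g div h) ` \<Gamma>"
  define n where "n = Max G"
  have finG: "finite G" using fin\<Gamma> by (simp add: G_def)
  have inj: "inj_on (\<lambda>g. g div h) \<Gamma>"
    using hdvd h by (intro inj_onI) (metis dvd_div_mult_self)
  have cG: "card G = Suc w" unfolding G_def card_image[OF inj] by (rule \<Gamma>(3))
  have G0: "0 \<in> G" using \<Gamma>(2) by (force simp: G_def)
  have Gnn: "0 \<le> g" if "g \<in> G" for g
    using that \<Gamma>(1) h by (auto simp: G_def pos_imp_zdiv_nonneg_iff)
  have Gn: "G \<subseteq> {0..n}" using finG Gnn by (auto simp: n_def)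
  have nG: "n \<in> G" using finG G0 unfolding n_def by (intro Max_in) auto
  have "Suc w \<le> card {0..n}" using card_mono[OF _ Gn] cG by simp
  then have wn: "int w \<le> n" by simp
  have hG: "(\<lambda>x. h * x) ` G = \<Gamma>" using hdvd h by (force simp: G_def image_image)
  have "Gcd G = 1"
  proof -
    have "h * Gcd G dvd Gcd \<Gamma>"
      unfolding hG[symmetric] by (rule Gcd_greatest) auto
    then have "h * Gcd G dvd h * 1" by (simp add: h_def)
    then have "Gcd G dvd 1" using h by (simp only: dvd_mult_cancel_left) simp
    then show ?thesis by simp
  qed
  \<comment> \<open>The defect is normalised so that \<open>f x \<le> 1 / 2\<close> is the condition
    bounded by \<open>2 * card B\<close> in \<open>card_small_shift_defect\<close>; this is the
    volume.\<close>
  define f where "f = (\<lambda>x. real (shift_defect B (h * x)) / card B)"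
  have cB: "card B > 0" using B by (simp add: card_gt_0_iff)
  have fhalf: "{x. f x \<le> 1 / 2} = {x. 2 * shift_defect B (h * x) \<le> card B}"
    using cB by (auto simp: f_def field_simps)
  interpret subadditive_ball f G n \<epsilon> "2 * card B" w
  proof
    show "f 0 = 0" by (simp add: f_def)
    show "f (x + y) \<le> f x + f y" for x y
      using shift_defect_add[OF B(1), of "h * x" "h * y"]
      by (simp add: f_def distrib_left add_divide_distrib[symmetric] divide_right_mono flip: of_nat_add)
    show "f (- x) = f x" for x using shift_defect_minus[OF B(1)] by (simp add: f_def)
    show "f g \<le> \<epsilon>" if "g \<in> G" for g
    proof -
      have "h * g \<in> \<Gamma>" using that hG by blast
      then show ?thesis using defect cB by (simp add: f_def field_simps)
    qed
    show "n > 0" using wn \<Gamma>(4) by simp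
    show "finite {x. f x \<le> 1 / 2}" "card {x. f x \<le> 1 / 2} \<le> 2 * card B"
      unfolding fhalf using card_small_shift_defect[OF B] h by auto
  qed (use G0 nG Gn \<open>Gcd G = 1\<close> cG in auto)
  obtain b where "b \<in> B" "real (card {x. x < k \<and> b + h * int x \<notin> B}) \<le> (6 * m + q) * \<epsilon> * k"
  proof (rule exists_long_near_progression[OF B, of k h "(6 * m + q) * \<epsilon>"])
    fix x assume "x < k"
    then have "int x \<le> int (q * w)" using par(4) by linarith
    also have "\<dots> \<le> int q * n" using wn by (simp add: mult_left_mono)
    finally have "f (int x) \<le> (6 * m + q) * \<epsilon>" using par(2) small_on_interval[OF par(1) _ par(3), of "int x" q] by simp
    then show "real (shift_defect B (h * int x)) \<le> (6 * m + q) * \<epsilon> * card B"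
      using cB by (simp add: f_def field_simps)
  qed
  then show ?thesis using that h hM by blast
qed

text \<open>From the primes up to \<open>Q\<close> one discards those with \<open>q ^ 2 < k\<close>,
  at most about \<open>sqrt k\<close>, the prime 2, and the divisors of \<open>h\<close>, at most
  \<open>ln h / ln 2\<close>.\<close>

lemma count_good_primes:
  fixes h Q k :: nat
  assumes "h > 0" "Q \<ge> 2"
  defines "P \<equiv> {q. prime q \<and> 2 < q \<and> \<not> q dvd h \<and> q \<le> Q \<and> k \<le> q\<^sup>2}"
  shows "real (Q - 1) / 2 * ln 4 / ln Q - 1 \<le> card P + 4 + sqrt k + 2 * ln h"
proof -
  define n where "n = Q div 2"
  have n: "n > 0" "2 * n \<le> Q" "Q \<le> 2 * n + 1" using assms(2)
    div_mult_mod_eq[of Q 2] mod_less_divisor[of 2 Q] unfolding n_def by linarith+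
  have Qln: "ln Q > 0" using assms(2) by simp
  let ?A = "{q. prime q \<and> q \<le> Q}" and ?D = "{q. prime q \<and> q dvd h}"
  have fin: "finite ?A" "finite P" by (auto simp: P_def)
  have finD: "finite ?D" by (rule finite_subset[of _ "{..h}"]) (use assms(1) in \<open>auto intro: dvd_imp_le\<close>)
  have "?A \<subseteq> P \<union> {..nat \<lfloor>sqrt k\<rfloor>} \<union> {..2} \<union> ?D"
  proof
    fix q assume q: "q \<in> ?A"
    show "q \<in> P \<union> {..nat \<lfloor>sqrt k\<rfloor>} \<union> {..2} \<union> ?D"
    proof (cases "k \<le> q\<^sup>2")
      case False
      then have "real (q\<^sup>2) \<le> real k" by (intro of_nat_mono) simp
      then have "real q \<le> sqrt k" by (intro real_le_rsqrt) simp
      then show ?thesis by (simp add: le_nat_floor)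
    qed (use q in \<open>auto simp: P_def\<close>)
  qed
  then have "card ?A \<le> card (P \<union> {..nat \<lfloor>sqrt k\<rfloor>} \<union> {..2} \<union> ?D)"
    using fin finD by (intro card_mono) auto
  also have "\<dots> \<le> card P + (nat \<lfloor>sqrt k\<rfloor> + 1) + 3 + card ?D"
    using card_Un_le[of "P \<union> {..nat \<lfloor>sqrt k\<rfloor>} \<union> {..2}" ?D]
      card_Un_le[of "P \<union> {..nat \<lfloor>sqrt k\<rfloor>}" "{..2}"] card_Un_le[of P "{..nat \<lfloor>sqrt k\<rfloor>}"]
    by simp
  finally have "real (card ?A) \<le> real (card P + (nat \<lfloor>sqrt k\<rfloor> + 1) + 3 + card ?D)"
    by (rule of_nat_mono)
  then have "real (card ?A) \<le> card P + real (nat \<lfloor>sqrt k\<rfloor>) + 4 + card ?D" by simp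
  moreover have "real (nat \<lfloor>sqrt k\<rfloor>) \<le> sqrt k" by (rule of_nat_floor) simp
  ultimately have 1: "real (card ?A) \<le> card P + sqrt k + 4 + card ?D" by linarith
  have "2 ^ card ?D \<le> real h" using card_prime_divisors_le[OF assms(1)]
    by (metis of_nat_le_iff of_nat_numeral of_nat_power)
  then have "ln (2 ^ card ?D) \<le> ln h" using assms(1) by (intro ln_mono) auto
  then have "card ?D * ln 2 \<le> ln h" by (simp add: ln_realpow)
  moreover have "card ?D * (1 / 2) \<le> card ?D * ln (2::real)"
    using ln2_ge_two_thirds by (intro mult_left_mono) auto
  ultimately have 2: "card ?D \<le> 2 * ln h" by linarith
  have "card {p. prime p \<and> p \<le> 2 * n} \<le> card ?A" using n by (intro card_mono) auto
  then have "real n * ln 4 \<le> (card ?A + 1) * ln (2 * real n)"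
    using prime_count_lower_bound[OF n(1)] n
    by (elim order.trans) (auto intro!: mult_right_mono)
  also have "\<dots> \<le> (card ?A + 1) * ln Q" using n by (intro mult_left_mono ln_mono) auto
  finally have "real n * ln 4 / ln Q \<le> card ?A + 1" using Qln by (simp add: field_simps)
  moreover have "real (Q - 1) / 2 * ln 4 / ln Q \<le> real n * ln 4 / ln Q"
    using n Qln by (intro divide_right_mono mult_right_mono) auto
  ultimately show ?thesis using 1 2 unfolding of_nat_add of_nat_1 of_nat_numeral by linarith
qed

lemma nat_floor_bounds:
  assumes "(y::real) \<ge> 0"
  shows "real (nat \<lfloor>y\<rfloor>) \<le> y" "y - 1 \<le> real (nat \<lfloor>y\<rfloor>)" "y \<le> real (nat \<lfloor>y\<rfloor>) + 1"
  using assms by (simp_all; linarith)+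

lemma nat_ceiling_bounds:
  assumes "(y::real) \<ge> 0"
  shows "y \<le> real (nat \<lceil>y\<rceil>)" "real (nat \<lceil>y\<rceil>) \<le> y + 1"
  using assms by (simp_all; linarith)+

text \<open>Slow growth makes \<open>B = subset_sums S\<close> almost invariant under a progression of length
  \<open>d powr 1.005\<close>, with few exceptions; but there are more primes below that length that each
  force a pair of exceptions.\<close>

theorem card_subset_sums_lower_bound:
  "\<forall>\<^sub>F d in sequentially. \<forall>(A :: nat set) N a0. A \<subseteq> {1..N} \<longrightarrow> card A = d \<longrightarrow>
     ln (real N) \<le> real d powr 1.002 \<longrightarrow> (+) a0 ` subset_sums A \<subseteq> perfect_powers \<longrightarrow>
     real d powr 2.49 \<le> card (subset_sums A)"
proof -
  \<comment> \<open>The primes range up to \<open>Y\<close> and the progression has length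
    \<open>3 * Y\<close>. With \<open>r = 12 * ln d / d\<close>, the value of \<open>t\<close> meets
    \<open>2 * t * (2 * r) \<le> 1 / 2\<close>. With \<open>w \<ge> d / 3\<close>, the product
    \<open>t * m * w\<close> then exceeds \<open>2 * d powr 2.49\<close> because
    \<open>700 / (96 * 3) > 2\<close>, and \<open>q * w\<close> covers the length.\<close>
  define Y :: "nat \<Rightarrow> nat" where "Y = (\<lambda>d. nat \<lfloor>real d powr 1.005\<rfloor>)"
  define m :: "nat \<Rightarrow> nat" where "m = (\<lambda>d. nat \<lceil>700 * real d powr 0.49 * ln d\<rceil>)"
  define t :: "nat \<Rightarrow> nat" where "t = (\<lambda>d. nat \<lfloor>real d / (96 * ln d)\<rfloor>)"
  define q :: "nat \<Rightarrow> nat" where "q = (\<lambda>d. nat \<lceil>9 * real d powr 0.005\<rceil>)"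
  have ev1: "\<forall>\<^sub>F d in sequentially. 12 * ln (real d) / real d \<le> 1"
    by real_asymp
  have ev2: "\<forall>\<^sub>F d in sequentially. 3 * (700 * real d powr 0.49 * ln d + 1) \<le> real d / (96 * ln d) - 1"
    by real_asymp
  \<comment> \<open>Since \<open>0.49 - 1 + 1.005 < 0.5\<close>, there will be at most
    \<open>sqrt d\<close> exceptions.\<close>
  have ev3: "\<forall>\<^sub>F d in sequentially.
      (6 * (700 * real d powr 0.49 * ln d + 1) + (9 * real d powr 0.005 + 1)) * (24 * ln d / d) * (3 * real d powr 1.005)
      \<le> real d powr 0.5"
    by real_asymp
  \<comment> \<open>The primes up to \<open>d powr 1.005\<close> outnumber \<open>d\<close> even
    after removing the divisors of the step, at most
    \<open>2 * ln N \<le> 2 * d powr 1.002\<close>.\<close>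
  have ev5: "\<forall>\<^sub>F d in sequentially. real d < (real d powr 1.005 - 2) / 2 * ln 4 / ln (real d powr 1.005)
      - 1 - 4 - sqrt (3 * real d powr 1.005) - 2 * real d powr 1.002"
    by real_asymp
  have ev4: "\<forall>\<^sub>F d in sequentially. d \<ge> (100::nat)" by (rule eventually_ge_at_top)
  show ?thesis
    using ev1 ev2 ev3 ev4 ev5
  proof eventually_elim
    case (elim d)
    show ?case
    proof (intro allI impI, rule ccontr)
      fix A :: "nat set" and N a0
      assume A: "A \<subseteq> {1..N}" "card A = d" and N: "ln (real N) \<le> real d powr 1.002"
        and PP: "(+) a0 ` subset_sums A \<subseteq> perfect_powers"
        and neg: "\<not> real d powr 2.49 \<le> card (subset_sums A)"
      define x where "x = real d"
      have x: "x \<ge> 100" using elim by (simp add: x_def)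
      have lnx: "ln x > 0" using x by simp
      have finA: "finite A" using A(1) finite_subset by blast
      \<comment> \<open>With \<open>n\<close> about \<open>d / 2\<close>, the bound
        \<open>(1 + r) ^ n \<ge> exp (n * r / 2)\<close> is about \<open>d ^ 3\<close>, so sustained
        greedy growth already proves the claim.\<close>
      define r where "r = 12 * ln x / x"
      define n where "n = d div 2"
      have r: "0 \<le> r" "r \<le> 1" using elim(1) x by (auto simp: r_def x_def)
      have lnr: "ln (1 + r) \<ge> r / 2"
      proof -
        have "exp (r / 2) \<le> 1 + r / 2 + (r / 2)\<^sup>2" using r by (intro exp_bound) auto
        also have "\<dots> \<le> 1 + r"
          using r mult_left_mono[of r 1 r] by (simp add: power2_eq_square)
        finally have "exp (r / 2) \<le> 1 + r" .
        then have "ln (exp (r / 2)) \<le> ln (1 + r)" by (intro ln_mono) auto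
        then show ?thesis by simp
      qed
      consider (1) S where "S \<subseteq> A" "(1 + r) ^ n \<le> real (card (subset_sums S))"
        | (2) S where "S \<subseteq> A" "card S < n"
          "\<forall>a\<in>A - S. shift_defect (int ` subset_sums S) (int a) \<le> r * card (subset_sums S)"
      proof -
        have "n \<le> card A" by (simp add: n_def A(2))
        from subset_sums_growth_dichotomy[OF finA this r(1)] show ?thesis
          using that by blast
      qed
      then show False
      proof cases
        case 1
        have "x powr 2.49 = exp (2.49 * ln x)" using x by (simp add: powr_def)
        also have "\<dots> \<le> exp (n * (r / 2))"
        proof -
          have "d \<le> 2 * n + 1" by (simp add: n_def)
          then have "real d \<le> real (2 * n + 1)" by (simp only: of_nat_le_iff)
          then have "real n \<ge> (x - 1) / 2" unfolding x_def by simp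
          then have "n * (r / 2) \<ge> (x - 1) / 2 * (r / 2)" using r by (intro mult_right_mono) auto
          also have "(x - 1) / 2 * (r / 2) = 3 * ((x - 1) / x) * ln x" using x by (simp add: r_def field_simps)
          finally have "n * (r / 2) \<ge> 3 * ((x - 1) / x) * ln x" .
          moreover have "3 * ((x - 1) / x) \<ge> 2.49" using x by (simp add: field_simps)
          ultimately have "n * (r / 2) \<ge> 2.49 * ln x"
            using mult_right_mono[of "2.49" "3 * ((x - 1) / x)" "ln x"] lnx by linarith
          then show ?thesis by simp
        qed
        also have "\<dots> \<le> exp (n * ln (1 + r))" using mult_left_mono[OF lnr, of "real n"] by simp
        also have "\<dots> = (1 + r) ^ n" using r by (simp add: exp_of_nat_mult)
        also have "\<dots> \<le> card (subset_sums S)" by (rule 1)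
        also have "\<dots> \<le> card (subset_sums A)"
          using subset_sums_mono[OF 1(1)] finA by (intro of_nat_mono card_mono) auto
        finally show False using neg by (simp add: x_def)
      next
        case 2
        have finS: "finite S" using 2(1) finA finite_subset by blast
        define A' where "A' = A - S"
        have A': "finite A'" "A' \<subseteq> A" using finA by (auto simp: A'_def)
        have "card A' = d - card S" using 2(1) finS A(2) by (simp add: A'_def card_Diff_subset)
        then have cA': "card A' > d div 2" using 2(2) n_def by simp
        then have neA': "A' \<noteq> {}" by auto
        \<comment> \<open>Differences from the least remaining generator stay in
          \<open>{0..N}\<close> and include 0; their defects are at most
          \<open>2 * r * card B\<close>.\<close>
        define a1 where "a1 = Min A'"
        have a1: "a1 \<in> A'" "\<And>a. a \<in> A' \<Longrightarrow> a1 \<le> a" using A' neA' by (auto simp: a1_def)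
        define \<Gamma> where "\<Gamma> = (\<lambda>a. int a - int a1) ` A'"
        define w where "w = card A' - 1"
        have injG: "inj_on (\<lambda>a. int a - int a1) A'" by (auto simp: inj_on_def)
        have w: "real w \<ge> x / 3" "w > 0" using cA' elim(4) by (auto simp: w_def x_def)
        define B where "B = int ` subset_sums S"
        have cB: "card B = card (subset_sums S)" by (simp add: B_def card_image)
        have B: "finite B" "B \<noteq> {}" using finS zero_in_subset_sums[of S] unfolding B_def by (auto simp del: zero_in_subset_sums)
        have "card B \<le> card (subset_sums A)"
          unfolding cB using subset_sums_mono[OF 2(1)] finA by (intro card_mono) auto
        then have cB': "real (card B) < x powr 2.49" using neg by (simp add: x_def)
        have m: "700 * x powr 0.49 * ln x \<le> m d" "m d \<le> 700 * x powr 0.49 * ln x + 1"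
          unfolding m_def x_def[symmetric] using lnx by (auto intro!: nat_ceiling_bounds)
        have t: "x / (96 * ln x) - 1 \<le> t d" "t d \<le> x / (96 * ln x)" "x / (96 * ln x) \<le> real (t d) + 1"
          unfolding t_def x_def[symmetric] using lnx x by (auto intro!: nat_floor_bounds)
        have qd: "9 * x powr 0.005 \<le> q d" "q d \<le> 9 * x powr 0.005 + 1"
          unfolding q_def x_def[symmetric] by (auto intro!: nat_ceiling_bounds)
        have Y: "Y d \<le> x powr 1.005" "x powr 1.005 - 1 \<le> Y d"
          unfolding Y_def x_def[symmetric] by (auto intro!: nat_floor_bounds)
        define k where "k = 3 * Y d"
        obtain h b where hb: "0 < h" "h \<le> int N" "b \<in> B"
          "real (card {y. y < k \<and> b + h * int y \<notin> B}) \<le> (6 * m d + q d) * (2 * r) * k"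
        proof (rule near_progression_of_small_defect[OF B, of \<Gamma> "int N" w "2 * r" "m d" "t d" k "q d"])
          show "\<Gamma> \<subseteq> {0..int N}" using a1 A' A(1) by (force simp: \<Gamma>_def)
          show "0 \<in> \<Gamma>" using a1 by (auto simp: \<Gamma>_def)
          show "card \<Gamma> = Suc w" using cA' by (simp add: \<Gamma>_def card_image[OF injG] w_def)
          show "w > 0" by fact
          show "real (shift_defect B g) \<le> 2 * r * card B" if "g \<in> \<Gamma>" for g
          proof -
            obtain a where a: "a \<in> A'" "g = int a + - int a1" using \<open>g \<in> \<Gamma>\<close> by (auto simp: \<Gamma>_def)
            have "shift_defect B g \<le> shift_defect B (int a) + shift_defect B (int a1)"
              using shift_defect_add[OF B(1), of "int a" "- int a1"] shift_defect_minus[OF B(1)] a(2) by simp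
            moreover have "shift_defect B (int a) \<le> r * card B" "shift_defect B (int a1) \<le> r * card B"
              using 2(3) a(1) a1(1) by (auto simp: A'_def B_def cB[unfolded B_def])
            ultimately show ?thesis
              using of_nat_mono[of "shift_defect B g" "shift_defect B (int a) + shift_defect B (int a1)", where 'a = real]
              by simp
          qed
          show "3 * m d \<le> t d"
          proof -
            have aux: "3 * (u + 1) \<le> v - 1 \<Longrightarrow> c \<le> u + 1 \<Longrightarrow> v - 1 \<le> e \<Longrightarrow> 3 * c \<le> e" for u v c e :: real
              by simp
            have "3 * real (m d) \<le> real (t d)" using elim(2) m(2) t(1) unfolding x_def[symmetric] by (rule aux)
            then show ?thesis by linarith
          qed
          show "2 * real (t d) * (2 * r) \<le> 1 / 2"
          proof -
            have "2 * real (t d) * (2 * r) \<le> 2 * (x / (96 * ln x)) * (2 * r)"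
              using t r by (intro mult_mono) auto
            also have "\<dots> = 1 / 2" using x lnx by (simp add: r_def field_simps)
            finally show ?thesis .
          qed
          show "2 * card B < (t d + 1) * (m d * w)"
          proof -
            have pw: "x powr 2.49 = x\<^sup>2 * x powr 0.49" using powr_add[of x 2 "0.49"] x by simp
            have "2 * real (card B) < 2 * x powr 2.49" using cB' by simp
            also have "2 * x powr 2.49 \<le> 700 / 288 * x powr 2.49" by simp
            also have "\<dots> = x / (96 * ln x) * ((700 * x powr 0.49 * ln x) * (x / 3))"
              unfolding pw using x lnx by (simp add: field_simps power2_eq_square)
            also have "\<dots> \<le> (real (t d) + 1) * (real (m d) * real w)"
              using t(3) m(1) w x lnx by (intro mult_mono) auto
            finally have "real (2 * card B) < real ((t d + 1) * (m d * w))" by (simp add: algebra_simps)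
            then show ?thesis by (simp only: of_nat_less_iff)
          qed
          show "k \<le> q d * w"
          proof -
            have "real k \<le> 3 * x powr 1.005" using Y by (simp add: k_def)
            also have "\<dots> = 9 * x powr 0.005 * (x / 3)" using powr_add[of x 1 "0.005"] x by simp
            also have "\<dots> \<le> q d * real w" using qd w x by (intro mult_mono) auto
            finally show ?thesis by (simp only: of_nat_mult[symmetric] of_nat_le_iff)
          qed
        qed
        obtain b' where b': "b = int b'" using hb(3) by (auto simp: B_def)
        define h' where "h' = nat h"
        have h': "h = int h'" "h' > 0" "h' \<le> N" using hb by (auto simp: h'_def)
        define U where "U = {y. y < k \<and> b' + h' * y \<notin> subset_sums S}"
        have UB: "{y. y < k \<and> b + h * int y \<notin> B} = U"
        proof -
          have "b + h * int y \<in> B \<longleftrightarrow> b' + h' * y \<in> subset_sums S" for y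
          proof -
            have "b + h * int y = int (b' + h' * y)" by (simp add: b' h'(1))
            then show ?thesis unfolding B_def by (simp only: inj_image_mem_iff[OF inj_of_nat])
          qed
          then show ?thesis by (simp add: U_def)
        qed
        define P where "P = {p. prime p \<and> 2 < p \<and> \<not> p dvd h' \<and> p \<le> Y d \<and> k \<le> p\<^sup>2}"
        have "(+) a0 ` subset_sums S \<subseteq> perfect_powers" using PP subset_sums_mono[OF 2(1)] by blast
        then have "card P \<le> (card U)\<^sup>2"
          unfolding U_def by (rule card_primes_le_exceptions[rotated 2]) (auto simp: P_def k_def)
        then have PU: "real (card P) \<le> (real (card U))\<^sup>2"
          by (metis of_nat_le_iff of_nat_power)
        have "real (card U) \<le> (6 * m d + q d) * (2 * r) * k" using hb(4) UB by simp
        also have "\<dots> \<le> (6 * (700 * x powr 0.49 * ln x + 1) + (9 * x powr 0.005 + 1)) * (24 * ln x / x) * (3 * x powr 1.005)"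
        proof (intro mult_mono)
          show "real (6 * m d + q d) \<le> 6 * (700 * x powr 0.49 * ln x + 1) + (9 * x powr 0.005 + 1)"
            using m(2) qd(2) by simp
          show "2 * r \<le> 24 * ln x / x" by (simp add: r_def)
          show "real k \<le> 3 * x powr 1.005" using Y by (simp add: k_def)
        qed (use r lnx x in \<open>auto intro!: divide_nonneg_nonneg mult_nonneg_nonneg add_nonneg_nonneg\<close>)
        also have "\<dots> \<le> x powr 0.5" using elim(3) unfolding x_def .
        finally have "(real (card U))\<^sup>2 \<le> (x powr 0.5)\<^sup>2"
          by (intro power_mono) auto
        also have "\<dots> = x" using powr_add[of x "0.5" "0.5"] x by (simp add: power2_eq_square)
        also have "\<dots> < (x powr 1.005 - 2) / 2 * ln 4 / ln (x powr 1.005) - 1 - 4 - sqrt (3 * x powr 1.005) - 2 * x powr 1.002"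
          using elim(5) by (simp add: x_def)
        also have "\<dots> \<le> card P"
        proof -
          have Y100: "real (Y d) \<ge> 99" using Y(2) x powr_mono[of 1 "1.005" x] by simp
          have "real (Y d - 1) / 2 * ln 4 / ln (Y d) - 1 \<le> card P + 4 + sqrt k + 2 * ln h'"
            unfolding P_def using h' Y100 by (intro count_good_primes) auto
          moreover have "(x powr 1.005 - 2) / 2 * ln 4 / ln (x powr 1.005) \<le> real (Y d - 1) / 2 * ln 4 / ln (Y d)"
            using Y Y100 x by (intro frac_le mult_right_mono ln_mono) (auto simp: of_nat_diff)
          moreover have "ln (real h') \<le> x powr 1.002"
          proof -
            have "ln (real h') \<le> ln (real N)" using h' by (intro ln_mono) auto
            then show ?thesis using N by (simp add: x_def)
          qed
          moreover have "sqrt k \<le> sqrt (3 * x powr 1.005)" using Y by (simp add: k_def)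
          ultimately show ?thesis by linarith
        qed
        finally show False using PU by simp
      qed
    qed
  qed
qed

subsection \<open>Linear combinations of products of radicals\<close>

text \<open>Gaussian elimination: equation \<open>i0\<close> is solved for the unknown
  \<open>j0\<close>, which is then substituted into the others.\<close>

lemma homogeneous_system_nontrivial:
  fixes a :: "'i \<Rightarrow> 'j \<Rightarrow> 'a::field"
  assumes "finite I" "finite J" "card I < card J"
  shows "\<exists>x. (\<exists>j\<in>J. x j \<noteq> 0) \<and> (\<forall>i\<in>I. (\<Sum>j\<in>J. a i j * x j) = 0)"
  using assms
proof (induction I arbitrary: J a rule: finite_induct)
  case empty
  then have "J \<noteq> {}" by auto
  then show ?case by (intro exI[of _ "\<lambda>_. 1"]) auto
next
  case (insert i0 I)
  show ?case
  proof (cases "\<forall>j\<in>J. a i0 j = 0")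
    case True
    have "card I < card J" using insert by simp
    then obtain x where "\<exists>j\<in>J. x j \<noteq> 0" "\<forall>i\<in>I. (\<Sum>j\<in>J. a i j * x j) = 0"
      using insert.IH[OF insert.prems(1)] by blast
    then show ?thesis using True by (intro exI[of _ x]) auto
  next
    case False
    then obtain j0 where j0: "j0 \<in> J" "a i0 j0 \<noteq> 0" by blast
    define J' where "J' = J - {j0}"
    have J': "finite J'" "J = insert j0 J'" "j0 \<notin> J'" using j0 insert.prems by (auto simp: J'_def)
    have "card I < card J'" using insert J' by simp
    then obtain x where x: "\<exists>j\<in>J'. x j \<noteq> 0"
      "\<forall>i\<in>I. (\<Sum>j\<in>J'. (a i j - a i j0 * a i0 j / a i0 j0) * x j) = 0"
      using insert.IH[OF J'(1), of "\<lambda>i j. a i j - a i j0 * a i0 j / a i0 j0"] by blast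
    define s where "s = (\<Sum>j\<in>J'. a i0 j * x j)"
    define y where "y = (\<lambda>j. if j = j0 then - s / a i0 j0 else x j)"
    have y: "(\<Sum>j\<in>J. a i j * y j) = a i j0 * (- s / a i0 j0) + (\<Sum>j\<in>J'. a i j * x j)" for i
    proof -
      have "(\<Sum>j\<in>J'. a i j * y j) = (\<Sum>j\<in>J'. a i j * x j)"
        using J' by (intro sum.cong) (auto simp: y_def)
      then show ?thesis using J' by (simp add: y_def)
    qed
    have "(\<Sum>j\<in>J. a i j * y j) = 0" if "i \<in> insert i0 I" for i
    proof (cases "i = i0")
      case True
      then show ?thesis unfolding y using j0 by (simp add: s_def)
    next
      case False
      then have "(\<Sum>j\<in>J'. (a i j - a i j0 * a i0 j / a i0 j0) * x j) = 0" using x(2) that by auto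
      moreover have "(\<Sum>j\<in>J'. (a i j - a i j0 * a i0 j / a i0 j0) * x j) =
          (\<Sum>j\<in>J'. a i j * x j) - (a i j0 / a i0 j0) * s"
        by (simp add: s_def sum_distrib_left sum_subtractf algebra_simps)
      ultimately show ?thesis unfolding y by (simp add: algebra_simps)
    qed
    moreover have "\<exists>j\<in>J. y j \<noteq> 0" using x(1) J' by (auto simp: y_def)
    ultimately show ?thesis by blast
  qed
qed

text \<open>\<open>rad e\<close> is the branch of \<open>\<Prod>l\<in>I. (\<beta> l + z) powr (e l / m l)\<close> that is positive on the
  positive real axis.\<close>

locale radicals =
  fixes I :: "nat set" and \<beta> m :: "nat \<Rightarrow> nat" and r :: real
  assumes fin_I: "finite I" and m: "l \<in> I \<Longrightarrow> m l \<ge> 2"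
    and r_pos: "r > 0" and r_le: "l \<in> I \<Longrightarrow> r \<le> \<beta> l" and inj_\<beta>: "inj_on \<beta> I"
begin

definition rad :: "(nat \<Rightarrow> nat) \<Rightarrow> complex \<Rightarrow> complex" where
  "rad e z = exp (\<Sum>l\<in>I. of_nat (e l) / of_nat (m l) * Ln (of_nat (\<beta> l) + z))"

definition exps :: "(nat \<Rightarrow> nat) set" where
  "exps = PiE I (\<lambda>l. {..<m l})"

definition lin :: "nat \<Rightarrow> complex poly" where
  "lin l = [:of_nat (\<beta> l), 1:]"

definition lin_prod :: "complex poly" where
  "lin_prod = (\<Prod>l\<in>I. lin l)"

text \<open>The logarithmic derivative of \<open>rad e\<close>, multiplied by the common denominator
  \<open>lin_prod\<close>.\<close>

definition log_deriv :: "(nat \<Rightarrow> nat) \<Rightarrow> complex poly" where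
  "log_deriv e = (\<Sum>l\<in>I. smult (of_nat (e l) / of_nat (m l)) (\<Prod>k\<in>I - {l}. lin k))"

text \<open>The assumption \<open>r \<le> \<beta> l\<close> keeps the arguments of \<open>Ln\<close>
  in the right half-plane, off the branch cut, on the whole disc.\<close>

lemma Re_pos:
  assumes "z \<in> ball 0 r" "l \<in> I"
  shows "Re (of_nat (\<beta> l) + z) > 0"
proof -
  have "\<bar>Re z\<bar> < r" using assms(1) abs_Re_le_cmod[of z] by simp
  then show ?thesis using r_le[OF assms(2)] by simp
qed

lemma lin_nz: "(z::complex) \<in> ball 0 r \<Longrightarrow> l \<in> I \<Longrightarrow> of_nat (\<beta> l) + z \<noteq> 0"
  using Re_pos[of z l] by fastforce

lemma not_nonpos: "(z::complex) \<in> ball 0 r \<Longrightarrow> l \<in> I \<Longrightarrow> of_nat (\<beta> l) + z \<notin> \<real>\<^sub>\<le>\<^sub>0"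
  using Re_pos[of z l] by (auto simp: complex_nonpos_Reals_iff)

lemma rad_nonzero [simp]: "rad e z \<noteq> 0"
  by (simp add: rad_def)

lemma finite_exps [simp]: "finite exps"
  unfolding exps_def using fin_I by (intro finite_PiE) auto

lemma card_exps: "card exps = (\<Prod>l\<in>I. m l)"
  unfolding exps_def using fin_I by (simp add: card_PiE)

lemma exps_less: "e \<in> exps \<Longrightarrow> l \<in> I \<Longrightarrow> e l < m l"
  by (auto simp: exps_def PiE_iff)

lemma exps_eqI: "e \<in> exps \<Longrightarrow> e' \<in> exps \<Longrightarrow> (\<And>l. l \<in> I \<Longrightarrow> e l = e' l) \<Longrightarrow> e = e'"
  unfolding exps_def by (rule PiE_ext)

section \<open>Linear independence of the radicals over the polynomials\<close>

lemma rad_has_derivative: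
  assumes z: "z \<in> ball 0 r"
  shows "(rad e has_field_derivative
    (\<Sum>l\<in>I. of_nat (e l) / of_nat (m l) / (of_nat (\<beta> l) + z)) * rad e z) (at z)"
  unfolding rad_def
  by (rule derivative_eq_intros refl | use not_nonpos[OF z] lin_nz[OF z] in force)+
    (auto simp: field_simps sum_distrib_left intro!: sum.cong)

lemma rad_holomorphic: "rad e holomorphic_on ball 0 r"
  unfolding holomorphic_on_open[OF open_ball] using rad_has_derivative by blast

lemma poly_log_deriv:
  assumes z: "z \<in> ball 0 r"
  shows "poly (log_deriv e) z =
    poly lin_prod z * (\<Sum>l\<in>I. of_nat (e l) / of_nat (m l) / (of_nat (\<beta> l) + z))"
proof -
  have "poly (smult (of_nat (e l) / of_nat (m l)) (\<Prod>k\<in>I - {l}. lin k)) z =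
      poly lin_prod z * (of_nat (e l) / of_nat (m l) / (of_nat (\<beta> l) + z))" if "l \<in> I" for l
  proof -
    define M where "M = (\<Prod>k\<in>I - {l}. lin k)"
    have "lin_prod = lin l * M"
      unfolding lin_prod_def M_def using fin_I that by (rule prod.remove)
    then have "poly lin_prod z = (of_nat (\<beta> l) + z) * poly M z" by (simp add: lin_def algebra_simps)
    moreover have "poly M z * u = (w * poly M z) * (u / w)" if "w \<noteq> 0" for u w using that by simp
    ultimately show ?thesis using lin_nz[OF z that] unfolding M_def[symmetric] poly_smult
      by (metis mult.commute)
  qed
  then show ?thesis by (simp add: log_deriv_def poly_sum sum_distrib_left)
qed

text \<open>At the root \<open>- \<beta> l\<close> the logarithmic derivative of a rational function has an integer
  residue, whereas the one of \<open>rad e / rad e'\<close> has residue \<open>(e l - e' l) / m l\<close>.\<close>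

lemma log_deriv_residue:
  assumes e: "e0 \<in> exps" "e1 \<in> exps" "A \<noteq> 0" "B \<noteq> 0"
    and eq: "A * (lin_prod * pderiv B + log_deriv e1 * B) = B * (lin_prod * pderiv A + log_deriv e0 * A)"
  shows "e0 = e1"
proof (rule exps_eqI[OF e(1,2)])
  fix l assume l: "l \<in> I"
  define x :: complex where "x = - of_nat (\<beta> l)"
  define L where "L = lin l"
  define M where "M = (\<Prod>k\<in>I - {l}. lin k)"
  have L: "L = [:- x, 1:]" by (simp add: L_def lin_def x_def)
  have Lx: "poly L x = 0" by (simp add: L)
  have PM: "lin_prod = L * M"
    unfolding lin_prod_def L_def M_def using fin_I l by (rule prod.remove)
  have Mx: "poly M x \<noteq> 0"
    using fin_I inj_onD[OF inj_\<beta> _ _ l] by (auto simp: M_def poly_prod lin_def x_def)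
  have ld: "poly (log_deriv e) x = of_nat (e l) / of_nat (m l) * poly M x" for e
  proof -
    have "poly (\<Prod>k\<in>I - {j}. lin k) x = 0" if "j \<in> I" "j \<noteq> l" for j
    proof -
      have "lin l dvd (\<Prod>k\<in>I - {j}. lin k)" using fin_I l that by (intro dvd_prodI) auto
      then show ?thesis using Lx by (auto simp: L_def[symmetric] elim: dvdE)
    qed
    then have "poly (log_deriv e) x = (\<Sum>j\<in>I. if j = l then of_nat (e l) / of_nat (m l) * poly M x else 0)"
      unfolding log_deriv_def poly_sum by (intro sum.cong) (auto simp: M_def)
    then show ?thesis using fin_I l by simp
  qed
  obtain A1 where A: "A = L ^ order x A * A1" "\<not> L dvd A1"
    using order_decomp[OF e(3), of x] by (auto simp: L)
  obtain B1 where B: "B = L ^ order x B * B1" "\<not> L dvd B1"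
    using order_decomp[OF e(4), of x] by (auto simp: L)
  define a b where "a = order x A" and "b = order x B"
  have nz: "poly A1 x \<noteq> 0" "poly B1 x \<noteq> 0"
    using A(2) B(2) by (simp_all add: L poly_eq_0_iff_dvd)
  \<comment> \<open>The extra factor \<open>L\<close> avoids the exponent \<open>i - 1\<close>, so
    one formula also covers order \<open>i = 0\<close>.\<close>
  have der: "L * pderiv (L ^ i * U) = L ^ i * (smult (of_nat i) U + L * pderiv U)" for i U
  proof (cases i)
    case (Suc k)
    have "pderiv L = 1" by (simp add: L pderiv_pCons)
    then have "pderiv (L ^ Suc k) = smult (of_nat (Suc k)) (L ^ k)"
      using pderiv_power_Suc[of L k] by simp
    then show ?thesis unfolding Suc pderiv_mult
      by (simp add: algebra_simps del: of_nat_Suc)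
  qed simp
  have eqs: "A = L ^ a * A1" "B = L ^ b * B1" using A(1) B(1) by (simp_all only: a_def b_def)
  define X where "X = smult (of_nat b) B1 + L * pderiv B1"
  define Y where "Y = smult (of_nat a) A1 + L * pderiv A1"
  have XY: "L * pderiv B = L ^ b * X" "L * pderiv A = L ^ a * Y"
    unfolding X_def Y_def der[symmetric] eqs[symmetric] by simp_all
  have "L ^ (a + b) * (A1 * (M * X + log_deriv e1 * B1)) =
      (L ^ a * A1) * (M * (L ^ b * X) + log_deriv e1 * (L ^ b * B1))"
    by (simp add: power_add algebra_simps)
  also have "\<dots> = A * (lin_prod * pderiv B + log_deriv e1 * B)"
    unfolding XY[symmetric] eqs[symmetric] PM by (simp add: mult_ac)
  also have "\<dots> = B * (lin_prod * pderiv A + log_deriv e0 * A)" by (rule eq)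
  also have "\<dots> = (L ^ b * B1) * (M * (L ^ a * Y) + log_deriv e0 * (L ^ a * A1))"
    unfolding XY[symmetric] eqs[symmetric] PM by (simp add: mult_ac)
  also have "\<dots> = L ^ (a + b) * (B1 * (M * Y + log_deriv e0 * A1))"
    by (simp add: power_add algebra_simps)
  finally have "A1 * (M * (smult (of_nat b) B1 + L * pderiv B1) + log_deriv e1 * B1) =
      B1 * (M * (smult (of_nat a) A1 + L * pderiv A1) + log_deriv e0 * A1)"
    unfolding X_def Y_def by (simp add: L)
  \<comment> \<open>At \<open>x\<close> every term with a factor \<open>L\<close> vanishes. What is
    left equates \<open>b + e1 l / m l\<close> with \<open>a + e0 l / m l\<close>, and both
    exponents lie below \<open>m l\<close>.\<close>
  then have "poly (A1 * (M * (smult (of_nat b) B1 + L * pderiv B1) + log_deriv e1 * B1)) x =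
      poly (B1 * (M * (smult (of_nat a) A1 + L * pderiv A1) + log_deriv e0 * A1)) x" by simp
  then have "poly A1 x * poly B1 x * poly M x * (of_nat b + of_nat (e1 l) / of_nat (m l)) =
      poly A1 x * poly B1 x * poly M x * (of_nat a + of_nat (e0 l) / of_nat (m l))"
    by (simp add: ld Lx algebra_simps)
  then have "of_nat b + of_nat (e1 l) / of_nat (m l) = (of_nat a + of_nat (e0 l) / of_nat (m l) :: complex)"
    using nz Mx by simp
  then have "of_nat (b * m l + e1 l) = (of_nat (a * m l + e0 l) :: complex)"
    using m[OF l] by (simp add: field_simps)
  then have "b * m l + e1 l = a * m l + e0 l" by (simp only: of_nat_eq_iff)
  then have "(b * m l + e1 l) mod m l = (a * m l + e0 l) mod m l" by simp
  then show "e0 l = e1 l" using exps_less[OF e(1) l] exps_less[OF e(2) l] by simp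
qed

text \<open>Shortest-relation argument: a relation and its derivative are combined to cancel one
  term. By induction the result is trivial, so the logarithmic derivatives of two radicals differ by
  that of a rational function, which the residues forbid.\<close>

lemma rad_independent:
  assumes "S \<subseteq> exps" "\<And>z. z \<in> ball 0 r \<Longrightarrow> (\<Sum>e\<in>S. poly (P e) z * rad e z) = 0" "e \<in> S"
  shows "P e = 0"
  using assms
proof (induction "card S" arbitrary: S P e rule: less_induct)
  case less
  have finS: "finite S" using less.prems(1) finite_exps finite_subset by blast
  have smaller: "Q e' = 0" if "e0 \<in> S" "Q e0 = 0" "e' \<in> S"
    "\<And>z. z \<in> ball 0 r \<Longrightarrow> (\<Sum>e\<in>S. poly (Q e) z * rad e z) = 0" for e0 e' Q
  proof (cases "e' = e0")
    case False
    have "(\<Sum>e\<in>S - {e0}. poly (Q e) z * rad e z) = 0" if "z \<in> ball 0 r" for z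
      using \<open>z \<in> ball 0 r \<Longrightarrow> (\<Sum>e\<in>S. poly (Q e) z * rad e z) = 0\<close>[OF that] finS
        \<open>e0 \<in> S\<close> \<open>Q e0 = 0\<close> by (simp add: sum.remove)
    moreover have "card (S - {e0}) < card S" using finS that(1) by (rule card_Diff1_less)
    ultimately show ?thesis using less.hyps[of "S - {e0}" Q e'] less.prems(1) that False by blast
  qed (use that in simp)
  show "P e = 0"
  proof (rule ccontr)
    assume Pe: "P e \<noteq> 0"
    have nz: "P e' \<noteq> 0" if "e' \<in> S" for e' using smaller[OF that _ less.prems(3,2)] Pe by blast
    show False
    proof (cases "S = {e}")
      case True
      then have "poly (P e) z = 0" if "z \<in> ball 0 r" for z using less.prems(2)[OF that] by simp
      then have "ball 0 r \<subseteq> {z. poly (P e) z = 0}" by auto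
      moreover have "infinite (ball (0::complex) r)" using uncountable_ball[OF r_pos] uncountable_infinite by blast
      ultimately show False using poly_roots_finite[OF Pe] finite_subset by blast
    next
      case False
      then obtain e1 where e1: "e1 \<in> S" "e1 \<noteq> e" using less.prems(3) by blast
      \<comment> \<open>\<open>D e\<close> is the coefficient of \<open>rad e\<close> after
        differentiating the relation and multiplying by \<open>lin_prod\<close>; \<open>Q\<close>
        combines both relations so that the term \<open>e\<close> drops out.\<close>
      define D where "D = (\<lambda>e. lin_prod * pderiv (P e) + log_deriv e * P e)"
      define Q where "Q = (\<lambda>e'. P e * D e' - P e' * D e)"
      have "(\<Sum>e'\<in>S. poly (Q e') z * rad e' z) = 0" if z: "z \<in> ball 0 r" for z
      proof -
        let ?F = "\<lambda>z. \<Sum>e\<in>S. poly (P e) z * rad e z"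
        let ?s = "\<lambda>e. \<Sum>l\<in>I. of_nat (e l) / of_nat (m l) / (of_nat (\<beta> l) + z)"
        have "(?F has_field_derivative (\<Sum>e\<in>S. poly (pderiv (P e)) z * rad e z + poly (P e) z * (?s e * rad e z))) (at z)"
          by (rule derivative_eq_intros poly_DERIV rad_has_derivative[OF z] refl)+
            (auto simp: algebra_simps intro!: sum.cong)
        moreover have "(?F has_field_derivative 0) (at z)"
          by (rule has_field_derivative_transform_within_open[of "\<lambda>_. 0" _ _ "ball 0 r"])
            (use z less.prems(2) in auto)
        ultimately have "(\<Sum>e\<in>S. poly (pderiv (P e)) z * rad e z + poly (P e) z * (?s e * rad e z)) = 0"
          by (rule DERIV_unique)
        then have "poly lin_prod z * (\<Sum>e\<in>S. poly (pderiv (P e)) z * rad e z + poly (P e) z * (?s e * rad e z)) = 0"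
          by simp
        then have D0: "(\<Sum>e\<in>S. poly (D e) z * rad e z) = 0"
          by (simp add: D_def poly_log_deriv[OF z] sum_distrib_left algebra_simps)
        have "(\<Sum>e'\<in>S. poly (Q e') z * rad e' z) =
            poly (P e) z * (\<Sum>e'\<in>S. poly (D e') z * rad e' z) - poly (D e) z * ?F z"
          by (simp add: Q_def sum_distrib_left sum_subtractf algebra_simps)
        then show ?thesis using D0 less.prems(2)[OF z] by simp
      qed
      then have "Q e1 = 0" using smaller[OF less.prems(3) _ e1(1), of Q] by (simp add: Q_def)
      then have "e = e1"
        using less.prems(1,3) e1 nz by (intro log_deriv_residue[of e e1 "P e" "P e1"]) (auto simp: Q_def D_def)
      then show False using e1 by simp
    qed
  qed
qed

section \<open>Products of radicals and the number of zeros of a combination\<close>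

definition exp_add :: "(nat \<Rightarrow> nat) \<Rightarrow> (nat \<Rightarrow> nat) \<Rightarrow> nat \<Rightarrow> nat" where
  "exp_add e e' = (\<lambda>l\<in>I. (e l + e' l) mod m l)"

text \<open>Whenever the sum of two exponents wraps around \<open>m l\<close>, one full factor
  \<open>\<beta> l + z\<close> is split off.\<close>

definition carry :: "(nat \<Rightarrow> nat) \<Rightarrow> (nat \<Rightarrow> nat) \<Rightarrow> complex poly" where
  "carry e e' = (\<Prod>l\<in>{l\<in>I. m l \<le> e l + e' l}. lin l)"

lemma exp_add_in: "exp_add e e' \<in> exps"
  using m by (force simp: exp_add_def exps_def)

lemma degree_carry: "degree (carry e e') \<le> card I"
proof -
  have "degree (carry e e') \<le> (\<Sum>l\<in>{l\<in>I. m l \<le> e l + e' l}. degree (lin l))"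
    unfolding carry_def by (rule order.trans[OF degree_prod_sum_le]) (auto simp: fin_I)
  also have "\<dots> = card {l\<in>I. m l \<le> e l + e' l}" by (simp add: lin_def)
  also have "\<dots> \<le> card I" using fin_I by (intro card_mono) auto
  finally show ?thesis .
qed

lemma rad_mult:
  assumes e: "e \<in> exps" "e' \<in> exps" and z: "z \<in> ball 0 r"
  shows "rad e z * rad e' z = poly (carry e e') z * rad (exp_add e e') z"
proof -
  let ?L = "\<lambda>l. Ln (of_nat (\<beta> l) + z)"
  have "rad e z * rad e' z = (\<Prod>l\<in>I. exp (of_nat (e l + e' l) / of_nat (m l) * ?L l))"
    unfolding rad_def exp_add[symmetric] sum.distrib[symmetric]
    using fin_I by (simp add: exp_sum add_divide_distrib algebra_simps)
  also have "\<dots> = (\<Prod>l\<in>I. (if m l \<le> e l + e' l then of_nat (\<beta> l) + z else 1) *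
      exp (of_nat (exp_add e e' l) / of_nat (m l) * ?L l))"
  proof (rule prod.cong[OF refl])
    fix l assume l: "l \<in> I"
    have less: "e l < m l" "e' l < m l" using e l exps_less by auto
    show "exp (of_nat (e l + e' l) / of_nat (m l) * ?L l) =
        (if m l \<le> e l + e' l then of_nat (\<beta> l) + z else 1) * exp (of_nat (exp_add e e' l) / of_nat (m l) * ?L l)"
    proof (cases "m l \<le> e l + e' l")
      case True
      then have "(e l + e' l) mod m l = e l + e' l - m l"
        using less by (simp add: le_mod_geq)
      then have "e l + e' l = m l + exp_add e e' l" using True l by (simp add: exp_add_def)
      then have "of_nat (e l + e' l) / of_nat (m l) * ?L l = ?L l + of_nat (exp_add e e' l) / of_nat (m l) * ?L l"
        using m[OF l] by (simp add: field_simps)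
      then show ?thesis using True lin_nz[OF z l] by (simp add: exp_add)
    qed (use l in \<open>simp add: exp_add_def\<close>)
  qed
  also have "\<dots> = (\<Prod>l\<in>I. if m l \<le> e l + e' l then of_nat (\<beta> l) + z else 1) * rad (exp_add e e') z"
    unfolding rad_def using fin_I by (simp add: prod.distrib exp_sum)
  also have "(\<Prod>l\<in>I. if m l \<le> e l + e' l then of_nat (\<beta> l) + z else 1) = poly (carry e e') z"
    using fin_I by (auto simp: carry_def poly_prod lin_def prod.inter_filter intro!: prod.cong)
  finally show ?thesis .
qed

text \<open>An underdetermined linear system yields \<open>G\<close> such that the product of the given
  combination with \<open>G\<close> is a polynomial; that polynomial inherits the zeros.\<close>

lemma card_zeros_rad_combination:
  fixes \<Lambda> :: "(nat \<Rightarrow> nat) \<Rightarrow> complex"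
  assumes "\<exists>e\<in>exps. \<Lambda> e \<noteq> 0" "C \<subseteq> ball 0 r" "\<And>z. z \<in> C \<Longrightarrow> (\<Sum>e\<in>exps. \<Lambda> e * rad e z) = 0"
  shows "finite C \<and> card C \<le> (card exps + 1) * card I"
proof -
  define R where "R = card exps"
  define j where "j = card I"
  define D where "D = R * j"
  define o0 where "o0 = (\<lambda>l\<in>I. 0::nat)"
  have o0: "o0 \<in> exps" using m by (force simp: o0_def exps_def)
  have R: "R > 0" using o0 by (auto simp: R_def card_gt_0_iff)
  \<comment> \<open>\<open>H G e''\<close> is the coefficient of \<open>rad e''\<close> in the
    product of the given combination with the one having coefficients \<open>G\<close>;
    \<open>a\<close> is the matrix of this linear dependence on \<open>G\<close>.\<close>
  define H where "H = (\<lambda>G e''. \<Sum>e'\<in>exps. \<Sum>e\<in>{e\<in>exps. exp_add e e' = e''}. smult (\<Lambda> e) (carry e e' * G e'))"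
  define a where "a = (\<lambda>(e'', k) (e', i). \<Sum>e\<in>{e\<in>exps. exp_add e e' = e''}. \<Lambda> e * coeff (carry e e' * monom 1 i) k)"
  \<comment> \<open>Only the coefficient of \<open>rad o0 = 1\<close> may survive. With
    \<open>D = R * j\<close> the \<open>(R - 1) * (D + j + 1)\<close> equations are
    \<open>j + 1\<close> fewer than the \<open>R * (D + 1)\<close> unknowns.\<close>
  have "card ((exps - {o0}) \<times> {..D + j}) < card (exps \<times> {..D})"
  proof -
    have "(R - 1) * (D + j + 1) + (j + 1) = R * (D + 1)"
      using R by (cases R) (auto simp: D_def algebra_simps)
    then show ?thesis using o0 by (simp add: card_cartesian_product card_Diff_singleton R_def[symmetric])
  qed
  then obtain x where x: "\<exists>t\<in>exps \<times> {..D}. x t \<noteq> 0"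
    "\<forall>s\<in>(exps - {o0}) \<times> {..D + j}. (\<Sum>t\<in>exps \<times> {..D}. a s t * x t) = 0"
    using homogeneous_system_nontrivial[of "(exps - {o0}) \<times> {..D + j}" "exps \<times> {..D}" a] by auto
  define G where "G = (\<lambda>e'. \<Sum>i\<le>D. monom (x (e', i)) i)"
  have degG: "degree (G e') \<le> D" for e'
    unfolding G_def by (rule degree_sum_le) (auto intro: order.trans[OF degree_monom_le])
  have coeffG: "coeff (G e') i = x (e', i)" if "i \<le> D" for e' i
    using that by (simp add: G_def coeff_sum)
  have Gnz: "\<exists>e'\<in>exps. G e' \<noteq> 0"
    using x(1) coeffG by (metis (no_types, lifting) SigmaE atMost_iff coeff_0)
  have degH: "degree (H G e'') \<le> D + j" for e''
    unfolding H_def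
  proof (intro degree_sum_le)
    fix e' e
    have "degree (carry e e' * G e') \<le> j + D"
      using degree_mult_le[of "carry e e'" "G e'"] degree_carry[of e e'] degG[of e'] by (simp add: j_def)
    then show "degree (smult (\<Lambda> e) (carry e e' * G e')) \<le> D + j"
      using degree_smult_le[of "\<Lambda> e" "carry e e' * G e'"] by linarith
  qed auto
  have H0: "H G e'' = 0" if "e'' \<in> exps" "e'' \<noteq> o0" for e''
  proof (rule poly_eqI)
    fix k
    show "coeff (H G e'') k = coeff 0 k"
    proof (cases "k \<le> D + j")
      case True
      have term_eq: "coeff (carry e e' * G e') k = (\<Sum>i\<le>D. coeff (carry e e' * monom 1 i) k * x (e', i))" for e e'
      proof -
        have "carry e e' * G e' = (\<Sum>i\<le>D. smult (x (e', i)) (carry e e' * monom 1 i))"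
          unfolding G_def sum_distrib_left by (intro sum.cong refl) (simp flip: mult_smult_right add: smult_monom)
        then show ?thesis by (simp add: coeff_sum mult.commute)
      qed
      have "coeff (H G e'') k = (\<Sum>e'\<in>exps. \<Sum>i\<le>D. a (e'', k) (e', i) * x (e', i))"
        unfolding H_def a_def
        by (simp add: coeff_sum term_eq sum_distrib_left sum_distrib_right mult.assoc)
           (subst sum.swap, simp add: sum_distrib_left sum_distrib_right mult.assoc)
      also have "\<dots> = (\<Sum>t\<in>exps \<times> {..D}. a (e'', k) t * x t)"
        by (simp add: sum.cartesian_product case_prod_unfold)
      also have "\<dots> = 0" using x(2) that True by auto
      finally show ?thesis by simp
    next
      case False
      then show ?thesis using degH[of e''] by (simp add: coeff_eq_0)
    qed
  qed
  define F where "F = (\<lambda>z. \<Sum>e\<in>exps. \<Lambda> e * rad e z)"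
  define g where "g = (\<lambda>z. \<Sum>e'\<in>exps. poly (G e') z * rad e' z)"
  define N where "N = H G o0"
  have rad_o0: "rad o0 z = 1" for z by (simp add: rad_def o0_def)
  have prod_eq: "F z * g z = poly N z" if z: "z \<in> ball 0 r" for z
  proof -
    have "F z * g z = (\<Sum>e'\<in>exps. \<Sum>e\<in>exps. \<Lambda> e * poly (G e') z * (rad e z * rad e' z))"
      unfolding F_def g_def sum_product by (subst sum.swap) (simp add: mult_ac)
    also have "\<dots> = (\<Sum>e'\<in>exps. \<Sum>e\<in>exps. \<Lambda> e * poly (G e') z * (poly (carry e e') z * rad (exp_add e e') z))"
      by (intro sum.cong refl) (simp add: rad_mult[OF _ _ z])
    also have "\<dots> = (\<Sum>e'\<in>exps. \<Sum>e''\<in>exps. \<Sum>e\<in>{e\<in>exps. exp_add e e' = e''}.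
        \<Lambda> e * poly (G e') z * (poly (carry e e') z * rad (exp_add e e') z))"
      by (intro sum.cong refl sum.group[symmetric]) (auto simp: exp_add_in)
    also have "\<dots> = (\<Sum>e''\<in>exps. \<Sum>e'\<in>exps. \<Sum>e\<in>{e\<in>exps. exp_add e e' = e''}.
        \<Lambda> e * poly (G e') z * (poly (carry e e') z * rad (exp_add e e') z))"
      by (rule sum.swap)
    also have "\<dots> = (\<Sum>e''\<in>exps. poly (H G e'') z * rad e'' z)"
      by (auto simp: H_def poly_sum sum_distrib_left sum_distrib_right mult_ac intro!: sum.cong)
    also have "\<dots> = (\<Sum>e''\<in>{o0}. poly (H G e'') z * rad e'' z)"
      using o0 H0 by (intro sum.mono_neutral_right) auto
    finally show ?thesis by (simp add: N_def rad_o0)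
  qed
  \<comment> \<open>If the product vanished, \<open>g\<close> would vanish where \<open>F\<close>
    does not, hence on the disc by the identity theorem, against the independence of the
    radicals.\<close>
  have N: "N \<noteq> 0"
  proof
    assume "N = 0"
    then have zero: "F z * g z = 0" if "z \<in> ball 0 r" for z using prod_eq[OF that] by simp
    have hol: "F holomorphic_on ball 0 r" "g holomorphic_on ball 0 r"
      unfolding F_def g_def by (intro holomorphic_intros rad_holomorphic poly_holomorphic_on)+
    have "\<exists>z\<in>ball 0 r. F z \<noteq> 0"
    proof (rule ccontr)
      assume "\<not> ?thesis"
      then have "(\<Sum>e\<in>exps. poly [:\<Lambda> e:] z * rad e z) = 0" if "z \<in> ball 0 r" for z
        using that by (simp add: F_def)
      then have "[:\<Lambda> e:] = 0" if "e \<in> exps" for e using rad_independent[of exps "\<lambda>e. [:\<Lambda> e:]"] that by blast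
      then show False using assms(1) by auto
    qed
    then obtain z0 where z0: "z0 \<in> ball 0 r" "F z0 \<noteq> 0" by blast
    define U where "U = {z \<in> ball 0 r. F z \<noteq> 0}"
    have "open U"
    proof -
      have "continuous_on (ball 0 r) F" using hol(1) by (rule holomorphic_on_imp_continuous_on)
      then have "open (ball 0 r \<inter> F -` (- {0}))" by (intro continuous_open_preimage) auto
      moreover have "ball 0 r \<inter> F -` (- {0}) = U" by (auto simp: U_def)
      ultimately show ?thesis by simp
    qed
    have "g z = 0" if "z \<in> ball 0 r" for z
    proof (rule analytic_continuation_open[of U "ball 0 r" g "\<lambda>_. 0" z])
      show "U \<noteq> {}" using z0 by (auto simp: U_def)
    qed (use \<open>open U\<close> hol that zero in \<open>auto simp: U_def\<close>)
    then have "G e' = 0" if "e' \<in> exps" for e' using rad_independent[of exps G] that by (simp add: g_def)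
    then show False using Gnz by blast
  qed
  have sub: "C \<subseteq> {z. poly N z = 0}"
  proof
    fix z assume "z \<in> C"
    then have "z \<in> ball 0 r" "F z = 0" using assms(2,3) by (auto simp: F_def)
    then show "z \<in> {z. poly N z = 0}" using prod_eq[of z] by simp
  qed
  have fin: "finite {z. poly N z = 0}" using N by (rule poly_roots_finite)
  have "card C \<le> card {z. poly N z = 0}" using sub fin by (rule card_mono[rotated])
  also have "\<dots> \<le> degree N" by (rule card_poly_roots_bound[OF N])
  also have "\<dots> \<le> D + j" unfolding N_def by (rule degH)
  also have "\<dots> = (card exps + 1) * card I" by (simp add: D_def R_def j_def)
  finally show ?thesis using sub fin finite_subset by blast
qed

end

text \<open>Box principle: two coefficient vectors with entries in \<open>{..L}\<close> have images
  in the same cell of side \<open>1 / 16\<close> in all real and imaginary parts, and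
  \<open>lam\<close> is their difference.\<close>

lemma siegel_pigeonhole:
  fixes u :: "nat \<Rightarrow> 'a \<Rightarrow> complex" and H T :: nat
  assumes E: "finite E" "E \<noteq> {}" and T: "T > 0" "4 * T \<le> card E" and H: "H \<ge> 1"
    and u: "\<And>n e. n < T \<Longrightarrow> e \<in> E \<Longrightarrow> cmod (u n e) \<le> H"
  obtains lam :: "'a \<Rightarrow> int" where "\<exists>e\<in>E. lam e \<noteq> 0" "\<And>e. e \<in> E \<Longrightarrow> \<bar>lam e\<bar> \<le> 64 * card E * H"
    "\<And>n. n < T \<Longrightarrow> cmod (\<Sum>e\<in>E. of_int (lam e) * u n e) \<le> 1 / 8"
proof -
  define R where "R = card E"
  have R: "R \<ge> 1" using T R_def by simp
  \<comment> \<open>Chosen so that \<open>4 * K = L * L\<close>: each of the \<open>2 * T\<close>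
    real coordinates has \<open>2 * K + 1 < (L + 1) ^ 2\<close> cells, and
    \<open>4 * T \<le> R\<close> lets the vectors outnumber the cells.\<close>
  define L where "L = 64 * R * H"
  define K where "K = 16 * L * R * H"
  have LK: "2 * K + 1 < (L + 1)\<^sup>2"
  proof -
    have "2 * (2 * K) = L * L" by (simp add: K_def L_def)
    moreover have "L > 0" using R H by (simp add: L_def)
    ultimately show ?thesis by (simp add: power2_eq_square)
  qed
  define S where "S = (\<lambda>v n. \<Sum>e\<in>E. of_nat (v e) * u n e)"
  define V where "V = PiE E (\<lambda>_. {..L})"
  define cell where "cell = (\<lambda>v. \<lambda>n\<in>{..<T}. (\<lfloor>16 * Re (S v n)\<rfloor>, \<lfloor>16 * Im (S v n)\<rfloor>))"
  define W where "W = PiE {..<T} (\<lambda>_. {- int K..int K} \<times> {- int K..int K})"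
  have Sb: "cmod (S v n) \<le> L * R * H" if "v \<in> V" "n < T" for v n
  proof -
    have "cmod (S v n) \<le> (\<Sum>e\<in>E. real L * H)"
      unfolding S_def
    proof (rule sum_norm_le)
      fix e assume e: "e \<in> E"
      have "v e \<le> L" using that(1) e by (auto simp: V_def)
      then show "cmod (of_nat (v e) * u n e) \<le> real L * H"
        using u[OF that(2) e] by (auto simp: norm_mult intro!: mult_mono)
    qed
    then show ?thesis by (simp add: R_def algebra_simps)
  qed
  have "cell ` V \<subseteq> W"
  proof
    fix w assume "w \<in> cell ` V"
    then obtain v where v: "v \<in> V" "w = cell v" by blast
    have "\<lfloor>16 * t\<rfloor> \<in> {- int K..int K}" if "\<bar>t\<bar> \<le> L * R * H" for t :: real
    proof -
      have "\<bar>16 * t\<bar> \<le> real K" using that by (simp add: K_def abs_mult)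
      then have "- real K \<le> 16 * t" "16 * t \<le> real K" by linarith+
      then show ?thesis by (simp add: le_floor_iff floor_le_iff)
    qed
    then have "\<lfloor>16 * Re (S v n)\<rfloor> \<in> {- int K..int K}" "\<lfloor>16 * Im (S v n)\<rfloor> \<in> {- int K..int K}" if "n < T" for n
      using Sb[OF v(1) that] abs_Re_le_cmod[of "S v n"] abs_Im_le_cmod[of "S v n"] by auto
    then show "w \<in> W" by (auto simp: v(2) cell_def W_def)
  qed
  moreover have finW: "finite W" by (auto simp: W_def intro!: finite_PiE)
  ultimately have le: "card (cell ` V) \<le> card W" by (intro card_mono)
  have "card {- int K..int K} = 2 * K + 1" by simp
  then have "card W = ((2 * K + 1)\<^sup>2) ^ T"
    by (simp add: W_def card_PiE card_cartesian_product power2_eq_square)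
  also have "\<dots> < ((L + 1) ^ 4) ^ T"
  proof (rule power_strict_mono[OF _ _ T(1)])
    have "(2 * K + 1)\<^sup>2 < ((L + 1)\<^sup>2)\<^sup>2" using LK by (intro power_strict_mono) auto
    then show "(2 * K + 1)\<^sup>2 < (L + 1) ^ 4" by simp
  qed simp
  also have "\<dots> = (L + 1) ^ (4 * T)" by (simp add: power_mult)
  also have "\<dots> \<le> (L + 1) ^ R" using T by (intro power_increasing) (auto simp: R_def)
  also have "\<dots> = card V" using E by (simp add: V_def card_PiE R_def)
  finally have "\<not> inj_on cell V" using le pigeonhole by (metis le_less_trans)
  then obtain v v' where v: "v \<in> V" "v' \<in> V" "v \<noteq> v'" "cell v = cell v'" by (auto simp: inj_on_def)
  define lam where "lam = (\<lambda>e. int (v e) - int (v' e))"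
  show ?thesis
  proof (rule that[of lam])
    have "\<exists>e\<in>E. v e \<noteq> v' e" using v(1-3) unfolding V_def by (metis PiE_ext)
    then show "\<exists>e\<in>E. lam e \<noteq> 0" by (auto simp: lam_def)
  next
    fix e assume e: "e \<in> E"
    have "v e \<le> L" "v' e \<le> L" using v(1,2) e by (auto simp: V_def)
    then have "\<bar>lam e\<bar> \<le> int L" unfolding lam_def by linarith
    then show "\<bar>lam e\<bar> \<le> 64 * card E * H" by (simp add: L_def R_def)
  next
    fix n assume n: "n < T"
    have eq: "(\<Sum>e\<in>E. of_int (lam e) * u n e) = S v n - S v' n"
      by (simp add: S_def lam_def sum_subtractf algebra_simps)
    have "cell v n = cell v' n" using v(4) by simp
    then have "\<lfloor>16 * Re (S v n)\<rfloor> = \<lfloor>16 * Re (S v' n)\<rfloor>" "\<lfloor>16 * Im (S v n)\<rfloor> = \<lfloor>16 * Im (S v' n)\<rfloor>"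
      using n by (auto simp: cell_def)
    then have "\<bar>16 * Re (S v n) - 16 * Re (S v' n)\<bar> \<le> 1" "\<bar>16 * Im (S v n) - 16 * Im (S v' n)\<bar> \<le> 1"
      by linarith+
    then have "\<bar>Re (S v n - S v' n)\<bar> + \<bar>Im (S v n - S v' n)\<bar> \<le> 1 / 8"
      by (simp only: minus_complex.sel)
    then show "cmod (\<Sum>e\<in>E. of_int (lam e) * u n e) \<le> 1 / 8"
      unfolding eq using cmod_le[of "S v n - S v' n"] by linarith
  qed
qed

text \<open>Siegel's lemma makes an integer combination of the monomials in the radicals so small on
  \<open>C\<close> that its integer values vanish there.\<close>

theorem card_simultaneous_powers_le:
  fixes \<beta> m :: "nat \<Rightarrow> nat" and I C :: "nat set" and r W :: nat
  assumes I: "finite I" and m: "\<And>l. l \<in> I \<Longrightarrow> m l \<ge> 2" and inj: "inj_on \<beta> I"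
    and r: "r > 0" "\<And>l. l \<in> I \<Longrightarrow> r \<le> \<beta> l \<and> \<beta> l + r \<le> W" and W: "W \<ge> 1"
    and C: "\<And>c. c \<in> C \<Longrightarrow> 8 * c \<le> r"
    and pow: "\<And>c l. c \<in> C \<Longrightarrow> l \<in> I \<Longrightarrow> \<exists>y. \<beta> l + c = y ^ m l"
  defines "R \<equiv> \<Prod>l\<in>I. m l"
  assumes big: "512 * R\<^sup>2 * W ^ (2 * card I) \<le> 2 ^ (R div 4)"
  shows "card C \<le> (R + 1) * card I"
proof -
  interpret radicals I \<beta> m "real r"
    using I m inj r by unfold_locales auto
  define T where "T = R div 4"
  define j where "j = card I"
  define H where "H = W ^ j"
  have cE: "card exps = R" unfolding R_def by (rule card_exps)
  have H1: "H \<ge> 1" using W by (simp add: H_def)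
  have "m l > 0" if "l \<in> I" for l using m[OF that] by simp
  then have R1: "R \<ge> 1" unfolding R_def by (simp add: Suc_leI prod_pos)
  have big': "512 * R\<^sup>2 * H\<^sup>2 \<le> 2 ^ T"
    using big by (simp add: H_def j_def T_def power_mult[symmetric] mult.commute)
  have T1: "T > 0"
  proof (rule Nat.gr0I)
    assume "T = 0"
    then have "512 * R\<^sup>2 * H\<^sup>2 \<le> 1" using big' by simp
    moreover have "R\<^sup>2 * H\<^sup>2 \<ge> 1" using R1 H1 by (simp add: Suc_leI)
    ultimately show False by simp
  qed
  \<comment> \<open>On half the radius Cauchy's inequality applies, and \<open>8 * c \<le> r\<close>
    becomes \<open>c \<le> \<rho> / 4\<close>, a geometric gain of \<open>1 / 4\<close> per Taylor
    term.\<close>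
  define \<rho> where "\<rho> = real r / 2"
  have \<rho>: "\<rho> > 0" "\<rho> < r" using r by (auto simp: \<rho>_def)
  define t where "t = (\<lambda>n e. (deriv ^^ n) (rad e) 0 / fact n)"
  have rad_bound: "cmod (rad e z) \<le> H" if e: "e \<in> exps" and z: "cmod z < r" for e z
  proof -
    have "Re (\<Sum>l\<in>I. of_nat (e l) / of_nat (m l) * Ln (of_nat (\<beta> l) + z)) =
        (\<Sum>l\<in>I. real (e l) / real (m l) * ln (cmod (of_nat (\<beta> l) + z)))"
    proof -
      have "Re (of_nat (e l) / of_nat (m l) * Ln (of_nat (\<beta> l) + z)) =
          real (e l) / real (m l) * ln (cmod (of_nat (\<beta> l) + z))" if "l \<in> I" for l
      proof -
        have "of_nat (e l) / of_nat (m l) = complex_of_real (real (e l) / real (m l))" by simp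
        moreover have "Re (Ln (of_nat (\<beta> l) + z)) = ln (cmod (of_nat (\<beta> l) + z))"
          using lin_nz[of z l] z that by (intro Re_Ln) auto
        ultimately show ?thesis by (simp only: times_complex.sel Re_complex_of_real Im_complex_of_real)
      qed
      then show ?thesis unfolding Re_sum by (intro sum.cong refl)
    qed
    also have "\<dots> \<le> (\<Sum>l\<in>I. ln W)"
    proof (rule sum_mono)
      fix l assume l: "l \<in> I"
      define w where "w = cmod (of_nat (\<beta> l) + z)"
      have "w > 0" using lin_nz[of z l] z l by (simp add: w_def)
      have "w \<le> real (\<beta> l) + r" using norm_triangle_ineq[of "of_nat (\<beta> l)" z] z by (simp add: w_def)
      also have "\<dots> \<le> W" using r(2)[OF l] by (simp flip: of_nat_add)
      finally have "ln w \<le> ln W" using \<open>w > 0\<close> by simp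
      moreover have c: "0 \<le> real (e l) / m l" "real (e l) / m l \<le> 1"
        using exps_less[OF e l] by auto
      moreover have "ln (real W) \<ge> 0" using W by simp
      ultimately show "real (e l) / m l * ln w \<le> ln W"
        using mult_left_mono[of "ln w" "ln W" "real (e l) / m l"] mult_right_mono[of "real (e l) / m l" 1 "ln W"]
        by linarith
    qed
    also have "\<dots> = ln H" using W by (simp add: H_def j_def ln_realpow)
    finally have "cmod (rad e z) \<le> exp (ln H)" unfolding rad_def norm_exp_eq_Re by simp
    then show ?thesis using H1 by simp
  qed
  have t_bound: "cmod (t n e * of_real \<rho> ^ n) \<le> H" if e: "e \<in> exps" for n e
  proof -
    have hol: "rad e holomorphic_on cball 0 \<rho>"
      using rad_holomorphic by (rule holomorphic_on_subset) (use \<rho> in auto)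
    have "cmod ((deriv ^^ n) (rad e) 0) \<le> fact n * real H / \<rho> ^ n"
      using hol \<rho> rad_bound[OF e]
      by (intro Cauchy_inequality) (auto intro: holomorphic_on_subset holomorphic_on_imp_continuous_on)
    then have "cmod (t n e) \<le> H / \<rho> ^ n"
      by (simp add: t_def norm_divide field_simps)
    then show ?thesis using \<rho> by (simp add: norm_mult norm_power field_simps)
  qed
  have "exps \<noteq> {}" using cE R1 by auto
  then obtain lam :: "(nat \<Rightarrow> nat) \<Rightarrow> int" where lam: "\<exists>e\<in>exps. lam e \<noteq> 0"
    "\<And>e. e \<in> exps \<Longrightarrow> \<bar>lam e\<bar> \<le> 64 * card exps * H"
    "\<And>n. n < T \<Longrightarrow> cmod (\<Sum>e\<in>exps. of_int (lam e) * (t n e * of_real \<rho> ^ n)) \<le> 1 / 8"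
    using siegel_pigeonhole[of exps T H "\<lambda>n e. t n e * of_real \<rho> ^ n"] t_bound T1 H1
    by (auto simp: cE T_def)
  define F where "F = (\<lambda>z. \<Sum>e\<in>exps. of_int (lam e) * rad e z)"
  define s where "s = (\<lambda>n. \<Sum>e\<in>exps. of_int (lam e) * (t n e * of_real \<rho> ^ n))"
  have s_big: "cmod (s n) \<le> 64 * (real R)\<^sup>2 * (real H)\<^sup>2" for n
  proof -
    have "cmod (s n) \<le> (\<Sum>e\<in>exps. (64 * real R * H) * H)"
      unfolding s_def
    proof (rule sum_norm_le)
      fix e assume e: "e \<in> exps"
      have "real_of_int \<bar>lam e\<bar> \<le> real_of_int (64 * R * H)"
        using lam(2)[OF e] cE by (simp only: of_int_le_iff)
      then show "cmod (of_int (lam e) * (t n e * of_real \<rho> ^ n)) \<le> (64 * real R * H) * H"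
        using t_bound[OF e, of n] by (subst norm_mult) (intro mult_mono, auto)
    qed
    then show ?thesis by (simp add: cE power2_eq_square algebra_simps)
  qed
  have F0: "F (of_nat c) = 0" if c: "c \<in> C" for c
  proof -
    have c8: "real c \<le> \<rho> / 4" using C[OF c] by (simp add: \<rho>_def)
    define q where "q = of_nat c / complex_of_real \<rho>"
    have q: "cmod q \<le> 1 / 4" using c8 \<rho> by (simp add: q_def norm_divide field_simps)
    have cball: "of_nat c \<in> ball (0::complex) r" using c8 \<rho> by (simp add: dist_norm)
    have "(\<lambda>n. t n e * of_nat c ^ n) sums rad e (of_nat c)" for e
      using holomorphic_power_series[OF rad_holomorphic cball, of e] by (simp add: t_def)
    then have "(\<lambda>n. \<Sum>e\<in>exps. of_int (lam e) * (t n e * of_nat c ^ n)) sums F (of_nat c)"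
      unfolding F_def by (intro sums_sum sums_mult)
    moreover have "(\<Sum>e\<in>exps. of_int (lam e) * (t n e * of_nat c ^ n)) = s n * q ^ n" for n
    proof -
      have "complex_of_real \<rho> ^ n * q ^ n = of_nat c ^ n" using \<rho> by (simp add: q_def power_divide)
      then show ?thesis by (simp add: s_def sum_distrib_right mult.assoc)
    qed
    ultimately have sums: "(\<lambda>n. s n * q ^ n) sums F (of_nat c)" by simp
    \<comment> \<open>Terms below \<open>T\<close> are small by the choice of \<open>lam\<close>.
      For the others \<open>big\<close> bounds \<open>s n\<close> by \<open>2 ^ n / 8\<close>, which
      the factor \<open>(1 / 4) ^ n\<close> outweighs. The total is at most \<open>1 / 4\<close>,
      less than any nonzero integer.\<close>
    have term_bound: "cmod (s n * q ^ n) \<le> 1 / 8 * (1 / 2) ^ n" for n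
    proof (cases "n < T")
      case True
      have "cmod (s n * q ^ n) \<le> 1 / 8 * (1 / 4) ^ n"
        unfolding norm_mult norm_power using lam(3)[OF True] q
        by (intro mult_mono power_mono) (auto simp: s_def)
      also have "\<dots> \<le> 1 / 8 * (1 / 2) ^ n" by (intro mult_left_mono power_mono) auto
      finally show ?thesis .
    next
      case False
      have "64 * (real R)\<^sup>2 * (real H)\<^sup>2 \<le> 1 / 8 * 2 ^ n"
      proof -
        have "real (512 * R\<^sup>2 * H\<^sup>2) \<le> real (2 ^ T)" using big' by (rule of_nat_mono)
        also have "\<dots> \<le> 2 ^ n" using False by (simp add: power_increasing)
        finally show ?thesis by simp
      qed
      then have "cmod (s n) \<le> 1 / 8 * 2 ^ n" using s_big[of n] by linarith
      then have "cmod (s n * q ^ n) \<le> 1 / 8 * 2 ^ n * (1 / 4) ^ n"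
        unfolding norm_mult norm_power using q by (intro mult_mono power_mono) auto
      also have "\<dots> = 1 / 8 * (1 / 2) ^ n" by (simp add: power_mult_distrib[symmetric] mult.assoc)
      finally show ?thesis .
    qed
    have g: "(\<lambda>n. 1 / 8 * (1 / 2) ^ n :: real) sums (1 / 4)"
      using sums_mult[OF geometric_sums[of "1 / 2 :: real"], of "1 / 8"] by simp
    have "cmod (F (of_nat c)) \<le> 1 / 4"
    proof -
      have "cmod (\<Sum>n. s n * q ^ n) \<le> (\<Sum>n. 1 / 8 * (1 / 2) ^ n)"
        using term_bound sums_summable[OF g] by (intro norm_suminf_le) auto
      then show ?thesis using sums_unique[OF sums] sums_unique[OF g] by simp
    qed
    moreover have "F (of_nat c) \<in> \<int>"
    proof -
      obtain y where y: "\<And>l. l \<in> I \<Longrightarrow> \<beta> l + c = y l ^ m l" using pow[OF c] by metis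
      have "rad e (of_nat c) \<in> \<int>" for e
      proof -
        have "exp (of_nat (e l) / of_nat (m l) * Ln (of_nat (\<beta> l) + of_nat c)) = (of_nat (y l ^ e l) :: complex)"
          if l: "l \<in> I" for l
        proof -
          have "y l ^ m l > 0" using y[OF l] r(1) r(2)[OF l] by linarith
          then have yp: "y l > 0" using m[OF l] by (cases "y l = 0") auto
          have "Ln (of_nat (\<beta> l) + of_nat c) = Ln (of_real (real (y l) ^ m l))"
            using y[OF l] by (metis of_nat_add of_nat_power of_real_of_nat_eq)
          also have "\<dots> = of_real (ln (real (y l) ^ m l))" using yp by (intro Ln_of_real) simp
          also have "\<dots> = of_nat (m l) * of_real (ln (y l))" using yp by (simp add: ln_realpow)
          finally have "of_nat (e l) / of_nat (m l) * Ln (of_nat (\<beta> l) + of_nat c) = of_real (e l * ln (y l))"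
            using m[OF l] by simp
          then have "exp (of_nat (e l) / of_nat (m l) * Ln (of_nat (\<beta> l) + of_nat c)) = of_real (exp (e l * ln (y l)))"
            by (simp only: exp_of_real)
          also have "exp (e l * ln (y l)) = real (y l) ^ e l" using yp by (simp add: exp_of_nat_mult)
          finally show ?thesis by simp
        qed
        then have "rad e (of_nat c) = (\<Prod>l\<in>I. of_nat (y l ^ e l))"
          unfolding rad_def using I by (simp add: exp_sum)
        then show ?thesis by (auto intro: Ints_prod)
      qed
      then show ?thesis unfolding F_def by (intro Ints_sum Ints_mult) auto
    qed
    ultimately show ?thesis by (elim Ints_cases) (auto simp: norm_of_int)
  qed
  have "card ((of_nat :: nat \<Rightarrow> complex) ` C) \<le> (card exps + 1) * card I"
  proof (rule conjunct2[OF card_zeros_rad_combination[of "\<lambda>e. of_int (lam e)"]])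
    show "of_nat ` C \<subseteq> ball (0::complex) (real r)"
    proof safe
      fix c assume "c \<in> C"
      then have "real (8 * c) \<le> real r" using C by (simp only: of_nat_le_iff)
      then show "of_nat c \<in> ball (0::complex) (real r)" using r(1) by simp
    qed
  qed (use lam(1) F0 in \<open>auto simp: F_def\<close>)
  then show ?thesis by (simp add: card_image inj_on_def cE)
qed

subsection \<open>Words of primes\<close>

text \<open>The exponent is large enough for the sum of \<open>p powr (- rexp)\<close> over all primes to be at
  most 1, and \<open>1 + rexp\<close> is below the exponent 2.49 of the growth of subset sums.\<close>

definition rexp :: real where "rexp = 29 / 20"

text \<open>As \<open>rexp = 29 / 20\<close>, raising to the 20th power reduces each numerical bound
  to an inequality between numerals.\<close>

lemma powr_minus_rexp_le:
  fixes p a :: real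
  assumes "p > 0" "a > 0" "100000 ^ 20 \<le> a ^ 20 * p ^ 29"
  shows "p powr (- rexp) \<le> a / 100000"
proof -
  have "(p powr (- rexp)) ^ 20 = p powr (- 29)"
    using assms(1) by (simp add: rexp_def powr_power)
  also have "\<dots> = 1 / p ^ 29" using assms(1) by (simp add: powr_minus powr_numeral divide_inverse)
  also have "\<dots> \<le> (a / 100000) ^ 20" using assms by (simp add: field_simps)
  finally show ?thesis using assms power_mono_iff[of "p powr (- rexp)" "a / 100000" 20] by simp
qed

text \<open>Comparison with the integral of \<open>x powr (- rexp)\<close> from 1 to infinity, made
  telescoping by the mean value theorem.\<close>

lemma sum_powr_minus_rexp_le: "(\<Sum>k=2..K. real k powr (- rexp)) \<le> 20 / 9"
proof -
  have step: "real k powr (- rexp) \<le> 20 / 9 * ((real k - 1) powr (- (9 / 20)) - real k powr (- (9 / 20)))" if k: "k \<ge> 2" for k :: nat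
  proof -
    have "\<exists>z. real k - 1 < z \<and> z < real k \<and> real k powr (- (9 / 20)) - (real k - 1) powr (- (9 / 20)) =
        (real k - (real k - 1)) * (- (9 / 20) * z powr (- (9 / 20) - 1))"
      by (rule MVT2) (use k in \<open>auto intro!: derivative_eq_intros\<close>)
    then obtain z where z: "real k - 1 < z" "z < real k"
      "(real k - 1) powr (- (9 / 20)) - real k powr (- (9 / 20)) = 9 / 20 * z powr (- rexp)"
      by (auto simp: rexp_def)
    have "real k powr (- rexp) \<le> z powr (- rexp)"
      using z k by (intro powr_mono2') (auto simp: rexp_def)
    then show ?thesis using z(3) by simp
  qed
  have "(\<Sum>k=2..K. real k powr (- rexp)) \<le> 20 / 9 * (1 - real K powr (- (9 / 20)))" if "K \<ge> 1"
    using that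
  proof (induction K rule: dec_induct)
    case (step n)
    have "{2..Suc n} = insert (Suc n) {2..n}" using step by auto
    then have "(\<Sum>k=2..Suc n. real k powr (- rexp)) = real (Suc n) powr (- rexp) + (\<Sum>k=2..n. real k powr (- rexp))"
      by simp
    also have "real (Suc n) powr (- rexp) \<le> 20 / 9 * (real n powr (- (9 / 20)) - real (Suc n) powr (- (9 / 20)))"
      using \<open>\<And>k. k \<ge> 2 \<Longrightarrow> _\<close>[of "Suc n"] step by simp
    finally show ?case using step.IH by (simp add: algebra_simps)
  qed simp
  moreover have "20 / 9 * (1 - real K powr (- (9 / 20))) \<le> 20 / 9" by simp
  ultimately have "(\<Sum>k=2..K. real k powr (- rexp)) \<le> 20 / 9" if "K \<ge> 1" using that order.trans by blast
  then show ?thesis by (cases "K \<ge> 1") auto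
qed

lemma small_primes:
  assumes "prime (p::nat)" "p < 60"
  shows "p \<in> {2,3,5,7,11,13,17,19,23,29,31,37,41,43,47,53,59}"
proof (cases "p = 2 \<or> p = 3 \<or> p = 5 \<or> p = 7")
  case False
  have "p mod q \<noteq> 0" if "q \<in> {2,3,5,7}" for q
  proof
    assume "p mod q = 0"
    then have "q = 1 \<or> q = p" using assms(1) by (auto simp: prime_nat_iff dvd_eq_mod_eq_0)
    then show False using that False by auto
  qed
  from this[of 2] this[of 3] this[of 5] this[of 7]
  have nd: "p mod 2 \<noteq> 0" "p mod 3 \<noteq> 0" "p mod 5 \<noteq> 0" "p mod 7 \<noteq> 0" by blast+
  have D: "\<forall>n\<in>set [2..<60]. n mod 2 = 0 \<or> n mod 3 = 0 \<or> n mod 5 = 0 \<or> n mod 7 = 0 \<or>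
      n \<in> {2,3,5,7,11,13,17,19,23,29,31,37,41,43,47,53,59::nat}" by code_simp
  have mem: "p \<in> set [2..<60]"
    using assms prime_ge_2_nat[of p] by (simp only: set_upt atLeastLessThan_iff)
  show ?thesis using bspec[OF D mem] nd by argo
qed auto

lemma large_prime_mod_30:
  assumes "prime (p::nat)" "p \<ge> 60"
  shows "p mod 30 \<in> {1,7,11,13,17,19,23,29}"
proof -
  have "p mod 30 mod q \<noteq> 0" if "q \<in> {2,3,5}" for q
  proof
    assume "p mod 30 mod q = 0"
    moreover have "p mod 30 mod q = p mod q" using that by (auto simp: mod_mod_cancel)
    ultimately have "q dvd p" by (simp add: dvd_eq_mod_eq_0)
    then have "q = 1 \<or> q = p" using assms(1) by (auto simp: prime_nat_iff)
    then show False using that assms(2) by auto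
  qed
  from this[of 2] this[of 3] this[of 5]
  have nd: "p mod 30 mod 2 \<noteq> 0" "p mod 30 mod 3 \<noteq> 0" "p mod 30 mod 5 \<noteq> 0" by blast+
  have D: "\<forall>n\<in>set [0..<30]. n mod 2 = 0 \<or> n mod 3 = 0 \<or> n mod 5 = 0 \<or> n \<in> {1,7,11,13,17,19,23,29::nat}"
    by code_simp
  have mem: "p mod 30 \<in> set [0..<30]" by simp
  show ?thesis using bspec[OF D mem] nd by argo
qed

text \<open>Primes below 60 contribute at most 0.8608. Beyond, each block of 30 integers holds at
  most 8 primes, and the blocks from 60 on add at most 0.1285.\<close>

lemma sum_primes_powr_le_1:
  assumes "finite S" "\<And>p. p \<in> S \<Longrightarrow> prime (p::nat)"
  shows "(\<Sum>p\<in>S. real p powr (- rexp)) \<le> 1"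
proof -
  define P0 :: "nat set" where "P0 = {2,3,5,7,11,13,17,19,23,29,31,37,41,43,47,53,59}"
  define T where "T = {p\<in>S. p \<ge> 60}"
  have finT: "finite T" using assms(1) by (simp add: T_def)
  have "S \<subseteq> P0 \<union> T"
  proof
    fix p assume "p \<in> S"
    then show "p \<in> P0 \<union> T" using small_primes[of p] assms(2)[of p] unfolding P0_def T_def
      by (cases "p < 60") auto
  qed
  then have "(\<Sum>p\<in>S. real p powr (- rexp)) \<le> (\<Sum>p\<in>P0 \<union> T. real p powr (- rexp))"
    using finT by (intro sum_mono2) (auto simp: P0_def)
  also have "\<dots> = (\<Sum>p\<in>P0. real p powr (- rexp)) + (\<Sum>p\<in>T. real p powr (- rexp))"
    using finT by (intro sum.union_disjoint) (auto simp: P0_def T_def)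
  also have "(\<Sum>p\<in>P0. real p powr (- rexp)) \<le> 0.8608"
  proof -
    have "(\<Sum>p\<in>P0. real p powr (- rexp)) = 2 powr (- rexp) + 3 powr (- rexp) + 5 powr (- rexp) + 7 powr (- rexp)
        + 11 powr (- rexp) + 13 powr (- rexp) + 17 powr (- rexp) + 19 powr (- rexp) + 23 powr (- rexp) + 29 powr (- rexp)
        + 31 powr (- rexp) + 37 powr (- rexp) + 41 powr (- rexp) + 43 powr (- rexp) + 47 powr (- rexp) + 53 powr (- rexp) + 59 powr (- rexp)"
      by (simp add: P0_def)
    also have "\<dots> \<le> 36603 / 100000 + 20332 / 100000 + 9694 / 100000 + 5952 / 100000 + 3091 / 100000 + 2426 / 100000 + 1644 / 100000 + 1399 / 100000 + 1061 / 100000 + 758 / 100000 + 688 / 100000 + 533 / 100000 + 459 / 100000 + 429 / 100000 + 377 / 100000 + 317 / 100000 + 271 / 100000"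
      by (intro add_mono powr_minus_rexp_le) simp_all
    finally show ?thesis by simp
  qed
  also have "(\<Sum>p\<in>T. real p powr (- rexp)) \<le> 0.1285"
  proof -
    define K where "K = Max (insert 0 T) div 30"
    have K: "p div 30 \<in> {2..K}" if "p \<in> T" for p
    proof -
      have "p \<le> Max (insert 0 T)" using finT that by simp
      then have "p div 30 \<le> K" unfolding K_def by (rule div_le_mono)
      moreover have "60 div 30 \<le> p div 30" using that by (intro div_le_mono) (simp add: T_def)
      ultimately show ?thesis by simp
    qed
    have block: "(\<Sum>p\<in>{p\<in>T. p div 30 = k}. real p powr (- rexp)) \<le> 8 * (30 powr (- rexp) * real k powr (- rexp))"
      if k: "k \<in> {2..K}" for k
    proof -
      have "card {p\<in>T. p div 30 = k} \<le> card {1,7,11,13,17,19,23,29::nat}"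
      proof (rule card_inj_on_le[of "\<lambda>p. p mod 30"])
        show "inj_on (\<lambda>p. p mod 30) {p\<in>T. p div 30 = k}"
          by (rule inj_onI) (metis (mono_tags, lifting) div_mult_mod_eq mem_Collect_eq)
        show "(\<lambda>p. p mod 30) ` {p\<in>T. p div 30 = k} \<subseteq> {1,7,11,13,17,19,23,29}"
          using large_prime_mod_30 assms(2) unfolding T_def by blast
      qed simp
      then have c8: "card {p\<in>T. p div 30 = k} \<le> 8" by simp
      have "(\<Sum>p\<in>{p\<in>T. p div 30 = k}. real p powr (- rexp)) \<le>
          (\<Sum>p\<in>{p\<in>T. p div 30 = k}. (30 * real k) powr (- rexp))"
      proof (rule sum_mono)
        fix p assume "p \<in> {p\<in>T. p div 30 = k}"
        then have "30 * k \<le> p" by (metis (mono_tags, lifting) mem_Collect_eq times_div_less_eq_dividend)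
        then have "30 * real k \<le> real p" by simp
        then show "real p powr (- rexp) \<le> (30 * real k) powr (- rexp)"
          using k by (intro powr_mono2') (auto simp: rexp_def)
      qed
      also have "\<dots> = card {p\<in>T. p div 30 = k} * (30 * real k) powr (- rexp)" by simp
      also have "\<dots> \<le> 8 * (30 * real k) powr (- rexp)" using c8 by (intro mult_right_mono) auto
      finally show ?thesis by (simp add: powr_mult)
    qed
    have "(\<Sum>p\<in>T. real p powr (- rexp)) = (\<Sum>k\<in>{2..K}. \<Sum>p\<in>{p\<in>T. p div 30 = k}. real p powr (- rexp))"
      using K finT by (intro sum.group[symmetric]) auto
    also have "\<dots> \<le> (\<Sum>k\<in>{2..K}. 8 * (30 powr (- rexp) * real k powr (- rexp)))"
      by (rule sum_mono) (rule block)
    also have "\<dots> = 8 * (30 powr (- rexp) * (\<Sum>k=2..K. real k powr (- rexp)))"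
      by (simp add: sum_distrib_left)
    also have "\<dots> \<le> 8 * (722 / 100000 * (20 / 9))"
    proof -
      have "30 powr (- rexp) \<le> 722 / 100000" by (rule powr_minus_rexp_le) simp_all
      moreover have "0 \<le> (\<Sum>k=2..K. real k powr (- rexp))" by (rule sum_nonneg) simp
      ultimately have "30 powr (- rexp) * (\<Sum>k=2..K. real k powr (- rexp)) \<le> 722 / 100000 * (20 / 9)"
        by (intro mult_mono[OF _ sum_powr_minus_rexp_le]) simp_all
      then show ?thesis by simp
    qed
    finally show ?thesis by simp
  qed
  finally show ?thesis by simp
qed

text \<open>Rankin's trick: by multiplicativity all words of length \<open>n\<close> together weigh
  at most \<open>1 ^ n\<close>, while each counted word weighs at least
  \<open>Y powr (- rexp)\<close>.\<close>

lemma card_words_le: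
  fixes S :: "nat set"
  assumes S: "finite S" "\<And>p. p \<in> S \<Longrightarrow> prime p" and "Y > 0"
  shows "real (card {ws. set ws \<subseteq> S \<and> length ws = n \<and> prod_list ws \<le> Y}) \<le> real Y powr rexp"
proof -
  define \<L> where "\<L> = (\<lambda>n. {ws. set ws \<subseteq> S \<and> length ws = n})"
  have fin: "finite (\<L> n)" for n unfolding \<L>_def using S(1) by (rule finite_lists_length_eq)
  have weight: "(\<Sum>ws\<in>\<L> n. real (prod_list ws) powr (- rexp)) \<le> 1" for n
  proof (induction n)
    case 0
    have "\<L> 0 = {[]}" by (auto simp: \<L>_def)
    then show ?case by simp
  next
    case (Suc n)
    have eq: "\<L> (Suc n) = (\<lambda>(p, ws). p # ws) ` (S \<times> \<L> n)"
      by (auto simp: \<L>_def length_Suc_conv image_iff)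
    have "(\<Sum>ws\<in>\<L> (Suc n). real (prod_list ws) powr (- rexp)) =
        (\<Sum>(p, ws)\<in>S \<times> \<L> n. real p powr (- rexp) * real (prod_list ws) powr (- rexp))"
      unfolding eq by (subst sum.reindex) (auto simp: inj_on_def powr_mult case_prod_unfold intro!: sum.cong)
    also have "\<dots> = (\<Sum>p\<in>S. real p powr (- rexp)) * (\<Sum>ws\<in>\<L> n. real (prod_list ws) powr (- rexp))"
      by (simp add: sum_product sum.cartesian_product)
    also have "\<dots> \<le> 1 * 1" using sum_primes_powr_le_1[OF S] Suc
      by (intro mult_mono) (auto intro: sum_nonneg)
    finally show ?case by simp
  qed
  let ?A = "{ws. set ws \<subseteq> S \<and> length ws = n \<and> prod_list ws \<le> Y}"
  have sub: "?A \<subseteq> \<L> n" by (auto simp: \<L>_def)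
  have "card ?A * real Y powr (- rexp) = (\<Sum>ws\<in>?A. real Y powr (- rexp))" by simp
  also have "\<dots> \<le> (\<Sum>ws\<in>?A. real (prod_list ws) powr (- rexp))"
  proof (rule sum_mono)
    fix ws assume ws: "ws \<in> ?A"
    have "0 \<notin> set ws" using ws S(2) by (metis (mono_tags, lifting) mem_Collect_eq not_prime_0 subsetD)
    then have "prod_list ws > 0" by (simp add: prod_list_zero_iff flip: neq0_conv)
    then show "real Y powr (- rexp) \<le> real (prod_list ws) powr (- rexp)"
      using ws by (intro powr_mono2') (auto simp: rexp_def)
  qed
  also have "\<dots> \<le> (\<Sum>ws\<in>\<L> n. real (prod_list ws) powr (- rexp))"
    using sub fin by (intro sum_mono2) auto
  also have "\<dots> \<le> 1" by (rule weight)
  finally have "card ?A * real Y powr (- rexp) \<le> 1" .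
  then have "card ?A / real Y powr rexp \<le> 1" by (simp only: powr_minus divide_inverse)
  moreover have "real Y powr rexp > 0" using assms(3) by simp
  ultimately show ?thesis by (simp only: divide_le_eq_1_pos)
qed

subsection \<open>Counting the points of a grid\<close>

text \<open>The points \<open>c\<close> are classified by the exponents of the powers \<open>\<beta> i + c\<close>. If a large
  exponent is frequent, then few indices \<open>i\<close> already determine a small class. Otherwise some
  block of \<open>s0\<close> indices only shows small exponents, and \<open>c\<close> is classified by the shortest
  initial word of this block with product at least \<open>L\<close>.\<close>

theorem card_grid_le:
  fixes M C :: "nat set" and \<beta> :: "nat \<Rightarrow> nat" and s0 t0 \<kappa> m0 L K W r :: nat
  defines "s \<equiv> (t0 + 1) * s0"
  assumes finC: "finite C" and M: "finite M" "\<And>m. m \<in> M \<Longrightarrow> prime m \<and> m \<le> K"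
    and powers: "\<And>c i. c \<in> C \<Longrightarrow> i < s \<Longrightarrow> \<exists>m\<in>M. \<exists>y. \<beta> i + c = y ^ m"
    and inj: "inj_on \<beta> {..<s}" and r: "r > 0" "\<And>i. i < s \<Longrightarrow> r \<le> \<beta> i \<and> \<beta> i + r \<le> W"
    and C8: "\<And>c. c \<in> C \<Longrightarrow> 8 * c \<le> r" and L: "L > 1"
    and big: "\<And>R. R \<ge> L \<Longrightarrow> 512 * R\<^sup>2 * W ^ (2 * s) \<le> 2 ^ (R div 4)"
    and s0: "L \<le> 2 ^ s0" and \<kappa>: "\<And>m. m \<in> M \<Longrightarrow> m0 < m \<Longrightarrow> L \<le> m ^ \<kappa>"
    and t0: "card {m\<in>M. m0 < m} * \<kappa> \<le> t0"
  shows "real (card C) \<le> card {m\<in>M. m0 < m} * (s ^ \<kappa> * (2 * s * (L * K))) +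
    (t0 + 1) * ((s0 + 1) * (real (L * m0) powr rexp * (2 * s * (L * m0))))"
proof -
  have s0_pos: "s0 > 0" using s0 L by (cases s0) auto
  have s_pos: "s > 0" using s0_pos by (simp add: s_def)
  have W1: "W \<ge> 1" using r s_pos by force
  obtain col where col: "\<And>c i. c \<in> C \<Longrightarrow> i < s \<Longrightarrow> col c i \<in> M \<and> (\<exists>y. \<beta> i + c = y ^ col c i)"
    using powers by metis
  have class_le: "card {c\<in>C. \<forall>i\<in>I. col c i = w i} \<le> 2 * s * (\<Prod>i\<in>I. w i)"
    if I: "I \<subseteq> {..<s}" and w: "\<And>i. i \<in> I \<Longrightarrow> w i \<in> M" and prod: "L \<le> (\<Prod>i\<in>I. w i)" for I w
  proof -
    have finI: "finite I" using I finite_subset by blast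
    have cI: "card I \<le> s" using card_mono[OF _ I] by simp
    let ?R = "\<Prod>i\<in>I. w i"
    have "card {c\<in>C. \<forall>i\<in>I. col c i = w i} \<le> (?R + 1) * card I"
    proof (rule card_simultaneous_powers_le[OF finI _ _ r(1) _ W1])
      show "w i \<ge> 2" if "i \<in> I" for i using M(2)[OF w[OF that]] prime_ge_2_nat by blast
      show "inj_on \<beta> I" using inj I inj_on_subset by blast
      show "r \<le> \<beta> i \<and> \<beta> i + r \<le> W" if "i \<in> I" for i using r(2) I that by auto
      show "8 * c \<le> r" if "c \<in> {c\<in>C. \<forall>i\<in>I. col c i = w i}" for c using C8 that by auto
      show "\<exists>y. \<beta> i + c = y ^ w i" if "c \<in> {c\<in>C. \<forall>i\<in>I. col c i = w i}" "i \<in> I" for c i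
        using col[of c i] I that by auto
      have "512 * ?R\<^sup>2 * W ^ (2 * card I) \<le> 512 * ?R\<^sup>2 * W ^ (2 * s)"
        using W1 cI by (intro mult_left_mono power_increasing) auto
      also have "\<dots> \<le> 2 ^ (?R div 4)" by (rule big[OF prod])
      finally show "512 * ?R\<^sup>2 * W ^ (2 * card I) \<le> 2 ^ (?R div 4)" .
    qed
    also have "\<dots> \<le> (2 * ?R) * s" using cI prod L by (intro mult_mono) auto
    finally show ?thesis by (simp add: algebra_simps)
  qed
  define B where "B = {m\<in>M. m0 < m}"
  have finB: "finite B" using M(1) by (simp add: B_def)
  \<comment> \<open>\<open>e m\<close> occurrences of the exponent \<open>m\<close> push the product
    up to \<open>L\<close>; by minimality it stays within \<open>L * K\<close>.\<close>
  define e where "e = (\<lambda>m. LEAST j. L \<le> m ^ j)"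
  have e: "L \<le> m ^ e m" "e m \<le> \<kappa>" "m ^ e m \<le> L * K" if m: "m \<in> B" for m
  proof -
    have m': "m \<in> M" "m0 < m" using m by (auto simp: B_def)
    show e1: "L \<le> m ^ e m" unfolding e_def using \<kappa>[OF m'] by (rule LeastI)
    show "e m \<le> \<kappa>" unfolding e_def using \<kappa>[OF m'] by (rule Least_le)
    obtain j where j: "e m = Suc j" using e1 L by (cases "e m") auto
    have "\<not> L \<le> m ^ j" using not_less_Least[of j "\<lambda>j. L \<le> m ^ j"] j by (simp add: e_def)
    then have "m ^ j * m \<le> L * K" using M(2)[OF m'(1)] by (intro mult_mono) auto
    then show "m ^ e m \<le> L * K" by (simp add: j mult.commute)
  qed
  define Bad where "Bad = (\<lambda>m. {c\<in>C. e m \<le> card {i. i < s \<and> col c i = m}})"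
  have bad: "card (Bad m) \<le> s ^ \<kappa> * (2 * s * (L * K))" if m: "m \<in> B" for m
  proof -
    define F where "F = {I. I \<subseteq> {..<s} \<and> card I = e m}"
    have "Bad m \<subseteq> (\<Union>I\<in>F. {c\<in>C. \<forall>i\<in>I. col c i = m})"
    proof
      fix c assume c: "c \<in> Bad m"
      then have "e m \<le> card {i. i < s \<and> col c i = m}" by (simp add: Bad_def)
      then obtain I where I: "I \<subseteq> {i. i < s \<and> col c i = m}" "card I = e m"
        by (rule obtain_subset_with_card_n)
      then show "c \<in> (\<Union>I\<in>F. {c\<in>C. \<forall>i\<in>I. col c i = m})"
        using c by (intro UN_I[of I]) (auto simp: F_def Bad_def)
    qed
    moreover have finF: "finite F" by (rule finite_subset[of _ "Pow {..<s}"]) (auto simp: F_def)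
    ultimately have "card (Bad m) \<le> card (\<Union>I\<in>F. {c\<in>C. \<forall>i\<in>I. col c i = m})"
      using finC by (intro card_mono) auto
    also have "\<dots> \<le> (\<Sum>I\<in>F. card {c\<in>C. \<forall>i\<in>I. col c i = m})"
      by (rule card_UN_le[OF finF])
    also have "\<dots> \<le> (\<Sum>I\<in>F. 2 * s * (L * K))"
    proof (rule sum_mono)
      fix I assume I: "I \<in> F"
      have "card {c\<in>C. \<forall>i\<in>I. col c i = m} \<le> 2 * s * (\<Prod>i\<in>I. m)"
        using I e(1)[OF m] m by (intro class_le) (auto simp: F_def B_def)
      also have "\<dots> \<le> 2 * s * (L * K)" using I e(3)[OF m] by (simp add: F_def)
      finally show "card {c\<in>C. \<forall>i\<in>I. col c i = m} \<le> 2 * s * (L * K)" .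
    qed
    also have "\<dots> = card F * (2 * s * (L * K))" by simp
    also have "card F \<le> s ^ \<kappa>"
    proof -
      have "card F = s choose (e m)" unfolding F_def using n_subsets[of "{..<s}" "e m"] by simp
      also have "\<dots> \<le> s ^ e m"
        by (cases "e m \<le> s") (auto simp: binomial_le_pow binomial_eq_0)
      also have "\<dots> \<le> s ^ \<kappa>" using s_pos e(2)[OF m] by (intro power_increasing) auto
      finally show ?thesis .
    qed
    finally show ?thesis by simp
  qed
  define Sm where "Sm = {m\<in>M. m \<le> m0}"
  have Sm: "finite Sm" "\<And>m. m \<in> Sm \<Longrightarrow> prime m" using M by (auto simp: Sm_def)
  define G where "G = (\<lambda>j. {c\<in>C. \<forall>i<s0. col c (j * s0 + i) \<in> Sm})"
  have jless: "j * s0 + i < s" if "j \<le> t0" "i < s0" for i j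
  proof -
    have "j * s0 + i < (j + 1) * s0" using that by simp
    also have "\<dots> \<le> s" unfolding s_def using that by (intro mult_le_mono1) simp
    finally show ?thesis .
  qed
  \<comment> \<open>Otherwise each of the \<open>t0 + 1\<close> disjoint blocks shows a large
    exponent, while each of these occurs at most \<open>\<kappa>\<close> times: too few by the
    choice of \<open>t0\<close>.\<close>
  have cover: "C \<subseteq> (\<Union>m\<in>B. Bad m) \<union> (\<Union>j\<in>{..t0}. G j)"
  proof
    fix c assume c: "c \<in> C"
    show "c \<in> (\<Union>m\<in>B. Bad m) \<union> (\<Union>j\<in>{..t0}. G j)"
    proof (rule ccontr)
      assume neg: "c \<notin> (\<Union>m\<in>B. Bad m) \<union> (\<Union>j\<in>{..t0}. G j)"
      have few: "card {i. i < s \<and> col c i = m} \<le> \<kappa>" if "m \<in> B" for m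
      proof -
        have "card {i. i < s \<and> col c i = m} < e m" using neg that c by (auto simp: Bad_def not_le)
        then show ?thesis using e(2)[OF that] by simp
      qed
      have "\<exists>i<s0. col c (j * s0 + i) \<in> B" if j: "j \<le> t0" for j
      proof -
        obtain i where i: "i < s0" "col c (j * s0 + i) \<notin> Sm" using neg j c by (auto simp: G_def)
        then have "col c (j * s0 + i) \<in> B" using col[OF c jless[OF j i(1)]] by (auto simp: Sm_def B_def)
        then show ?thesis using i by blast
      qed
      then obtain f where f: "\<And>j. j \<le> t0 \<Longrightarrow> f j < s0 \<and> col c (j * s0 + f j) \<in> B" by metis
      have "card {..t0} \<le> card (\<Union>m\<in>B. {i. i < s \<and> col c i = m})"
      proof (rule card_inj_on_le[of "\<lambda>j. j * s0 + f j"])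
        show "inj_on (\<lambda>j. j * s0 + f j) {..t0}"
        proof (rule inj_onI)
          fix j j' assume jj: "j \<in> {..t0}" "j' \<in> {..t0}" "j * s0 + f j = j' * s0 + f j'"
          have div: "(i * s0 + f i) div s0 = i" if "i \<le> t0" for i using f[OF that] by simp
          have "j = (j * s0 + f j) div s0" using div[of j] jj(1) by simp
          also have "\<dots> = (j' * s0 + f j') div s0" by (simp only: jj(3))
          also have "\<dots> = j'" using div[of j'] jj(2) by simp
          finally show "j = j'" .
        qed
        show "(\<lambda>j. j * s0 + f j) ` {..t0} \<subseteq> (\<Union>m\<in>B. {i. i < s \<and> col c i = m})"
          using f jless by auto
        show "finite (\<Union>m\<in>B. {i. i < s \<and> col c i = m})" using finB by auto
      qed
      also have "\<dots> \<le> (\<Sum>m\<in>B. card {i. i < s \<and> col c i = m})" by (rule card_UN_le[OF finB])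
      also have "\<dots> \<le> (\<Sum>m\<in>B. \<kappa>)" by (rule sum_mono) (rule few)
      also have "\<dots> \<le> t0" using t0 by (simp add: B_def)
      finally show False by simp
    qed
  qed
  \<comment> \<open>The shortest initial word with product at least \<open>L\<close> overshoots by
    less than its last letter, a factor at most \<open>m0\<close>.\<close>
  define Y where "Y = L * m0"
  define word where "word = (\<lambda>c j n. map (\<lambda>i. col c (j * s0 + i)) [0..<n])"
  define Ws where "Ws = (\<lambda>n. {ws. set ws \<subseteq> Sm \<and> length ws = n \<and> prod_list ws \<le> Y})"
  have prod_word: "prod_list (word c j n) = (\<Prod>i<n. col c (j * s0 + i))" for c j n
    by (simp add: word_def interv_sum_list_conv_sum_set_nat atLeast0LessThan prod.distinct_set_conv_list[symmetric])
  have good: "real (card (G j)) \<le> (s0 + 1) * (real Y powr rexp * (2 * s * Y))" if j: "j \<le> t0" for j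
  proof -
    define Cl where "Cl = (\<lambda>n ws. {c\<in>C. word c j n = ws \<and> L \<le> prod_list ws})"
    have "G j \<subseteq> (\<Union>n\<in>{..s0}. \<Union>ws\<in>Ws n. Cl n ws)"
    proof
      fix c assume c: "c \<in> G j"
      define Q where "Q = (\<lambda>n. L \<le> prod_list (word c j n))"
      have small: "col c (j * s0 + i) \<in> Sm" if "i < s0" for i using c that by (auto simp: G_def)
      have "2 ^ s0 \<le> (\<Prod>i<s0. col c (j * s0 + i))"
      proof -
        have "(\<Prod>i<s0. 2::nat) \<le> (\<Prod>i<s0. col c (j * s0 + i))"
          using Sm(2)[OF small] prime_ge_2_nat by (intro prod_mono) auto
        then show ?thesis by simp
      qed
      then have Qs0: "Q s0" using s0 by (simp add: Q_def prod_word)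
      define n where "n = (LEAST n. Q n)"
      have n: "Q n" "n \<le> s0" unfolding n_def using LeastI[of Q, OF Qs0] Least_le[of Q, OF Qs0] by auto
      have "\<not> Q 0" using L by (simp add: Q_def prod_word)
      then obtain k where k: "n = Suc k" using n(1) by (cases n) auto
      have "\<not> Q k" using not_less_Least[of k Q] k by (simp add: n_def)
      then have "prod_list (word c j k) \<le> L" by (simp add: Q_def)
      moreover have "col c (j * s0 + k) \<le> m0" using small[of k] n(2) k by (simp add: Sm_def)
      ultimately have "prod_list (word c j n) \<le> Y"
        unfolding Y_def k prod_word by (simp add: mult_mono)
      then have "word c j n \<in> Ws n" using small n(2) by (auto simp: Ws_def word_def)
      then show "c \<in> (\<Union>n\<in>{..s0}. \<Union>ws\<in>Ws n. Cl n ws)"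
        using c n by (auto simp: Cl_def G_def Q_def)
    qed
    moreover have finWs: "finite (Ws n)" for n
      by (rule finite_subset[OF _ finite_lists_length_eq[OF Sm(1), of n]]) (auto simp: Ws_def)
    ultimately have "card (G j) \<le> card (\<Union>n\<in>{..s0}. \<Union>ws\<in>Ws n. Cl n ws)"
      using finC by (intro card_mono) (auto simp: Cl_def)
    also have "\<dots> \<le> (\<Sum>n\<le>s0. card (\<Union>ws\<in>Ws n. Cl n ws))" by (rule card_UN_le) simp
    also have "\<dots> \<le> (\<Sum>n\<le>s0. \<Sum>ws\<in>Ws n. card (Cl n ws))" by (intro sum_mono card_UN_le finWs)
    also have "\<dots> \<le> (\<Sum>n\<le>s0. \<Sum>ws\<in>Ws n. 2 * s * Y)"
    proof (intro sum_mono)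
      fix n ws assume n: "n \<in> {..s0}" and ws: "ws \<in> Ws n"
      show "card (Cl n ws) \<le> 2 * s * Y"
      proof (cases "L \<le> prod_list ws")
        case True
        define I where "I = (\<lambda>i. j * s0 + i) ` {..<n}"
        define w where "w = (\<lambda>i. ws ! (i - j * s0))"
        have len: "length ws = n" "set ws \<subseteq> Sm" "prod_list ws \<le> Y" using ws by (auto simp: Ws_def)
        have injI: "inj_on (\<lambda>i. j * s0 + i) {..<n}" by simp
        have "(\<Prod>i\<in>I. w i) = (\<Prod>i<n. ws ! i)" unfolding I_def using injI by (simp add: prod.reindex w_def)
        also have "\<dots> = prod_list ws" using prod.list_conv_set_nth[of ws] len by (simp add: atLeast0LessThan)
        finally have pw: "(\<Prod>i\<in>I. w i) = prod_list ws" .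
        have "Cl n ws \<subseteq> {c\<in>C. \<forall>i\<in>I. col c i = w i}"
          by (auto simp: Cl_def I_def w_def word_def)
        then have "card (Cl n ws) \<le> card {c\<in>C. \<forall>i\<in>I. col c i = w i}" using finC by (intro card_mono) auto
        also have "\<dots> \<le> 2 * s * (\<Prod>i\<in>I. w i)"
        proof (rule class_le)
          show "I \<subseteq> {..<s}" using jless[OF j] n by (auto simp: I_def)
          show "w i \<in> M" if "i \<in> I" for i
          proof -
            have "w i \<in> set ws" using that len by (auto simp: I_def w_def)
            then show ?thesis using len by (auto simp: Sm_def)
          qed
          show "L \<le> (\<Prod>i\<in>I. w i)" using True pw by simp
        qed
        also have "\<dots> \<le> 2 * s * Y" using pw len by simp
        finally show ?thesis .
      qed (simp add: Cl_def)
    qed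
    finally have "real (card (G j)) \<le> real (\<Sum>n\<le>s0. \<Sum>ws\<in>Ws n. 2 * s * Y)" by (rule of_nat_mono)
    also have "\<dots> = (\<Sum>n\<le>s0. real (card (Ws n)) * (2 * real s * real Y))" by simp
    also have "\<dots> \<le> (\<Sum>n\<le>s0. real Y powr rexp * (2 * real s * real Y))"
    proof (intro sum_mono mult_right_mono)
      fix n :: nat
      show "real (card (Ws n)) \<le> real Y powr rexp"
      proof (cases "Y > 0")
        case True
        show ?thesis unfolding Ws_def using card_words_le[OF Sm(1) Sm(2) True] by simp
      next
        case False
        then have "m0 = 0" using L by (simp add: Y_def)
        then have "Sm = {}" using Sm(2) by (auto simp: Sm_def)
        moreover have "prod_list ([]::nat list) > Y" using False by simp
        ultimately have "Ws n = {}" by (auto simp: Ws_def)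
        then show ?thesis by simp
      qed
    qed simp
    also have "\<dots> = (s0 + 1) * (real Y powr rexp * (2 * s * Y))" by simp
    finally show ?thesis .
  qed
  have "card C \<le> card ((\<Union>m\<in>B. Bad m) \<union> (\<Union>j\<in>{..t0}. G j))"
    using cover finB finC by (intro card_mono) (auto simp: Bad_def G_def)
  also have "\<dots> \<le> card (\<Union>m\<in>B. Bad m) + card (\<Union>j\<in>{..t0}. G j)" by (rule card_Un_le)
  also have "\<dots> \<le> (\<Sum>m\<in>B. card (Bad m)) + (\<Sum>j\<le>t0. card (G j))"
    by (intro add_mono card_UN_le finB) auto
  finally have "real (card C) \<le> real ((\<Sum>m\<in>B. card (Bad m)) + (\<Sum>j\<le>t0. card (G j)))" by (rule of_nat_mono)
  also have "\<dots> = (\<Sum>m\<in>B. real (card (Bad m))) + (\<Sum>j\<le>t0. real (card (G j)))" by simp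
  also have "\<dots> \<le> (\<Sum>m\<in>B. real (s ^ \<kappa> * (2 * s * (L * K)))) +
      (\<Sum>j\<le>t0. (s0 + 1) * (real Y powr rexp * (2 * s * Y)))"
    by (intro add_mono sum_mono of_nat_mono bad good) auto
  finally show ?thesis by (simp add: B_def Y_def)
qed

subsection \<open>A grid of constant valuation\<close>

text \<open>Sums of the smallest generators are dominated by a sum of many larger ones; this
  provides the bound \<open>8 * c \<le> X\<close>.\<close>

lemma exists_lower_subset:
  fixes A :: "nat set"
  assumes "finite A" "n \<le> card A"
  shows "\<exists>B\<subseteq>A. card B = n \<and> (\<forall>b\<in>B. \<forall>a\<in>A - B. b \<le> a)"
  using assms(2)
proof (induction n)
  case 0
  show ?case by (intro exI[of _ "{}"]) simp
next
  case (Suc n)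
  then obtain B where B: "B \<subseteq> A" "card B = n" "\<forall>b\<in>B. \<forall>a\<in>A - B. b \<le> a" by auto
  have finB: "finite B" using B(1) assms(1) finite_subset by blast
  have "A - B \<noteq> {}" using B Suc.prems finB by (metis Diff_eq_empty_iff card_mono not_less_eq_eq)
  define a where "a = Min (A - B)"
  have a: "a \<in> A - B" "\<And>x. x \<in> A - B \<Longrightarrow> a \<le> x"
    unfolding a_def using Min_in[of "A - B"] Min_le[of "A - B"] \<open>A - B \<noteq> {}\<close> assms(1) by blast+
  then show ?case using B finB by (intro exI[of _ "insert a B"]) auto
qed

text \<open>Each of \<open>s\<close> groups of \<open>p\<close> elements has a nonempty subset whose
  sum gains a factor \<open>p\<close>; accumulating these positive sums gives the chain.\<close>

lemma chain_of_multiples: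
  fixes A :: "nat set"
  assumes "finite A" "card A = s * p" "p > 0" "\<And>a. a \<in> A \<Longrightarrow> a > 0 \<and> p ^ k dvd a"
  shows "\<exists>b. (\<forall>i j. i < j \<and> j < s \<longrightarrow> b i < b j) \<and> (\<forall>i<s. b i \<in> subset_sums A \<and> p ^ Suc k dvd b i)"
  using assms
proof (induction s arbitrary: A)
  case 0
  then show ?case by auto
next
  case (Suc s)
  obtain G where G: "G \<subseteq> A" "card G = p"
    using obtain_subset_with_card_n[of p A] Suc.prems(2) by auto
  have finG: "finite G" using G(1) Suc.prems(1) finite_subset by blast
  have "card (A - G) = s * p" using G finG Suc.prems(2) by (simp add: card_Diff_subset)
  then obtain b where b: "\<forall>i j. i < j \<and> j < s \<longrightarrow> b i < b j"
    "\<forall>i<s. b i \<in> subset_sums (A - G) \<and> p ^ Suc k dvd b i"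
    using Suc.IH[of "A - G"] Suc.prems by auto
  obtain S where S: "S \<subseteq> G" "S \<noteq> {}" "p dvd (\<Sum>a\<in>S. a div p ^ k)"
    using zero_sum_subset[OF finG G(2) \<open>p > 0\<close>] by blast
  have finS: "finite S" using S(1) finG finite_subset by blast
  have "(\<Sum>a\<in>S. p ^ k * (a div p ^ k)) = \<Sum>S"
    using Suc.prems(4) S(1) G(1) by (intro sum.cong) auto
  then have "p ^ k * (\<Sum>a\<in>S. a div p ^ k) = \<Sum>S" by (simp add: sum_distrib_left)
  then have dS: "p ^ Suc k dvd \<Sum>S" using S(3) by (metis mult_dvd_mono dvd_refl power_Suc2)
  obtain a where a: "a \<in> S" using S(2) by blast
  have "0 < a" using Suc.prems(4) a S(1) G(1) by blast
  also have "a \<le> \<Sum>S" using a finS by (intro member_le_sum) auto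
  finally have pos: "\<Sum>S > 0" .
  have SG: "\<Sum>S \<in> subset_sums G" using S(1) by (rule subset_sumsI)
  have AG: "A - G \<union> G = A" using G(1) by blast
  define t where "t = (if s = 0 then 0 else b (s - 1))"
  have t: "t \<in> subset_sums (A - G)" "p ^ Suc k dvd t" using b(2) by (auto simp: t_def)
  have bt: "b i \<le> t" if "i < s" for i
  proof (cases "i = s - 1")
    case False
    then have "b i < b (s - 1)" using b(1) that by simp
    then show ?thesis using that by (simp add: t_def)
  qed (use that in \<open>simp add: t_def\<close>)
  define b' where "b' = (\<lambda>i. if i < s then b i else t + \<Sum>S)"
  have "b' i < b' j" if "i < j \<and> j < Suc s" for i j
    using that b(1) bt[of i] pos by (auto simp: b'_def)
  moreover have "b' i \<in> subset_sums A \<and> p ^ Suc k dvd b' i" if "i < Suc s" for i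
  proof (cases "i < s")
    case True
    then show ?thesis using b(2) subset_sums_mono[of "A - G" A] by (auto simp: b'_def)
  next
    case False
    have "t + \<Sum>S \<in> subset_sums (A - G \<union> G)"
      using t(1) SG Suc.prems(1) finG by (intro subset_sums_Un) auto
    then show ?thesis using False t(2) dS AG by (auto simp: b'_def intro: dvd_add)
  qed
  ultimately show ?case by blast
qed

text \<open>All elements of the grid have \<open>p\<close>-adic valuation \<open>k\<close>, so that the exponents are
  divisors of \<open>k\<close>; and \<open>k\<close> is logarithmic in \<open>N\<close>, as \<open>p ^ k\<close> divides an element of \<open>A\<close>.\<close>

theorem exists_grid:
  fixes A :: "nat set" and a0 p N n s :: nat
  assumes A: "A \<subseteq> {1..N}" and p: "prime p" "p dvd a0" "a0 > 0"
    and PP: "(+) a0 ` subset_sums A \<subseteq> perfect_powers"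
    and size: "2 * p + 1 + 9 * n + s * p \<le> card A" "n \<ge> 1"
  obtains Lo C \<beta> X k where "Lo \<subseteq> A" "card Lo = n" "C \<subseteq> subset_sums Lo" "card (subset_sums Lo) \<le> 2 * card C"
    "k > 0" "2 ^ k \<le> N" "inj_on \<beta> {..<s}" "X > 0"
    "\<And>i. i < s \<Longrightarrow> X \<le> \<beta> i \<and> a0 \<le> \<beta> i \<and> \<beta> i \<le> a0 + card A * N" "\<And>c. c \<in> C \<Longrightarrow> 8 * c \<le> X"
    "\<And>c i. c \<in> C \<Longrightarrow> i < s \<Longrightarrow> \<exists>m\<in>prime_factors k. \<exists>y. \<beta> i + c = y ^ m"
proof -
  have finA: "finite A" using A finite_subset by blast
  have p1: "p > 1" using p(1) prime_gt_1_nat by blast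
  define A0 where "A0 = {a\<in>A. p dvd a}"
  have A0: "finite A0" "A0 \<subseteq> A" using finA by (auto simp: A0_def)
  have "card A = card A0 + card {a\<in>A. \<not> p dvd a}"
    unfolding A0_def using finA by (subst card_Un_disjoint[symmetric]) (auto intro: arg_cong[where f = card])
  then have cA0: "card A \<le> card A0 + 2 * p" using card_not_dvd_less[OF finA p(1) PP] by simp
  define V where "V = insert a0 A0"
  have V: "finite V" "V \<noteq> {}" using A0 by (auto simp: V_def)
  have Vpos: "x > 0 \<and> p dvd x" if "x \<in> V" for x using that p A by (auto simp: V_def A0_def)
  \<comment> \<open>By minimality \<open>p ^ k\<close> divides every sum used below, so valuation
    \<open>k\<close> just means that \<open>p ^ Suc k\<close> does not divide it.\<close>
  define k where "k = Min (multiplicity p ` V)"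
  have kV: "k \<in> multiplicity p ` V" unfolding k_def using V by (intro Min_in) auto
  have k_le: "k \<le> multiplicity p x" if "x \<in> V" for x unfolding k_def using V that by simp
  have dk: "p ^ k dvd x" if "x \<in> V" for x using k_le[OF that] by (rule multiplicity_dvd')
  have dSuc: "p ^ Suc k dvd x \<longleftrightarrow> multiplicity p x \<noteq> k" if "x \<in> V" for x
  proof -
    have "p ^ Suc k dvd x \<longleftrightarrow> Suc k \<le> multiplicity p x"
      using Vpos[OF that] p1 by (intro power_dvd_iff_le_multiplicity) auto
    then show ?thesis using k_le[OF that] by auto
  qed
  have "multiplicity p x \<ge> 1" if "x \<in> V" for x
    using Vpos[OF that] p1 power_dvd_iff_le_multiplicity[of x p 1] by auto
  then have k_pos: "k > 0" using kV by force
  have "A0 \<noteq> {}" using cA0 size by auto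
  then obtain a1 where a1: "a1 \<in> A0" by blast
  have "2 ^ k \<le> p ^ k" using p1 by (intro power_mono) auto
  also have "p ^ k \<le> a1" using dk[of a1] Vpos[of a1] a1 by (auto simp: V_def intro: dvd_imp_le)
  also have "a1 \<le> N" using a1 A0 A by auto
  finally have kN: "2 ^ k \<le> N" .
  \<comment> \<open>\<open>Z\<close> reserves one generator of exact valuation \<open>k\<close>. If
    none exists, \<open>a0\<close> alone has valuation \<open>k\<close>, and then so has every
    sum.\<close>
  obtain Z where Z: "Z \<subseteq> A0" "card Z \<le> 1" "\<And>z. z \<in> Z \<Longrightarrow> \<not> p ^ Suc k dvd z"
    "Z = {} \<Longrightarrow> \<not> p ^ Suc k dvd a0 \<and> (\<forall>a\<in>A0. p ^ Suc k dvd a)"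
  proof (cases "\<exists>z\<in>A0. \<not> p ^ Suc k dvd z")
    case True
    then obtain z where "z \<in> A0" "\<not> p ^ Suc k dvd z" by blast
    then show ?thesis using that[of "{z}"] by auto
  next
    case False
    obtain x where x: "x \<in> V" "multiplicity p x = k" using kV by auto
    then have "\<not> p ^ Suc k dvd x" using dSuc by blast
    then have "x = a0" using False x(1) by (auto simp: V_def)
    then show ?thesis using that[of "{}"] False \<open>\<not> p ^ Suc k dvd x\<close> by auto
  qed
  have finZ: "finite Z" using Z(1) A0 finite_subset by blast
  define A1 where "A1 = A0 - Z"
  have A1: "finite A1" "A1 \<subseteq> A0" using A0 by (auto simp: A1_def)
  have cA1: "card A0 \<le> card A1 + 1" using Z finZ by (simp add: A1_def card_Diff_subset)
  \<comment> \<open>The hypothesis \<open>size\<close> pays for fewer than \<open>2 * p\<close>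
    elements prime to \<open>p\<close>, one in \<open>Z\<close>, \<open>n\<close> in
    \<open>Lo\<close>, \<open>s * p\<close> in \<open>AB\<close>, and at least \<open>8 * n\<close>
    in \<open>T\<close>, none of which is below an element of \<open>Lo\<close>.\<close>
  obtain Lo where Lo: "Lo \<subseteq> A1" "card Lo = n" "\<forall>b\<in>Lo. \<forall>a\<in>A1 - Lo. b \<le> a"
    using exists_lower_subset[OF A1(1), of n] size cA0 cA1 by auto
  have finLo: "finite Lo" using Lo(1) A1 finite_subset by blast
  have cA1Lo: "card (A1 - Lo) = card A1 - n" using Lo finLo by (simp add: card_Diff_subset)
  then have "s * p \<le> card (A1 - Lo)" using size cA0 cA1 by simp
  then obtain AB where AB: "AB \<subseteq> A1 - Lo" "card AB = s * p"
    by (rule obtain_subset_with_card_n)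
  have finAB: "finite AB" using AB(1) A1 finite_subset by blast
  define T where "T = A1 - Lo - AB"
  have finT: "finite T" using A1 by (simp add: T_def)
  have "card T = card A1 - n - s * p" using AB finAB cA1Lo by (simp add: T_def card_Diff_subset)
  then have cT: "8 * n \<le> card T" using size cA0 cA1 by simp
  have small: "8 * c \<le> \<Sum>T" if c: "c \<in> subset_sums Lo" for c
  proof -
    define \<mu> where "\<mu> = Max Lo"
    have "Lo \<noteq> {}" using Lo(2) size(2) by auto
    then have \<mu>: "\<mu> \<in> Lo" "\<And>x. x \<in> Lo \<Longrightarrow> x \<le> \<mu>" using finLo by (auto simp: \<mu>_def)
    obtain S where S: "S \<subseteq> Lo" "c = \<Sum>S" using c by (auto simp: subset_sums_def)
    have "c \<le> (\<Sum>x\<in>S. \<mu>)" unfolding S(2) using S(1) \<mu>(2) by (intro sum_mono) auto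
    also have "\<dots> \<le> n * \<mu>" using card_mono[OF finLo S(1)] Lo(2) by simp
    finally have "8 * c \<le> (8 * n) * \<mu>" by simp
    also have "\<dots> \<le> card T * \<mu>" using cT by (rule mult_le_mono1)
    also have "\<dots> = (\<Sum>x\<in>T. \<mu>)" by simp
    also have "\<dots> \<le> \<Sum>T" using Lo(3) \<mu>(1) by (intro sum_mono) (auto simp: T_def)
    finally show ?thesis .
  qed
  \<comment> \<open>Adding a \<open>z\<close> of exact valuation \<open>k\<close> destroys
    divisibility by \<open>p ^ Suc k\<close>. So at least half of the sums \<open>c\<close> are
    good, either without \<open>z\<close> or with it.\<close>
  define C1 where "C1 = {c\<in>subset_sums Lo. \<not> p ^ Suc k dvd a0 + \<Sum>T + c}"
  obtain T' C where T': "T \<subseteq> T'" "T' \<subseteq> T \<union> Z" and C: "C \<subseteq> subset_sums Lo"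
    "card (subset_sums Lo) \<le> 2 * card C" "\<And>c. c \<in> C \<Longrightarrow> \<not> p ^ Suc k dvd a0 + \<Sum>T' + c"
  proof (cases "card (subset_sums Lo) \<le> 2 * card C1")
    case True
    then show ?thesis using that[of T C1] by (auto simp: C1_def)
  next
    case False
    have "Z \<noteq> {}"
    proof
      assume "Z = {}"
      then have d: "\<not> p ^ Suc k dvd a0" "\<And>a. a \<in> A0 \<Longrightarrow> p ^ Suc k dvd a" using Z(4) by auto
      have "\<not> p ^ Suc k dvd a0 + \<Sum>T + c" if c: "c \<in> subset_sums Lo" for c
      proof -
        obtain S where S: "S \<subseteq> Lo" "c = \<Sum>S" using c by (auto simp: subset_sums_def)
        have "p ^ Suc k dvd \<Sum>T" "p ^ Suc k dvd c" unfolding S(2)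
          using d(2) S(1) Lo(1) A1(2) by (auto intro!: dvd_sum simp: T_def)
        then show ?thesis using d(1) by (metis dvd_add_left_iff)
      qed
      then have "C1 = subset_sums Lo" by (auto simp: C1_def)
      then show False using False by simp
    qed
    then obtain z where z: "z \<in> Z" by blast
    have zT: "z \<notin> T" using z by (auto simp: T_def A1_def)
    define C2 where "C2 = subset_sums Lo - C1"
    have "card C2 = card (subset_sums Lo) - card C1"
      unfolding C2_def using finLo by (intro card_Diff_subset) (auto simp: C1_def)
    then have "card (subset_sums Lo) \<le> 2 * card C2" using False by simp
    moreover have "\<not> p ^ Suc k dvd a0 + \<Sum>(insert z T) + c" if "c \<in> C2" for c
    proof
      assume d: "p ^ Suc k dvd a0 + \<Sum>(insert z T) + c"
      have "p ^ Suc k dvd a0 + \<Sum>T + c" using that by (auto simp: C2_def C1_def)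
      moreover have "a0 + \<Sum>(insert z T) + c = (a0 + \<Sum>T + c) + z" using finT zT by simp
      ultimately have "p ^ Suc k dvd z" using d by (metis dvd_add_right_iff)
      then show False using Z(3)[OF z] by simp
    qed
    ultimately show ?thesis using z that[of "insert z T" C2] by (auto simp: C2_def)
  qed
  have T'A: "T' \<subseteq> A0" "T' \<inter> Lo = {}" "T' \<inter> AB = {}" using T' Z(1) A1 Lo(1) AB(1) by (auto simp: T_def A1_def)
  have finT': "finite T'" using T'A A0 finite_subset by blast
  define X where "X = a0 + \<Sum>T'"
  have "\<Sum>T \<le> \<Sum>T'" using T'(1) finT' by (intro sum_mono2) auto
  then have X8: "8 * c \<le> X" if "c \<in> C" for c using small[of c] that C(1) by (auto simp: X_def)
  have "\<And>a. a \<in> AB \<Longrightarrow> a > 0 \<and> p ^ k dvd a" using AB(1) A1 Vpos dk by (auto simp: V_def)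
  then obtain b where b: "\<forall>i j. i < j \<and> j < s \<longrightarrow> b i < b j"
    "\<forall>i<s. b i \<in> subset_sums AB \<and> p ^ Suc k dvd b i"
    using chain_of_multiples[OF finAB AB(2), of k] p1 by auto
  define \<beta> where "\<beta> = (\<lambda>i. X + b i)"
  have inj: "inj_on \<beta> {..<s}"
  proof (rule inj_onI)
    fix i j assume "i \<in> {..<s}" "j \<in> {..<s}" "\<beta> i = \<beta> j"
    then show "i = j" using b(1) by (metis \<beta>_def add_left_cancel lessThan_iff linorder_neqE_nat order.irrefl)
  qed
  have inA: "\<Sum>T' + b i + c \<in> subset_sums A" if "i < s" "c \<in> subset_sums Lo" for i c
  proof -
    have "\<Sum>T' + b i \<in> subset_sums (T' \<union> AB)"
      using b(2) that(1) finT' finAB T'A(3) by (intro subset_sums_Un subset_sumsI) auto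
    then have "\<Sum>T' + b i + c \<in> subset_sums (T' \<union> AB \<union> Lo)"
      using that(2) finT' finAB finLo T'A AB(1) by (intro subset_sums_Un[of "T' \<union> AB" Lo]) auto
    moreover have "T' \<union> AB \<union> Lo \<subseteq> A" using T'A AB(1) Lo(1) A1(2) A0(2) by blast
    ultimately show ?thesis using subset_sums_mono by blast
  qed
  have \<beta>_le: "\<beta> i \<le> a0 + card A * N" if "i < s" for i
  proof -
    have "\<Sum>T' + b i \<in> subset_sums A" using inA[OF that, of 0] by simp
    then obtain S where S: "S \<subseteq> A" "\<Sum>T' + b i = \<Sum>S" by (auto simp: subset_sums_def)
    have "\<Sum>S \<le> \<Sum>A" using S(1) finA by (intro sum_mono2) auto
    also have "\<dots> \<le> (\<Sum>a\<in>A. N)" using A by (intro sum_mono) auto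
    finally show ?thesis using S(2) by (simp add: \<beta>_def X_def)
  qed
  have exps: "\<exists>m\<in>prime_factors k. \<exists>y. \<beta> i + c = y ^ m" if c: "c \<in> C" and i: "i < s" for c i
  proof -
    have eq: "\<beta> i + c = a0 + (\<Sum>T' + b i + c)" by (simp add: \<beta>_def X_def)
    have "\<beta> i + c \<in> perfect_powers" unfolding eq using inA[OF i] c C(1) PP by blast
    then obtain y m where ym: "\<beta> i + c = y ^ m" "2 \<le> m" by (auto simp: perfect_powers_def)
    have "p ^ k dvd x" if "x \<in> subset_sums A0" for x
      using that dk by (auto simp: subset_sums_def V_def intro!: dvd_sum)
    moreover have "b i \<in> subset_sums A0" using b(2) i subset_sums_mono[of AB A0] AB(1) A1 by blast
    moreover have "c \<in> subset_sums A0" using c C(1) subset_sums_mono[of Lo A0] Lo(1) A1 by blast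
    moreover have "\<Sum>T' \<in> subset_sums A0" using T'A(1) by (rule subset_sumsI)
    moreover have "p ^ k dvd a0" using dk by (simp add: V_def)
    ultimately have d1: "p ^ k dvd \<beta> i + c" unfolding eq by (intro dvd_add) auto
    have d2: "\<not> p ^ Suc k dvd \<beta> i + c"
    proof
      assume "p ^ Suc k dvd \<beta> i + c"
      moreover have "\<beta> i + c = (a0 + \<Sum>T' + c) + b i" by (simp add: \<beta>_def X_def)
      moreover have "p ^ Suc k dvd b i" using b(2) i by blast
      ultimately have "p ^ Suc k dvd a0 + \<Sum>T' + c" by (metis dvd_add_left_iff)
      then show False using C(3)[OF c] by simp
    qed
    have "multiplicity p (\<beta> i + c) = k" using d1 d2 by (intro multiplicity_eqI) auto
    moreover have "y \<noteq> 0" using ym d2 by (intro notI) (auto simp: power_0_left)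
    ultimately have "k = m * multiplicity p y"
      using ym(1) p(1) by (simp add: prime_elem_multiplicity_power_distrib)
    then have mk: "m dvd k" by simp
    \<comment> \<open>An \<open>m\<close>-th power is also a \<open>q\<close>-th power for a prime
      \<open>q\<close> dividing \<open>m\<close>, so prime exponents suffice.\<close>
    obtain q where q: "prime q" "q dvd m" using ym(2) by (metis prime_factor_nat numeral_le_one_iff semiring_norm(69))
    then have "q \<in> prime_factors k" using mk k_pos by (auto simp: prime_factors_dvd)
    moreover have "\<beta> i + c = (y ^ (m div q)) ^ q" using q(2) ym(1) by (simp flip: power_mult)
    ultimately show ?thesis by blast
  qed
  show ?thesis
  proof (rule that[of Lo C k \<beta> X])
    show "Lo \<subseteq> A" using Lo(1) A1(2) A0(2) by blast
    show "X > 0" using p(3) by (simp add: X_def)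
    show "X \<le> \<beta> i \<and> a0 \<le> \<beta> i \<and> \<beta> i \<le> a0 + card A * N" if "i < s" for i
      using \<beta>_le[OF that] by (simp add: \<beta>_def X_def)
  qed (use Lo(2) C k_pos kN inj X8 exps in auto)
qed

text \<open>Consecutive \<open>m\<close>-th powers differ by at least \<open>y ^ (m - 1)\<close>,
  and \<open>m \<le> 2 * (m - 1)\<close>.\<close>

lemma power_gap:
  fixes y z m :: nat
  assumes "y ^ m < z ^ m" "m \<ge> 2"
  shows "y ^ m \<le> (z ^ m - y ^ m)\<^sup>2"
proof -
  have yz: "Suc y \<le> z" using assms(1) by (meson Suc_leI not_less power_mono zero_le)
  obtain j where j: "m = Suc (Suc j)" using assms(2) by (metis add_2_eq_Suc le_Suc_ex)
  have "y ^ m + y ^ Suc j \<le> Suc y ^ m"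
  proof -
    have "y ^ m + y ^ Suc j = Suc y * y ^ Suc j" by (simp add: j)
    also have "\<dots> \<le> Suc y * Suc y ^ Suc j" by (intro mult_left_mono power_mono) auto
    finally show ?thesis by (simp add: j)
  qed
  also have "\<dots> \<le> z ^ m" using yz by (intro power_mono) auto
  finally have le: "y ^ Suc j \<le> z ^ m - y ^ m" by simp
  have "y ^ m \<le> (y ^ Suc j)\<^sup>2"
  proof (cases "y = 0")
    case False
    then have "y ^ m \<le> y ^ (Suc j * 2)" by (intro power_increasing) (auto simp: j)
    then show ?thesis by (simp only: power_mult)
  qed (simp add: j)
  also have "\<dots> \<le> (z ^ m - y ^ m)\<^sup>2" using le by (intro power_mono) auto
  finally show ?thesis .
qed

text \<open>Two different \<open>m\<close>-th powers cannot be this close, so the exponent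
  determines \<open>c\<close>. This serves the case of a huge \<open>a0\<close>.\<close>

lemma card_powers_in_short_interval:
  fixes M C :: "nat set"
  assumes "finite M" "\<And>m. m \<in> M \<Longrightarrow> m \<ge> 2" "\<And>c. c \<in> C \<Longrightarrow> \<exists>m\<in>M. \<exists>y. \<beta> + c = y ^ m"
    "\<And>c. c \<in> C \<Longrightarrow> c \<le> \<Delta>" "\<Delta>\<^sup>2 < \<beta>"
  shows "card C \<le> card M"
proof -
  obtain m y where my: "\<And>c. c \<in> C \<Longrightarrow> m c \<in> M \<and> \<beta> + c = y c ^ m c" using assms(3) by metis
  have less: False if "c \<in> C" "c' \<in> C" "m c = m c'" "c < c'" for c c'
  proof -
    have "y c ^ m c \<le> (y c' ^ m c - y c ^ m c)\<^sup>2"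
      using that my[of c] my[of c'] assms(2) by (intro power_gap) auto
    also have "y c' ^ m c - y c ^ m c = c' - c" using my[of c] my[of c'] that by (metis add_diff_cancel_left)
    also have "(c' - c)\<^sup>2 \<le> \<Delta>\<^sup>2" using assms(4)[OF that(2)] by (intro power_mono) auto
    finally show False using my[OF that(1)] assms(5) by simp
  qed
  show ?thesis
  proof (rule card_inj_on_le[of m])
    show "inj_on m C" by (rule inj_onI) (metis less linorder_neqE_nat)
  qed (use my assms(1) in auto)
qed

subsection \<open>Conclusion\<close>

text \<open>In logarithms, \<open>R \<ge> x powr 1.003\<close> beats \<open>s * ln W\<close>, of
  order \<open>x powr 1.001001\<close>. A quarter of the available \<open>R / 4 * ln 2\<close> pays
  for \<open>W\<close>, the rest for \<open>512 * R ^ 2\<close> and the rounding in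
  \<open>R div 4\<close>.\<close>

lemma big_power_condition:
  "\<forall>\<^sub>F x in at_top. \<forall>R W s :: nat. x powr 1.003 \<le> R \<longrightarrow> W > 0 \<longrightarrow> s \<le> x powr (1 / 1000000) \<longrightarrow>
     ln W \<le> 5 * x powr 1.001 \<longrightarrow> 512 * R\<^sup>2 * W ^ (2 * s) \<le> 2 ^ (R div 4)"
proof -
  have "\<forall>\<^sub>F y::real in at_top. ln 512 + 2 * ln y + ln 2 \<le> 3 / 16 * ln 2 * y" by real_asymp
  then obtain y0 where y0: "\<And>y::real. y \<ge> y0 \<Longrightarrow> ln 512 + 2 * ln y + ln 2 \<le> 3 / 16 * ln 2 * y"
    unfolding eventually_at_top_linorder by blast
  have "\<forall>\<^sub>F x::real in at_top. 2 * x powr (1 / 1000000) * (5 * x powr 1.001) \<le> ln 2 / 16 * x powr 1.003"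
    by real_asymp
  moreover have "\<forall>\<^sub>F x in at_top. x \<ge> max 1 y0" by (rule eventually_ge_at_top)
  ultimately show ?thesis
  proof (eventually_elim, intro allI impI)
    fix x and R W s :: nat
    assume x1: "2 * x powr (1 / 1000000) * (5 * x powr 1.001) \<le> ln 2 / 16 * x powr 1.003" and x: "x \<ge> max 1 y0"
      and R: "x powr 1.003 \<le> real R" and W: "W > 0" "ln (real W) \<le> 5 * x powr 1.001"
      and s: "real s \<le> x powr (1 / 1000000)"
    have x': "x \<ge> 1" "x \<ge> y0" using x by auto
    have "x \<le> x powr 1.003" using powr_mono[of 1 "1.003" x] x' by simp
    then have R': "real R \<ge> y0" "R > 0" using x' R by (auto intro!: Nat.gr0I)
    have 1: "ln (real (512 * R\<^sup>2 * W ^ (2 * s))) = ln 512 + 2 * ln (real R) + 2 * s * ln (real W)"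
      using R' W by (simp add: ln_mult ln_realpow)
    have "2 * s * ln (real W) \<le> 2 * x powr (1 / 1000000) * (5 * x powr 1.001)"
      using s W by (intro mult_mono) auto
    also have "\<dots> \<le> ln 2 / 16 * x powr 1.003" by (rule x1)
    also have "\<dots> \<le> ln 2 / 16 * R" using R by (intro mult_left_mono) auto
    finally have 2: "2 * s * ln (real W) \<le> ln 2 / 16 * R" .
    have 3: "ln 512 + 2 * ln (real R) + ln 2 / 16 * R \<le> (R / 4 - 1) * ln 2"
      using y0[OF R'(1)] by argo
    have 4: "(R / 4 - 1) * ln 2 \<le> real (R div 4) * ln 2"
    proof (rule mult_right_mono)
      have "R < 4 * (R div 4) + 4" by presburger
      then have "real R < real (4 * (R div 4) + 4)" by (simp only: of_nat_less_iff)
      then show "R / 4 - 1 \<le> real (R div 4)" by simp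
    qed simp
    have 5: "real (R div 4) * ln 2 = ln (real (2 ^ (R div 4)))" by (simp add: ln_realpow)
    have "ln (real (512 * R\<^sup>2 * W ^ (2 * s))) \<le> ln (real (2 ^ (R div 4)))"
      using 1 2 3 4 5 by linarith
    then have "real (512 * R\<^sup>2 * W ^ (2 * s)) \<le> real (2 ^ (R div 4))"
      using R' W by (subst (asm) ln_le_cancel_iff) auto
    then show "512 * R\<^sup>2 * W ^ (2 * s) \<le> 2 ^ (R div 4)" by (simp only: of_nat_le_iff)
  qed
qed

lemma card_large_prime_factors:
  fixes k m0 :: nat
  assumes "k > 0"
  shows "(m0 + 1) ^ card {m\<in>prime_factors k. m0 < m} \<le> k"
proof -
  let ?B = "{m\<in>prime_factors k. m0 < m}"
  have "(m0 + 1) ^ card ?B = (\<Prod>m\<in>?B. m0 + 1)" by simp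
  also have "\<dots> \<le> (\<Prod>m\<in>?B. m)" by (intro prod_mono) auto
  also have "(\<Prod>m\<in>?B. m) \<le> k"
  proof (rule dvd_imp_le)
    have "(\<Prod>m\<in>?B. m) dvd (\<Prod>m\<in>prime_factors k. m)" by (rule prod_dvd_prod_subset) auto
    also have "\<dots> dvd (\<Prod>m\<in>prime_factors k. m ^ multiplicity m k)"
      by (intro prod_dvd_prod dvd_power) (auto simp: prime_factors_multiplicity)
    also have "\<dots> = k" using assms by (simp add: prod_prime_factors)
    finally show "(\<Prod>m\<in>?B. m) dvd k" .
  qed (use assms in simp)
  finally show ?thesis .
qed

text \<open>The set \<open>Lo\<close> of about \<open>x / 16\<close> generators has at least
  \<open>(x / 16 - 1) powr 2.49\<close> subset sums, half of which lie in the grid, whereas the grid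
  bound is of order below \<open>x powr 2.48\<close>.\<close>

lemma no_large_cube:
  assumes "\<delta> > 0"
  shows "\<forall>\<^sub>F x in at_top. \<forall>d (A :: nat set) N a0 p. x = real d \<longrightarrow> A \<subseteq> {1..N} \<longrightarrow> card A = d \<longrightarrow>
    ln (real N) \<le> x powr 1.001 \<longrightarrow> prime p \<longrightarrow> real p \<le> x powr (1 - \<delta>) \<longrightarrow> p dvd a0 \<longrightarrow> a0 > 0 \<longrightarrow>
    \<not> (+) a0 ` subset_sums A \<subseteq> perfect_powers"
proof -
  obtain dg where dg: "\<forall>d\<ge>dg. \<forall>(A :: nat set) N a0. A \<subseteq> {1..N} \<longrightarrow> card A = d \<longrightarrow>
     ln (real N) \<le> real d powr 1.002 \<longrightarrow> (+) a0 ` subset_sums A \<subseteq> perfect_powers \<longrightarrow>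
     real d powr 2.49 \<le> card (subset_sums A)"
    using card_subset_sums_lower_bound unfolding eventually_sequentially by (rule exE)
  have e1: "\<forall>\<^sub>F x::real in at_top. (2 + 40603 * (3 * ln x + 1)) * x powr (1 - \<delta>) \<le> x / 100"
    using assms by real_asymp
  have e2: "\<forall>\<^sub>F x::real in at_top. 40603 * (3 * ln x + 1) \<le> x powr (1 / 1000000)" by real_asymp
  have e3: "\<forall>\<^sub>F x::real in at_top. x powr 1.001 \<le> (x / 16 - 1) powr 1.002" by real_asymp
  \<comment> \<open>The first term bounds the points with a frequent large exponent. The second is
    \<open>Y powr (1 + rexp)\<close> for \<open>Y = L * m0 \<le> 2 * x powr 1.008\<close>, with room
    for the logarithms.\<close>
  have e4: "\<forall>\<^sub>F x::real in at_top. 1608 * x powr 2.005 + 4 * x powr (1 / 500000) * (2 * x powr 1.008) powr 2.45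
      < (x / 16 - 1) powr 2.49 / 2" by real_asymp
  have e5: "\<forall>\<^sub>F x::real in at_top. x powr 1.003 + 1 \<le> x powr 1.01" by real_asymp
  have e6: "\<forall>\<^sub>F x::real in at_top. 2 * x powr 1.001 < x powr 1.01" by real_asymp
  have e7: "\<forall>\<^sub>F x::real in at_top. 2 + 2 * ln x + 2 * x powr 1.001 \<le> 5 * x powr 1.001" by real_asymp
  have e8: "\<forall>\<^sub>F x::real in at_top. 2 * x powr 1.001 < (x / 16 - 1) powr 2.49 / 2" by real_asymp
  have e9: "\<forall>\<^sub>F x::real in at_top. x \<ge> 16 * real dg + 1000" by (rule eventually_ge_at_top)
  show ?thesis
    using e1 e2 e3 e4 e5 e6 e7 e8 e9 big_power_condition
  proof eventually_elim
    case (elim x)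
    show ?case
    proof (intro allI impI notI)
      fix d :: nat and A :: "nat set" and N a0 p :: nat
      assume d: "x = real d" and A: "A \<subseteq> {1..N}" "card A = d" and N: "ln (real N) \<le> x powr 1.001"
        and p: "prime p" "real p \<le> x powr (1 - \<delta>)" "p dvd a0" "a0 > 0"
        and PP: "(+) a0 ` subset_sums A \<subseteq> perfect_powers"
      have x: "x \<ge> 16 * real dg + 1000" "x \<ge> 1000" using elim(9) by auto
      have lnx: "ln x > 0" using x by simp
      \<comment> \<open>As \<open>3 * ln 2 \<ge> 2\<close>, this makes
        \<open>2 ^ s0 \<ge> x powr 2 \<ge> L\<close>. Below, \<open>40602 = 201 * 202\<close>: at
        most 201 prime factors of \<open>k\<close> exceed \<open>m0\<close>, and the 202nd power of
        each is at least \<open>x powr 1.01 \<ge> L\<close>.\<close>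
      define s0 where "s0 = nat \<lceil>3 * ln x\<rceil>"
      define s where "s = (40602 + 1) * s0"
      \<comment> \<open>The grid consumes \<open>9 * n \<le> 9 * d / 16\<close> generators, which
        leaves ample room for the terms with \<open>p\<close>.\<close>
      define n where "n = d div 16"
      define L where "L = nat \<lceil>x powr 1.003\<rceil>"
      define m0 where "m0 = nat \<lfloor>x powr 0.005\<rfloor>"
      have s0: "3 * ln x \<le> s0" "s0 \<le> 3 * ln x + 1"
        unfolding s0_def using lnx by (auto intro!: nat_ceiling_bounds)
      have s_le: "real s \<le> 40603 * (3 * ln x + 1)" using s0(2) by (simp add: s_def)
      then have s_small: "real s \<le> x powr (1 / 1000000)" using elim(2) by linarith
      have n: "x / 16 - 1 \<le> real n" "real n \<le> x / 16"
      proof -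
        have "d < 16 * n + 16" "16 * n \<le> d" unfolding n_def by presburger+
        then have "real d < real (16 * n + 16)" "real (16 * n) \<le> real d" by (simp_all only: of_nat_less_iff of_nat_le_iff)
        then show "x / 16 - 1 \<le> real n" "real n \<le> x / 16" using d by simp_all
      qed
      have ndg: "n \<ge> dg" "n \<ge> 1" using n(1) x by linarith+
      have L: "x powr 1.003 \<le> L" "L \<le> x powr 1.003 + 1"
        unfolding L_def by (auto intro!: nat_ceiling_bounds)
      have m0: "m0 \<le> x powr 0.005" "x powr 0.005 \<le> real m0 + 1"
        unfolding m0_def by (auto intro!: nat_floor_bounds)
      have "1 \<le> x powr 1.003" using x by (simp add: ge_one_powr_ge_zero)
      then have L2: "real L \<le> 2 * x powr 1.003" using L by linarith
      have "x \<le> x powr 1.003" using powr_mono[of 1 "1.003" x] x by simp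
      then have L1: "L > 1" using L x by linarith
      have size: "2 * p + 1 + 9 * n + s * p \<le> card A"
      proof -
        have "real (2 * p + s * p) \<le> (2 + 40603 * (3 * ln x + 1)) * x powr (1 - \<delta>)"
          using s_le p(2) lnx by (simp add: distrib_right[symmetric] mult_mono)
        also have "\<dots> \<le> x / 100" by (rule elim(1))
        finally have "real (2 * p + 1 + 9 * n + s * p) \<le> real d" using n(2) x d by simp
        then show ?thesis using A(2) by (simp only: of_nat_le_iff)
      qed
      obtain Lo C \<beta> X k where Lo: "Lo \<subseteq> A" "card Lo = n" and C: "C \<subseteq> subset_sums Lo" "card (subset_sums Lo) \<le> 2 * card C"
        and k: "k > 0" "2 ^ k \<le> N" and inj: "inj_on \<beta> {..<s}" and X: "X > 0"
        and \<beta>: "\<And>i. i < s \<Longrightarrow> X \<le> \<beta> i \<and> a0 \<le> \<beta> i \<and> \<beta> i \<le> a0 + card A * N"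
        and C8: "\<And>c. c \<in> C \<Longrightarrow> 8 * c \<le> X"
        and pow: "\<And>c i. c \<in> C \<Longrightarrow> i < s \<Longrightarrow> \<exists>m\<in>prime_factors k. \<exists>y. \<beta> i + c = y ^ m"
        by (rule exists_grid[OF A(1) p(1,3,4) PP size ndg(2)]) blast
      have finLo: "finite Lo" using Lo(1) A(1) by (meson finite_atLeastAtMost finite_subset)
      have finC: "finite C" using C(1) finLo finite_subset finite_subset_sums by blast
      have "real n powr 2.49 \<le> card (subset_sums Lo)"
      proof (rule dg[rule_format, OF ndg(1) _ Lo(2)])
        show "Lo \<subseteq> {1..N}" using Lo(1) A(1) by blast
        have "x powr 1.001 \<le> (x / 16 - 1) powr 1.002" by (rule elim(3))
        also have "\<dots> \<le> real n powr 1.002" using n(1) x by (intro powr_mono2) auto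
        finally show "ln (real N) \<le> real n powr 1.002" using N by linarith
        show "(+) a0 ` subset_sums Lo \<subseteq> perfect_powers" using PP subset_sums_mono[OF Lo(1)] by blast
      qed
      moreover have "(x / 16 - 1) powr 2.49 \<le> real n powr 2.49" using n(1) x by (intro powr_mono2) auto
      moreover have "real (card (subset_sums Lo)) \<le> 2 * real (card C)" using C(2) by linarith
      ultimately have cC: "(x / 16 - 1) powr 2.49 / 2 \<le> card C" by linarith
      have N1: "N \<ge> 1" using k(2) by (metis One_nat_def Suc_leI le_trans zero_less_numeral zero_less_power)
      have "real (2 ^ k) \<le> real N" using k(2) by (rule of_nat_mono)
      then have "ln (2 ^ k) \<le> ln (real N)" by (intro ln_mono) auto
      then have "k * ln 2 \<le> ln (real N)" by (simp add: ln_realpow)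
      moreover have "real k * (1 / 2) \<le> real k * ln 2" using ln2_ge_two_thirds by (intro mult_left_mono) auto
      ultimately have k_le: "real k \<le> 2 * x powr 1.001" using N by linarith
      have pf: "prime m \<and> m \<le> k" if "m \<in> prime_factors k" for m
        using that k(1) by (auto simp: prime_factors_dvd dest: dvd_imp_le)
      have s_pos: "s > 0" using s0(1) lnx by (auto simp: s_def intro!: Nat.gr0I)
      show False
      \<comment> \<open>The bound on \<open>ln W\<close> needs \<open>a0\<close> to be polynomial in
        \<open>d * N\<close>. For larger \<open>a0\<close> there is at most one \<open>c\<close> per
        prime factor of \<open>k\<close>, far too few.\<close>
      proof (cases "a0 > (d * N)\<^sup>2")
        case True
        have "card C \<le> card (prime_factors k)"
        proof (rule card_powers_in_short_interval[of _ _ "\<beta> 0" "d * N"])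
          show "m \<ge> 2" if "m \<in> prime_factors k" for m using pf[OF that] prime_ge_2_nat by blast
          show "\<exists>m\<in>prime_factors k. \<exists>y. \<beta> 0 + c = y ^ m" if "c \<in> C" for c using pow[OF that s_pos] .
          show "(d * N)\<^sup>2 < \<beta> 0" using True \<beta>[OF s_pos] by linarith
          fix c assume "c \<in> C"
          then have "c \<in> \<Sum> ` Pow Lo" using C(1) by (auto simp: subset_sums_def)
          then obtain S where "c = \<Sum>S" "S \<in> Pow Lo" by (rule imageE)
          then have S: "S \<subseteq> A" "c = \<Sum>S" using Lo(1) by auto
          have finA: "finite A" using A(1) finite_subset by blast
          have "c \<le> (\<Sum>a\<in>S. N)" unfolding S(2) using S(1) A(1) by (intro sum_mono) auto
          also have "\<dots> \<le> d * N" using card_mono[OF finA S(1)] A(2) by simp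
          finally show "c \<le> d * N" .
        qed simp
        also have "\<dots> \<le> card {1..k}"
        proof (rule card_mono)
          show "prime_factors k \<subseteq> {1..k}"
          proof
            fix m assume "m \<in> prime_factors k"
            then show "m \<in> {1..k}" using pf[of m] prime_ge_1_nat[of m] by simp
          qed
        qed simp
        finally have "card C \<le> k" by simp
        then have "real (card C) \<le> real k" by (rule of_nat_mono)
        then show False using cC k_le elim(8) by linarith
      next
        case False
        define W where "W = 2 * (a0 + d * N)"
        have dN: "d * N \<ge> 1" using N1 x d by (cases d) auto
        have "W \<le> 4 * (d * N)\<^sup>2"
        proof -
          have "d * N \<le> (d * N)\<^sup>2" using dN by (simp add: power2_eq_square)
          then have "a0 + d * N \<le> (d * N)\<^sup>2 + (d * N)\<^sup>2" using False by (intro add_mono) auto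
          then show ?thesis unfolding W_def by simp
        qed
        then have "real W \<le> real (4 * (d * N)\<^sup>2)" by (rule of_nat_mono)
        moreover have W0: "W > 0" using p(4) by (simp add: W_def)
        ultimately have "ln (real W) \<le> ln (real (4 * (d * N)\<^sup>2))" by (intro ln_mono) auto
        also have "\<dots> = ln 4 + 2 * ln x + 2 * ln (real N)"
          using N1 x d by (simp add: ln_mult ln_realpow)
        also have "\<dots> \<le> 5 * x powr 1.001"
        proof -
          have "ln 4 \<le> (2::real)"
          proof -
            have "ln (4::real) = 2 * ln 2" using ln_realpow[of 2 2] by simp
            moreover have "ln (2::real) \<le> 1" using ln_le_minus_one[of 2] by simp
            ultimately show ?thesis by linarith
          qed
          then show ?thesis using elim(7) N by linarith
        qed
        finally have lnW: "ln (real W) \<le> 5 * x powr 1.001" .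
        define B where "B = {m\<in>prime_factors k. m0 < m}"
        have cB: "card B \<le> 201"
        proof (rule ccontr)
          assume "\<not> card B \<le> 201"
          then have "x powr 1.01 \<le> (real m0 + 1) ^ card B"
          proof -
            have "x powr 1.01 = (x powr 0.005) ^ 202" using x by (simp add: powr_power)
            also have "\<dots> \<le> (real m0 + 1) ^ 202" using m0(2) by (intro power_mono) auto
            also have "\<dots> \<le> (real m0 + 1) ^ card B"
              using \<open>\<not> card B \<le> 201\<close> by (intro power_increasing) auto
            finally show ?thesis .
          qed
          also have "\<dots> = real ((m0 + 1) ^ card B)" by (simp add: add.commute)
          also have "\<dots> \<le> real k" using card_large_prime_factors[OF k(1), of m0] unfolding B_def by (rule of_nat_mono)
          finally show False using k_le elim(6) by linarith
        qed
        have "real (card C) \<le> card {m\<in>prime_factors k. m0 < m} * (s ^ 202 * (2 * s * (L * k))) +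
            real (40602 + 1) * ((s0 + 1) * (real (L * m0) powr rexp * (2 * s * (L * m0))))"
        proof (rule card_grid_le[where r = X and W = W and M = "prime_factors k" and \<beta> = \<beta> and \<kappa> = 202
              and ?t0.0 = 40602 and ?s0.0 = s0 and K = k and C = C and L = L and ?m0.0 = m0, folded s_def])
          show "finite C" by (rule finC)
          show "prime m \<and> m \<le> k" if "m \<in> prime_factors k" for m by (rule pf[OF that])
          show "\<exists>m\<in>prime_factors k. \<exists>y. \<beta> i + c = y ^ m" if "c \<in> C" "i < s" for c i by (rule pow[OF that])
          show "inj_on \<beta> {..<s}" by (rule inj)
          show "X > 0" by (rule X)
          show "X \<le> \<beta> i \<and> \<beta> i + X \<le> W" if "i < s" for i
            using \<beta>[OF that] A(2) unfolding W_def by auto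
          show "8 * c \<le> X" if "c \<in> C" for c by (rule C8[OF that])
          show "1 < L" by (rule L1)
          show "512 * R\<^sup>2 * W ^ (2 * s) \<le> 2 ^ (R div 4)" if "L \<le> R" for R
          proof (rule elim(10)[rule_format, OF _ W0 s_small lnW])
            show "x powr 1.003 \<le> real R" using L(1) that by linarith
          qed
          show "L \<le> 2 ^ s0"
          proof -
            have "x powr 1.01 \<le> x powr 2" using x by (intro powr_mono) auto
            also have "\<dots> = exp (2 * ln x)" using x by (simp add: powr_def)
            also have "\<dots> \<le> exp (s0 * ln 2)"
            proof -
              have "2 * ln x \<le> (3 * ln x) * ln 2"
                using mult_left_mono[OF ln2_ge_two_thirds, of "3 * ln x"] lnx by simp
              also have "\<dots> \<le> s0 * ln 2" using s0(1) by (intro mult_right_mono) auto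
              finally show ?thesis by simp
            qed
            also have "\<dots> = 2 ^ s0" by (simp add: exp_of_nat_mult)
            finally have "real L \<le> 2 ^ s0" using L(2) elim(5) by linarith
            then have "real L \<le> real (2 ^ s0)" by (simp only: of_nat_power of_nat_numeral)
            then show ?thesis by (simp only: of_nat_le_iff)
          qed
          show "L \<le> m ^ 202" if "m \<in> prime_factors k" "m0 < m" for m
          proof -
            have "x powr 1.01 = (x powr 0.005) ^ 202" using x by (simp add: powr_power)
            also have "\<dots> \<le> real m ^ 202" using m0(2) that(2) by (intro power_mono) auto
            finally have "real L \<le> real m ^ 202" using L(2) elim(5) by linarith
            then have "real L \<le> real (m ^ 202)" by (simp only: of_nat_power)
            then show ?thesis by (simp only: of_nat_le_iff)
          qed
          show "card {m \<in> prime_factors k. m0 < m} * 202 \<le> 40602" using cB by (simp add: B_def)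
        qed simp
        also have "real (card {m\<in>prime_factors k. m0 < m} * (s ^ 202 * (2 * s * (L * k)))) \<le> 1608 * x powr 2.005"
        proof -
          have "real s ^ 203 \<le> (x powr (1 / 1000000)) ^ 203" using s_small by (intro power_mono) auto
          also have "\<dots> = x powr (203 / 1000000)" using x by (simp add: powr_power)
          finally have s203: "real s ^ 203 \<le> x powr (203 / 1000000)" .
          have "real (card {m\<in>prime_factors k. m0 < m} * (s ^ 202 * (2 * s * (L * k)))) =
              real (card B) * (2 * (real s ^ 203 * (real L * real k)))"
            unfolding B_def by (simp add: power_Suc[of "real s" 202, simplified] mult_ac)
          also have "\<dots> \<le> 201 * (2 * (x powr (203 / 1000000) * ((2 * x powr 1.003) * (2 * x powr 1.001))))"
            using cB s203 L2 k_le by (intro mult_mono) auto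
          also have "\<dots> = 1608 * (x powr (203 / 1000000) * (x powr 1.003 * x powr 1.001))" by simp
          also have "x powr (203 / 1000000) * (x powr 1.003 * x powr 1.001) = x powr (203 / 1000000 + (1.003 + 1.001))"
            by (simp only: powr_add)
          also have "1608 * x powr (203 / 1000000 + (1.003 + 1.001)) \<le> 1608 * x powr 2.005"
            using x by (intro mult_left_mono powr_mono) auto
          finally show ?thesis .
        qed
        also have "real (40602 + 1) * (real (s0 + 1) * (real (L * m0) powr rexp * real (2 * s * (L * m0)))) \<le>
            4 * x powr (1 / 500000) * (2 * x powr 1.008) powr 2.45"
        proof -
          define Y where "Y = real (L * m0)"
          have "1 \<le> x powr 0.005" using x by (simp add: ge_one_powr_ge_zero)
          then have "m0 \<ge> 1" unfolding m0_def by (simp add: le_nat_iff le_floor_iff)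
          then have Y0: "Y > 0" using L1 by (simp add: Y_def)
          have "Y \<le> (2 * x powr 1.003) * x powr 0.005" unfolding Y_def of_nat_mult
            using L2 m0(1) by (intro mult_mono) auto
          also have "\<dots> = 2 * x powr 1.008" using powr_add[of x "1.003" "0.005"] by simp
          finally have Y: "Y \<le> 2 * x powr 1.008" .
          have s0s: "real (40602 + 1) * real (s0 + 1) \<le> 2 * real s"
          proof -
            have "s0 \<ge> 1" using s_pos by (cases s0) (auto simp: s_def)
            then show ?thesis by (simp add: s_def)
          qed
          have "real (40602 + 1) * (real (s0 + 1) * (real (L * m0) powr rexp * real (2 * s * (L * m0)))) =
              (real (40602 + 1) * real (s0 + 1)) * (2 * real s) * (Y powr rexp * Y powr 1)"
            using Y0 by (simp add: Y_def mult_ac)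
          also have "\<dots> \<le> (2 * real s) * (2 * real s) * (Y powr rexp * Y powr 1)"
            using s0s by (intro mult_right_mono) auto
          also have "\<dots> = 4 * (real s * real s) * Y powr 2.45"
            using powr_add[of Y rexp 1] by (simp add: rexp_def)
          also have "\<dots> \<le> 4 * (x powr (1 / 1000000) * x powr (1 / 1000000)) * (2 * x powr 1.008) powr 2.45"
            using s_small Y Y0 by (intro mult_mono powr_mono2) auto
          also have "\<dots> = 4 * x powr (1 / 500000) * (2 * x powr 1.008) powr 2.45"
            using powr_add[of x "1 / 1000000" "1 / 1000000"] by simp
          finally show ?thesis .
        qed
        finally have "real (card C) \<le> 1608 * x powr 2.005 + 4 * x powr (1 / 500000) * (2 * x powr 1.008) powr 2.45"
          by simp
        then show False using elim(4) cC by linarith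
      qed
    qed
  qed
qed

text \<open>For \<open>t = ln N powr (1 - c')\<close> the hypotheses read
  \<open>p \<le> t powr (1 - \<delta>)\<close> and \<open>ln N \<le> t powr 1.001\<close>. More than
  \<open>2 * t\<close> generators would include about \<open>t\<close> of them spanning a cube
  excluded by \<open>no_large_cube\<close>; for small \<open>N\<close> the bound
  \<open>d \<le> N\<close> suffices.\<close>

theorem theorem2p7:
  fixes c :: real
  assumes "c > 0"
  shows "\<exists>c' > 0. \<exists>C > 0. \<forall>(N :: nat) (a0 :: nat) (d :: nat) (a :: nat \<Rightarrow> nat).
           a0 > 0 \<longrightarrow>
           (\<exists>p. prime p \<and> p dvd a0 \<and> real p \<le> ln (real N) powr (1 - c)) \<longrightarrow>
           a ` {1..d} \<subseteq> {1..N} \<longrightarrow>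
           inj_on a {1..d} \<longrightarrow>
           hilbert_cube a0 a d \<subseteq> perfect_powers \<longrightarrow>
           real d \<le> C * ln (real N) powr (1 - c')"
proof -
  \<comment> \<open>The cap \<open>1 / 2\<close> keeps \<open>1 - b\<close> positive,
    \<open>c' < b\<close> makes \<open>\<delta>\<close> positive, and
    \<open>c' \<le> 1 / 2000\<close> gives \<open>1 / (1 - c') \<le> 1.001\<close>. The choice of
    \<open>\<delta>\<close> makes \<open>t powr (1 - \<delta>)\<close> equal to
    \<open>ln N powr (1 - b)\<close>.\<close>
  define b where "b = min c (1 / 2)"
  define c' where "c' = min (b / 2) (1 / 2000)"
  define \<delta> where "\<delta> = 1 - (1 - b) / (1 - c')"
  have b: "0 < b" "b \<le> 1 / 2" "b \<le> c" using assms by (auto simp: b_def)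
  have c': "0 < c'" "c' \<le> 1 / 2000" "c' < b" using b by (auto simp: c'_def)
  have "(1 - b) / (1 - c') < 1" using c' by (simp add: divide_less_eq)
  then have \<delta>: "\<delta> > 0" by (simp add: \<delta>_def)
  obtain x0 where x0: "\<forall>x\<ge>x0. \<forall>d (A :: nat set) N a0 p. x = real d \<longrightarrow> A \<subseteq> {1..N} \<longrightarrow> card A = d \<longrightarrow>
    ln (real N) \<le> x powr 1.001 \<longrightarrow> prime p \<longrightarrow> real p \<le> x powr (1 - \<delta>) \<longrightarrow> p dvd a0 \<longrightarrow> a0 > 0 \<longrightarrow>
    \<not> (+) a0 ` subset_sums A \<subseteq> perfect_powers"
    using no_large_cube[OF \<delta>] unfolding eventually_at_top_linorder by (rule exE)
  define l0 where "l0 = max 1 (max 0 x0 powr (1 / (1 - c')))"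
  define N0 where "N0 = nat \<lceil>exp l0\<rceil>"
  define C where "C = 2 * real N0 + 2"
  have "real d \<le> C * ln (real N) powr (1 - c')"
    if a0: "a0 > 0" and p: "prime p" "p dvd a0" "real p \<le> ln (real N) powr (1 - c)"
      and a: "a ` {1..d} \<subseteq> {1..N}" "inj_on a {1..d}" and H: "hilbert_cube a0 a d \<subseteq> perfect_powers"
    for N a0 d p :: nat and a
  proof -
    define A where "A = a ` {1..d}"
    have A: "A \<subseteq> {1..N}" "card A = d" "finite A"
      using a by (auto simp: A_def card_image)
    have PP: "(+) a0 ` subset_sums A \<subseteq> perfect_powers"
      using H unfolding hilbert_cube_eq[OF a(2)] A_def .
    have dN: "d \<le> N" using card_mono[OF _ A(1)] A(2) by simp
    have p2: "real p \<ge> 2" using prime_ge_2_nat[OF p(1)] by simp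
    \<comment> \<open>\<open>ln 0\<close>, \<open>ln 1\<close> and every power
      \<open>0 powr _\<close> are 0, so \<open>N \<le> 1\<close> would contradict
      \<open>p \<ge> 2\<close>.\<close>
    have "ln (real N) \<noteq> 0" using p2 p(3) by auto
    then have N2: "N \<ge> 2" by (cases "N = 0"; cases "N = 1") auto
    then have "ln 2 \<le> ln (real N)" by (intro ln_mono) auto
    then have lnN: "ln (real N) \<ge> 1 / 2" using ln2_ge_two_thirds by linarith
    define l where "l = ln (real N)"
    show ?thesis
    proof (cases "l \<ge> l0")
      case False
      have "real N = exp l" using N2 by (simp add: l_def)
      also have "\<dots> \<le> exp l0" using False by simp
      also have "\<dots> \<le> real N0" unfolding N0_def by (rule real_nat_ceiling_ge)
      finally have "real d \<le> real N0" using dN by linarith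
      also have "\<dots> \<le> C * (1 / 2)" by (simp add: C_def)
      also have "\<dots> \<le> C * l powr (1 - c')"
      proof (rule mult_left_mono)
        have "(1 / 2 :: real) = (1 / 2) powr 1" by simp
        also have "\<dots> \<le> (1 / 2) powr (1 - c')" using c' by (intro powr_mono') auto
        also have "\<dots> \<le> l powr (1 - c')" using lnN c' by (intro powr_mono2) (auto simp: l_def)
        finally show "1 / 2 \<le> l powr (1 - c')" .
      qed (simp add: C_def)
      finally show ?thesis by (simp add: l_def)
    next
      case True
      have l1: "l \<ge> 1" using True by (simp add: l0_def)
      define t where "t = l powr (1 - c')"
      have t1: "t \<ge> 1" unfolding t_def using l1 c' by (simp add: ge_one_powr_ge_zero)
      have l_eq: "l = t powr (1 / (1 - c'))" using l1 c' by (simp add: t_def powr_powr)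
      have "max 0 x0 = (max 0 x0 powr (1 / (1 - c'))) powr (1 - c')"
        using c' by (simp add: powr_powr)
      also have "\<dots> \<le> t" unfolding t_def using True c' by (intro powr_mono2) (auto simp: l0_def)
      finally have t0: "x0 \<le> t" by simp
      have "real d \<le> 2 * t"
      proof (rule ccontr)
        assume neg: "\<not> real d \<le> 2 * t"
        define e where "e = nat \<lceil>t\<rceil>"
        have e: "t \<le> e" "e \<le> t + 1" unfolding e_def using t1 by (auto intro!: nat_ceiling_bounds)
        have "e \<le> card A" using e(2) neg t1 A(2) by linarith
        then obtain A' where A': "A' \<subseteq> A" "card A' = e" by (rule obtain_subset_with_card_n)
        have "\<not> (+) a0 ` subset_sums A' \<subseteq> perfect_powers"
        proof (rule x0[rule_format, of "real e" e A' N p])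
          show "x0 \<le> real e" using t0 e(1) by linarith
          show "A' \<subseteq> {1..N}" using A' A by blast
          have "l \<le> t powr 1.001" unfolding l_eq
            using t1 c' by (intro powr_mono) (auto simp: divide_le_eq)
          also have "\<dots> \<le> real e powr 1.001" using e t1 by (intro powr_mono2) auto
          finally show "ln (real N) \<le> real e powr 1.001" by (simp add: l_def)
          have "real p \<le> l powr (1 - c)" using p(3) by (simp add: l_def)
          also have "\<dots> \<le> l powr (1 - b)" using l1 b by (intro powr_mono) auto
          also have "\<dots> = t powr (1 - \<delta>)" unfolding t_def using c' by (simp add: \<delta>_def powr_powr)
          also have "\<dots> \<le> real e powr (1 - \<delta>)"
            using e t1 b c' by (intro powr_mono2) (auto simp: \<delta>_def)
          finally show "real p \<le> real e powr (1 - \<delta>)" .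
        qed (use A' p a0 in auto)
        moreover have "(+) a0 ` subset_sums A' \<subseteq> perfect_powers" using PP subset_sums_mono[OF A'(1)] by blast
        ultimately show False by simp
      qed
      also have "\<dots> \<le> C * t" using t1 by (intro mult_right_mono) (auto simp: C_def)
      finally show ?thesis by (simp add: t_def l_def)
    qed
  qed
  then show ?thesis using c'(1) by (intro exI[of _ c'] conjI exI[of _ C]) (auto simp: C_def)
qed

end
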